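(* There exists a family of five closed flat $2$-dimensional orbifolds that are mutually $1$-isospectral, no two of which are $0$-isospectral, and that have different types of singularities, such that: (1) One of them can be viewed as a Euclidean square with absolute boundary conditions: its underlying space is a Euclidean square, and its $1$-spectrum as an orbifold coincides with the $1$-spectrum of the square with absolute boundary conditions. (2) The underlying spaces of the various orbifolds include a sphere, a projective plane, and disks. (3) Some of the orbifolds have reflector edges, of various lengths, while another has only cone points as singularities. Thus the family contains both locally orientable and non-locally orientable orbifolds.
   Context: All orbifolds are connected and compact without boundary as orbifolds ("closed"). A closed flat $2$-orbifold is a quotient $\Sigma\backslash\mathbb{R}^2$ where $\Sigma$ is a discrete cocompact subgroup of the Euclidean motion group $\mathbb{R}^2\rtimes O(2)$. The isotropy group of a point is the linear part, in $O(2)$, of the stabilizer in $\Sigma$ of a lift of the point; a point is singular if its isotropy group is non-trivial. A cone point has isotropy group a non-trivial finite group of rotations; a reflector edge is a one-dimensional singular stratum (connected component of the set of points of a given isotropy type) whose isotropy group is generated by a reflection. An orbifold is locally orientable if all of its isotropy groups consist of orientation-preserving transformations (are subgroups of $SO(2)$). The $p$-spectrum of a closed Riemannian orbifold is the spectrum (with multiplicities) of the Hodge Laplacian acting on smooth $p$-forms; here, for $\Sigma\backslash\mathbb{R}^2$, smooth $p$-forms are the $\Sigma$-invariant smooth $p$-forms on $\mathbb{R}^2$. Two closed orbifolds are $p$-isospectral if they have the same $p$-spectrum. Absolute boundary conditions on a form $\omega$ require that the interior products with the unit normal $\nu$ satisfy $\iota_\nu\omega=0$ and $\iota_\nu d\omega=0$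 on the boundary. *)

theory Defs
  imports
    "HOL-Analysis.Analysis"
    "HOL-Library.Function_Algebras"
    "HOL-Algebra.Group"
begin

section \<open>Euclidean motions and flat 2-orbifolds\<close>

text \<open>The pair \<open>(t, A)\<close> stands for the motion \<open>x \<mapsto> A x + t\<close>, so that \<open>snd\<close> is the linear part.
  Discreteness of a subgroup is taken in the topology of \<open>\<real>\<^sup>2 \<times> \<real>\<^sup>2\<^sup>\<times>\<^sup>2\<close>, which induces the
  Lie group topology on the motion group.\<close>

type_synonym plane = "real^2"
type_synonym motion = "(real^2) \<times> (real^2^2)"

definition act :: "motion \<Rightarrow> plane \<Rightarrow> plane" where
  "act g x = snd g *v x + fst g"

definition motion_group :: "motion monoid" where
  "motion_group = \<lparr>carrier = {g. orthogonal_matrix (snd g)},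
                   mult = (\<lambda>g h. (fst g + snd g *v fst h, snd g ** snd h)),
                   one = (0, mat 1)\<rparr>"

lemma act_mult: "act (g \<otimes>\<^bsub>motion_group\<^esub> h) x = act g (act h x)"
  by (simp add: act_def motion_group_def matrix_vector_mul_assoc matrix_vector_right_distrib
      add.commute add.left_commute)

lemma group_motion_group: "group motion_group"
proof (rule groupI)
  fix g assume g: "g \<in> carrier motion_group"
  let ?h = "(- (transpose (snd g) *v fst g), transpose (snd g))"
  have "?h \<otimes>\<^bsub>motion_group\<^esub> g = \<one>\<^bsub>motion_group\<^esub>"
    using g by (simp add: motion_group_def orthogonal_matrix)
  moreover have "?h \<in> carrier motion_group"
    using g by (simp add: motion_group_def orthogonal_matrix_transpose)
  ultimately show "\<exists>h\<in>carrier motion_group. h \<otimes>\<^bsub>motion_group\<^esub> g = \<one>\<^bsub>motion_group\<^esub>"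
    by blast
qed (auto simp: motion_group_def orthogonal_matrix_mul orthogonal_matrix_id
      matrix_vector_mul_assoc matrix_vector_right_distrib matrix_mul_assoc)

definition quotient_topology :: "'a topology \<Rightarrow> ('a \<Rightarrow> 'b) \<Rightarrow> 'b topology" where
  "quotient_topology X f =
     topology (\<lambda>U. U \<subseteq> f ` topspace X \<and> openin X {x \<in> topspace X. f x \<in> U})"

lemma openin_quotient_topology:
  "openin (quotient_topology X f) U \<longleftrightarrow>
     U \<subseteq> f ` topspace X \<and> openin X {x \<in> topspace X. f x \<in> U}"
proof -
  have "istopology (\<lambda>U. U \<subseteq> f ` topspace X \<and> openin X {x \<in> topspace X. f x \<in> U})"
    unfolding istopology_def
  proof (intro conjI allI impI)
    fix S T
    assume *: "S \<subseteq> f ` topspace X \<and> openin X {x \<in> topspace X. f x \<in> S}"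
      "T \<subseteq> f ` topspace X \<and> openin X {x \<in> topspace X. f x \<in> T}"
    show "S \<inter> T \<subseteq> f ` topspace X" using * by blast
    have "openin X ({x \<in> topspace X. f x \<in> S} \<inter> {x \<in> topspace X. f x \<in> T})"
      using * by (intro openin_Int) blast+
    moreover have "{x \<in> topspace X. f x \<in> S} \<inter> {x \<in> topspace X. f x \<in> T}
        = {x \<in> topspace X. f x \<in> S \<inter> T}" by blast
    ultimately show "openin X {x \<in> topspace X. f x \<in> S \<inter> T}" by (rule back_subst)
  next
    fix K
    assume *: "\<forall>S\<in>K. S \<subseteq> f ` topspace X \<and> openin X {x \<in> topspace X. f x \<in> S}"
    show "\<Union>K \<subseteq> f ` topspace X" using * by blast
    have "openin X (\<Union>S\<in>K. {x \<in> topspace X. f x \<in> S})"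
      using * by (intro openin_Union) auto
    moreover have "(\<Union>S\<in>K. {x \<in> topspace X. f x \<in> S}) = {x \<in> topspace X. f x \<in> \<Union>K}"
      by blast
    ultimately show "openin X {x \<in> topspace X. f x \<in> \<Union>K}" by (rule back_subst)
  qed
  then show ?thesis unfolding quotient_topology_def by (simp only: topology_inverse')
qed

lemma topspace_quotient_topology: "topspace (quotient_topology X f) = f ` topspace X"
proof -
  have "openin (quotient_topology X f) (f ` topspace X)"
    by (simp add: openin_quotient_topology Collect_conj_eq Int_absorb2 image_eqI subset_iff)
  then show ?thesis
    by (meson openin_quotient_topology openin_subset openin_topspace subset_antisym)
qed

lemma quotient_map_quotient_topology: "quotient_map X (quotient_topology X f) f"
  by (simp add: quotient_map_def topspace_quotient_topology openin_quotient_topology)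

definition motion_orbit :: "motion set \<Rightarrow> plane \<Rightarrow> plane set" where
  "motion_orbit \<Sigma> x = (\<lambda>g. act g x) ` \<Sigma>"

definition orbifold_points :: "motion set \<Rightarrow> plane set set" where
  "orbifold_points \<Sigma> = range (motion_orbit \<Sigma>)"

definition underlying_space :: "motion set \<Rightarrow> plane set topology" where
  "underlying_space \<Sigma> = quotient_topology euclidean (motion_orbit \<Sigma>)"

text \<open>The orbifold \<open>\<Sigma>\<setminus>\<real>\<^sup>2\<close> is represented by \<open>\<Sigma>\<close>.\<close>

definition closed_flat_2_orbifold :: "motion set \<Rightarrow> bool" where
  "closed_flat_2_orbifold \<Sigma> \<longleftrightarrow>
     subgroup \<Sigma> motion_group \<and> discrete \<Sigma> \<and> compact_space (underlying_space \<Sigma>)"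

section \<open>Singularities\<close>

definition isotropy :: "motion set \<Rightarrow> plane \<Rightarrow> (real^2^2) set" where
  "isotropy \<Sigma> x = snd ` {g \<in> \<Sigma>. act g x = x}"

text \<open>The isotropy group at a point \<open>P\<close> of the orbifold depends on the lift \<open>x \<in> P\<close> only up to
  conjugation; its isotropy type is the conjugacy class in \<open>O(2)\<close>.\<close>

definition isotropy_type :: "motion set \<Rightarrow> plane set \<Rightarrow> (real^2^2) set set" where
  "isotropy_type \<Sigma> P =
     {(\<lambda>A. B ** A ** transpose B) ` isotropy \<Sigma> x | B x. x \<in> P \<and> orthogonal_matrix B}"

definition singular_point :: "motion set \<Rightarrow> plane set \<Rightarrow> bool" where
  "singular_point \<Sigma> P \<longleftrightarrow> P \<in> orbifold_points \<Sigma> \<and> (\<forall>x\<in>P. isotropy \<Sigma> x \<noteq> {mat 1})"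

definition singularity_types :: "motion set \<Rightarrow> (real^2^2) set set set" where
  "singularity_types \<Sigma> = isotropy_type \<Sigma> ` {P. singular_point \<Sigma> P}"

definition cone_point :: "motion set \<Rightarrow> plane set \<Rightarrow> bool" where
  "cone_point \<Sigma> P \<longleftrightarrow> singular_point \<Sigma> P \<and>
     (\<forall>x\<in>P. finite (isotropy \<Sigma> x) \<and> (\<forall>A\<in>isotropy \<Sigma> x. rotation_matrix A))"

text \<open>In dimension two, the orthogonal matrices of determinant \<open>-1\<close> are exactly the reflections,
  and a stratum whose isotropy is generated by a reflection is one-dimensional.\<close>

definition reflector_edge :: "motion set \<Rightarrow> plane set set \<Rightarrow> bool" where
  "reflector_edge \<Sigma> E \<longleftrightarrow>
     (\<exists>T. E \<in> connected_components_of
            (subtopology (underlying_space \<Sigma>)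
               {P \<in> orbifold_points \<Sigma>. isotropy_type \<Sigma> P = T})) \<and>
     (\<forall>P\<in>E. \<forall>x\<in>P. \<exists>R. rotoinversion_matrix R \<and> isotropy \<Sigma> x = {mat 1, R})"

text \<open>A reflector edge lifts to a segment of a mirror line, so its length is read off from a
  bijective unit-speed straight parametrization: on an open interval when the edge is an open arc,
  on a half-open interval when it is a closed curve.\<close>

definition edge_length :: "motion set \<Rightarrow> plane set set \<Rightarrow> real \<Rightarrow> bool" where
  "edge_length \<Sigma> E l \<longleftrightarrow> l > 0 \<and>
     (\<exists>p u. norm u = 1 \<and>
        (bij_betw (\<lambda>t. motion_orbit \<Sigma> (p + t *\<^sub>R u)) {0<..<l} E \<or>
         bij_betw (\<lambda>t. motion_orbit \<Sigma> (p + t *\<^sub>R u)) {0..<l} E))"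

definition locally_orientable :: "motion set \<Rightarrow> bool" where
  "locally_orientable \<Sigma> \<longleftrightarrow> (\<forall>x. \<forall>A\<in>isotropy \<Sigma> x. rotation_matrix A)"

section \<open>Differential forms on the plane and the Hodge Laplacian\<close>

text \<open>The 1-form \<open>P dx + Q dy\<close> is the vector field \<open>(P, Q)\<close>, so that \<open>\<omega>\<^sub>x(v) = \<omega> x \<bullet> v\<close>, and the
  2-form \<open>h dx \<and> dy\<close> is the function \<open>h\<close>.\<close>

definition partial :: "2 \<Rightarrow> (plane \<Rightarrow> 'b::real_normed_vector) \<Rightarrow> plane \<Rightarrow> 'b" where
  "partial i f x = frechet_derivative f (at x) (axis i 1)"

primrec C_k :: "nat \<Rightarrow> (plane \<Rightarrow> 'b::real_normed_vector) \<Rightarrow> bool" where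
  "C_k 0 f \<longleftrightarrow> continuous_on UNIV f"
| "C_k (Suc k) f \<longleftrightarrow> (\<forall>x. f differentiable (at x)) \<and> (\<forall>i. C_k k (partial i f))"

definition smooth :: "(plane \<Rightarrow> 'b::real_normed_vector) \<Rightarrow> bool" where
  "smooth f \<longleftrightarrow> (\<forall>k. C_k k f)"

definition d0 :: "(plane \<Rightarrow> real) \<Rightarrow> plane \<Rightarrow> real^2" where
  "d0 f x = vector [partial 1 f x, partial 2 f x]"

definition d1 :: "(plane \<Rightarrow> real^2) \<Rightarrow> plane \<Rightarrow> real" where
  "d1 w x = partial 1 (\<lambda>y. w y $ 2) x - partial 2 (\<lambda>y. w y $ 1) x"

text \<open>The codifferentials are \<open>\<delta> = - \<star> d \<star>\<close> with \<open>\<star>dx = dy\<close>, \<open>\<star>dy = -dx\<close>, \<open>\<star>(dx \<and> dy) = 1\<close>.\<close>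

definition codiff1 :: "(plane \<Rightarrow> real^2) \<Rightarrow> plane \<Rightarrow> real" where
  "codiff1 w x = - (partial 1 (\<lambda>y. w y $ 1) x + partial 2 (\<lambda>y. w y $ 2) x)"

definition codiff2 :: "(plane \<Rightarrow> real) \<Rightarrow> plane \<Rightarrow> real^2" where
  "codiff2 h x = vector [partial 2 h x, - partial 1 h x]"

definition hodge_laplacian0 :: "(plane \<Rightarrow> real) \<Rightarrow> plane \<Rightarrow> real" where
  "hodge_laplacian0 f x = codiff1 (d0 f) x"

definition hodge_laplacian1 :: "(plane \<Rightarrow> real^2) \<Rightarrow> plane \<Rightarrow> real^2" where
  "hodge_laplacian1 w x = d0 (codiff1 w) x + codiff2 (d1 w) x"

section \<open>Spectra\<close>

text \<open>A spectrum with multiplicities is the function sending each real number to the dimension of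
  its eigenspace. By compactness all eigenspaces are finite-dimensional, so the convention that
  \<open>dim\<close> is \<open>0\<close> for infinite-dimensional spaces plays no role.\<close>

definition fun_scale :: "real \<Rightarrow> ('a \<Rightarrow> 'b::real_vector) \<Rightarrow> 'a \<Rightarrow> 'b" where
  "fun_scale c f = (\<lambda>x. c *\<^sub>R f x)"

lemma vector_space_fun_scale: "vector_space fun_scale"
  by unfold_locales (auto simp: fun_scale_def fun_eq_iff algebra_simps)

definition fun_dim :: "('a \<Rightarrow> 'b::real_vector) set \<Rightarrow> nat" where
  "fun_dim = vector_space.dim fun_scale"

text \<open>Invariance means \<open>g\<^sup>*\<omega> = \<omega>\<close> for all \<open>g \<in> \<Sigma>\<close>; on 1-forms
  \<open>(g\<^sup>*\<omega>)\<^sub>x(v) = \<omega>\<^bsub>g x\<^esub>(A v)\<close>, where \<open>A\<close> is the linear part of \<open>g\<close>.\<close>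

definition forms0 :: "motion set \<Rightarrow> (plane \<Rightarrow> real) set" where
  "forms0 \<Sigma> = {f. smooth f \<and> (\<forall>g\<in>\<Sigma>. \<forall>x. f (act g x) = f x)}"

definition forms1 :: "motion set \<Rightarrow> (plane \<Rightarrow> real^2) set" where
  "forms1 \<Sigma> = {w. smooth w \<and> (\<forall>g\<in>\<Sigma>. \<forall>x. transpose (snd g) *v w (act g x) = w x)}"

definition spectrum0 :: "motion set \<Rightarrow> real \<Rightarrow> nat" where
  "spectrum0 \<Sigma> ev = fun_dim {f \<in> forms0 \<Sigma>. \<forall>x. hodge_laplacian0 f x = ev * f x}"

definition spectrum1 :: "motion set \<Rightarrow> real \<Rightarrow> nat" where
  "spectrum1 \<Sigma> ev = fun_dim {w \<in> forms1 \<Sigma>. \<forall>x. hodge_laplacian1 w x = ev *\<^sub>R w x}"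

definition isospectral0 :: "motion set \<Rightarrow> motion set \<Rightarrow> bool" where
  "isospectral0 \<Sigma> \<Sigma>' \<longleftrightarrow> spectrum0 \<Sigma> = spectrum0 \<Sigma>'"

definition isospectral1 :: "motion set \<Rightarrow> motion set \<Rightarrow> bool" where
  "isospectral1 \<Sigma> \<Sigma>' \<longleftrightarrow> spectrum1 \<Sigma> = spectrum1 \<Sigma>'"

section \<open>The Euclidean square with absolute boundary conditions\<close>

definition square :: "real \<Rightarrow> plane set" where
  "square a = {x. \<forall>i. 0 \<le> x $ i \<and> x $ i \<le> a}"

text \<open>At a corner both normals of the adjacent sides are admitted; by continuity this imposes no
  further condition.\<close>

definition outward_normal :: "real \<Rightarrow> plane \<Rightarrow> plane \<Rightarrow> bool" where
  "outward_normal a x \<nu> \<longleftrightarrow> x \<in> square a \<and>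
     (\<exists>i. x $ i = 0 \<and> \<nu> = - axis i 1 \<or> x $ i = a \<and> \<nu> = axis i 1)"

text \<open>Interior products with \<open>\<nu>\<close> of a covector, and of \<open>h dx \<and> dy\<close>:
  \<open>\<iota>\<^sub>\<nu>(h dx \<and> dy) = h (\<nu>\<^sub>1 dy - \<nu>\<^sub>2 dx)\<close>.\<close>

definition interior_product1 :: "plane \<Rightarrow> real^2 \<Rightarrow> real" where
  "interior_product1 \<nu> w = w \<bullet> \<nu>"

definition interior_product2 :: "plane \<Rightarrow> real \<Rightarrow> real^2" where
  "interior_product2 \<nu> h = vector [- (h * \<nu> $ 2), h * \<nu> $ 1]"

definition absolute_bc :: "real \<Rightarrow> (plane \<Rightarrow> real^2) \<Rightarrow> bool" where
  "absolute_bc a w \<longleftrightarrow> (\<forall>x \<nu>. outward_normal a x \<nu> \<longrightarrow>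
     interior_product1 \<nu> (w x) = 0 \<and> interior_product2 \<nu> (d1 w x) = 0)"

text \<open>Smooth forms on the closed square are restrictions of smooth forms on the plane (extended
  here by zero outside the square); derivatives on the square, boundary included, do not depend on
  the smooth extension.\<close>

definition square_abs_spectrum1 :: "real \<Rightarrow> real \<Rightarrow> nat" where
  "square_abs_spectrum1 a ev = fun_dim
     {(\<lambda>x. if x \<in> square a then w x else 0) | w.
        smooth w \<and> absolute_bc a w \<and>
        (\<forall>x\<in>square a. hodge_laplacian1 w x = ev *\<^sub>R w x)}"

section \<open>Underlying spaces\<close>

text \<open>The quotient distance of two orbits is the infimum of the distances of their points.\<close>

definition isometric_to_square :: "motion set \<Rightarrow> real \<Rightarrow> bool" where
  "isometric_to_square \<Sigma> a \<longleftrightarrow>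
     (\<exists>\<phi>. bij_betw \<phi> (orbifold_points \<Sigma>) (square a) \<and>
        (\<forall>P\<in>orbifold_points \<Sigma>. \<forall>Q\<in>orbifold_points \<Sigma>. dist (\<phi> P) (\<phi> Q) = setdist P Q))"

definition sphere_space :: "(real^3) topology" where
  "sphere_space = top_of_set (sphere 0 1)"

definition projective_plane :: "(real^3) set topology" where
  "projective_plane = quotient_topology sphere_space (\<lambda>x. {x, - x})"

definition disk_space :: "(real^2) topology" where
  "disk_space = top_of_set (cball 0 1)"

end

theory Submission
  imports Defs
begin

text \<open>All five orbifolds have translation lattice \<open>(2\<pi>\<int>)\<^sup>2\<close> and a point group of order four containing
  \<open>-1\<close>, generated by \<open>-1\<close> and a further class \<open>A\<close> of trace zero: the wallpaper groups pmm (a square),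
  pmg, cmm (disks), pgg (a projective plane) and p4 (a sphere). An invariant 1-form is an odd periodic
  vector field \<open>w\<close> with \<open>w (A x + b) = A w x\<close>; because \<open>A\<close> has trace zero, \<open>w\<close> is determined by one of
  its components, which can be an arbitrary odd periodic function. Hence every eigenspace on 1-forms
  is isomorphic to the space of odd periodic eigenfunctions, whichever of the five groups is taken.

  On a square with Dirichlet or Neumann conditions on each pair of opposite sides, eigenfunctions are
  finite sums of products of sines and cosines: integration by parts kills all other Fourier
  coefficients. So forms on the square with absolute boundary conditions extend to invariant
  forms for pmm, and the 0-eigenspaces for the eigenvalues 1, 2 and 4 can be listed explicitly; their
  dimensions tell the five groups apart.

  The quotient of the plane by the lattice and \<open>-1\<close> is a sphere, on which the remaining generator acts by
  a reflection (pmm, pmg, cmm), the antipodal map (pgg) or a half-turn (p4).\<close>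

section \<open>Partial derivatives and smooth functions on the plane\<close>

text \<open>Heuristically, a motion with linear part B enters the heat trace on p-forms with the
  trace of B on p-covectors as weight. On 1-forms the class of \<open>A\<close> has weight 0
  whatever \<open>b\<close> is, so only the shared lattice and -1 count; on functions its weight is
  1, and there the groups can differ. No eigenvalue expansion on orbifolds is presupposed:
  eigenforms are smooth by definition, and the task is to show that an eigenspace contains nothing
  beyond the expected functions. This rests on completeness of the cosines on [0, pi], obtained from
  Stone-Weierstrass. The resulting finite sums also extend forms beyond the square; extending by
  reflection would leave smoothness across the sides to be proved. The eigenvalues are the first
  that separate: at 1 the 0-eigenspaces of pmm, pmg, pgg, cmm, p4 have dimensions 2, 1, 0, 1, 1; at
  4 pmg has 2 against 1 for cmm and p4; at 2 cmm has 2 and p4 has 1. The sphere is realised by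
  explicit coordinates in which the generator (\<open>b\<close>, \<open>A\<close>) becomes a linear
  isometry of 3-space, so that the remaining quotients can be written as formulas.\<close>

definition pt :: "real \<Rightarrow> real \<Rightarrow> plane" where
  "pt x y = vector [x, y]"

lemma pt_nth [simp]: "pt x y $ 1 = x" "pt x y $ 2 = y"
  by (simp_all add: pt_def)

lemma plane_eq_iff: "p = q \<longleftrightarrow> p $ 1 = q $ 1 \<and> p $ 2 = q $ (2::2)" for p q :: "'a^2"
  by (simp add: vec_eq_iff forall_2)

lemma pt_eta [simp]: "pt (p $ 1) (p $ 2) = p"
  by (simp add: plane_eq_iff)

lemma pt_axis: "pt x y = x *\<^sub>R axis 1 1 + y *\<^sub>R axis 2 1"
  by (simp add: plane_eq_iff axis_def)

lemma partial_eqI: "(f has_derivative D) (at p) \<Longrightarrow> partial i f p = D (axis i 1)"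
  unfolding partial_def by (metis frechet_derivative_at)

lemma has_derivative_partials:
  assumes "f differentiable (at p)"
  shows "(f has_derivative (\<lambda>h. h $ 1 *\<^sub>R partial 1 f p + h $ 2 *\<^sub>R partial 2 f p)) (at p)"
proof -
  let ?D = "frechet_derivative f (at p)"
  have D: "(f has_derivative ?D) (at p)"
    using assms by (simp add: frechet_derivative_works)
  then have l: "linear ?D"
    by (simp add: has_derivative_linear)
  have "?D h = h $ 1 *\<^sub>R partial 1 f p + h $ 2 *\<^sub>R partial 2 f p" for h
  proof -
    have "?D h = ?D (h $ 1 *\<^sub>R axis 1 1 + h $ 2 *\<^sub>R axis 2 1)"
      by (simp add: pt_axis[symmetric])
    then show ?thesis
      by (simp add: linear_add[OF l] linear_scale[OF l] partial_def)
  qed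
  then have "?D = (\<lambda>h. h $ 1 *\<^sub>R partial 1 f p + h $ 2 *\<^sub>R partial 2 f p)"
    by (rule ext)
  then show ?thesis using D by simp
qed

text \<open>Restriction to coordinate lines, the passage from partial derivatives to one-variable
  calculus: the fundamental theorem and integration by parts are applied through it.\<close>

lemma has_vector_derivative_pt:
  assumes "f differentiable (at (pt x y))"
  shows "((\<lambda>t. f (pt t y)) has_vector_derivative partial 1 f (pt x y)) (at x within S)"
    and "((\<lambda>t. f (pt x t)) has_vector_derivative partial 2 f (pt x y)) (at y within S)"
proof -
  have 1: "((\<lambda>t. pt t y) has_derivative (\<lambda>t. t *\<^sub>R axis 1 1)) (at x within S)"
    and 2: "((\<lambda>t. pt x t) has_derivative (\<lambda>t. t *\<^sub>R axis 2 1)) (at y within S)"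
    unfolding pt_axis by (auto intro!: derivative_eq_intros)
  show "((\<lambda>t. f (pt t y)) has_vector_derivative partial 1 f (pt x y)) (at x within S)"
    using has_derivative_compose[OF 1 has_derivative_partials[OF assms]]
    by (simp add: has_vector_derivative_def axis_def)
  show "((\<lambda>t. f (pt x t)) has_vector_derivative partial 2 f (pt x y)) (at y within S)"
    using has_derivative_compose[OF 2 has_derivative_partials[OF assms]]
    by (simp add: has_vector_derivative_def axis_def)
qed

text \<open>A class of differentiable functions that is closed under partial derivatives lies in
  every \<open>C_k\<close>, by induction on k. The closure lemmas below take for \<open>X\<close>
  all functions of the shape in question (sums, composites, multiples of trigonometric products), so
  that no induction on k has to be repeated.\<close>

lemma smooth_coinduct:
  assumes "X f" and step: "\<And>g. X g \<Longrightarrow> (\<forall>x. g differentiable (at x)) \<and> (\<forall>i. X (partial i g))"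
  shows "smooth f"
proof -
  have "X g \<Longrightarrow> C_k k g" for k g
  proof (induction k arbitrary: g)
    case 0
    then have "g differentiable_on UNIV"
      using step by (auto simp: differentiable_on_def intro: differentiable_at_withinI)
    then show ?case by (simp add: differentiable_imp_continuous_on)
  next
    case (Suc k)
    then show ?case using step by auto
  qed
  then show ?thesis using assms(1) by (simp add: smooth_def)
qed

lemma smooth_differentiable: "smooth f \<Longrightarrow> f differentiable (at x)"
  unfolding smooth_def by (metis C_k.simps(2))

lemma smooth_partial: "smooth f \<Longrightarrow> smooth (partial i f)"
  unfolding smooth_def by (metis C_k.simps(2))

lemma smooth_continuous_on: "smooth f \<Longrightarrow> continuous_on S f"
  unfolding smooth_def by (metis C_k.simps(1) continuous_on_subset subset_UNIV)

lemmas smooth_has_derivative = has_derivative_partials[OF smooth_differentiable]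

lemma smooth_bounded_linear:
  assumes L: "bounded_linear L" and "smooth f"
  shows "smooth (\<lambda>x. L (f x))" "partial i (\<lambda>x. L (f x)) = (\<lambda>x. L (partial i f x))"
proof -
  interpret bounded_linear L by fact
  have D: "((\<lambda>x. L (f x)) has_derivative
      (\<lambda>h. L (h $ 1 *\<^sub>R partial 1 f x + h $ 2 *\<^sub>R partial 2 f x))) (at x)" if "smooth f" for f x
    by (rule has_derivative[OF smooth_has_derivative[OF that]])
  have P: "partial i (\<lambda>x. L (f x)) = (\<lambda>x. L (partial i f x))" if "smooth f" for f i
    using exhaust_2[of i] by (auto simp: partial_eqI[OF D[OF that]] axis_def fun_eq_iff)
  show "partial i (\<lambda>x. L (f x)) = (\<lambda>x. L (partial i f x))" using P assms by blast
  show "smooth (\<lambda>x. L (f x))"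
  proof (rule smooth_coinduct[where X="\<lambda>g. \<exists>f. smooth f \<and> g = (\<lambda>x. L (f x))"])
    fix h assume "\<exists>f. smooth f \<and> h = (\<lambda>x. L (f x))"
    then obtain f where f: "smooth f" "h = (\<lambda>x. L (f x))" by blast
    have "h differentiable at x" for x
      using D[OF f(1)] f(2) by (auto simp: differentiable_def)
    then show "(\<forall>x. h differentiable at x) \<and> (\<forall>i. \<exists>f. smooth f \<and> partial i h = (\<lambda>x. L (f x)))"
      using P[OF f(1)] smooth_partial[OF f(1)] f(2) by blast
  qed (use assms in blast)
qed

lemma smooth_add:
  assumes "smooth f" "smooth g"
  shows "smooth (\<lambda>x. f x + g x)" "partial i (\<lambda>x. f x + g x) = (\<lambda>x. partial i f x + partial i g x)"
proof -
  have D: "((\<lambda>x. f x + g x) has_derivative (\<lambda>h. (h $ 1 *\<^sub>R partial 1 f x + h $ 2 *\<^sub>R partial 2 f x)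
      + (h $ 1 *\<^sub>R partial 1 g x + h $ 2 *\<^sub>R partial 2 g x))) (at x)"
    if "smooth f" "smooth g" for f g :: "plane \<Rightarrow> 'a" and x
    using that by (intro has_derivative_add smooth_has_derivative)
  have P: "partial i (\<lambda>x. f x + g x) = (\<lambda>x. partial i f x + partial i g x)"
    if "smooth f" "smooth g" for f g :: "plane \<Rightarrow> 'a" and i
    using exhaust_2[of i] by (auto simp: partial_eqI[OF D[OF that]] axis_def fun_eq_iff)
  show "partial i (\<lambda>x. f x + g x) = (\<lambda>x. partial i f x + partial i g x)" using P assms by blast
  show "smooth (\<lambda>x. f x + g x)"
  proof (rule smooth_coinduct[where X="\<lambda>h. \<exists>f g. smooth f \<and> smooth g \<and> h = (\<lambda>x. f x + g x)"])
    fix h :: "plane \<Rightarrow> 'a" assume "\<exists>f g. smooth f \<and> smooth g \<and> h = (\<lambda>x. f x + g x)"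
    then obtain f g where f: "smooth f" "smooth g" "h = (\<lambda>x. f x + g x)" by blast
    have "h differentiable at x" for x
      using D[OF f(1,2)] f(3) by (auto simp: differentiable_def)
    then show "(\<forall>x. h differentiable at x) \<and>
        (\<forall>i. \<exists>f g. smooth f \<and> smooth g \<and> partial i h = (\<lambda>x. f x + g x))"
      using P[OF f(1,2)] smooth_partial[OF f(1)] smooth_partial[OF f(2)] f(3) by blast
  qed (use assms in blast)
qed

lemma smooth_scaleR:
  assumes "smooth f"
  shows "smooth (\<lambda>x. c *\<^sub>R f x)" "partial i (\<lambda>x. c *\<^sub>R f x) = (\<lambda>x. c *\<^sub>R partial i f x)"
  using smooth_bounded_linear[OF bounded_linear_scaleR_right assms] by auto

lemma smooth_mult_const:
  fixes f :: "plane \<Rightarrow> real"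
  assumes "smooth f"
  shows "smooth (\<lambda>x. c * f x)" "partial i (\<lambda>x. c * f x) = (\<lambda>x. c * partial i f x)"
  using smooth_scaleR[OF assms] by auto

lemma smooth_uminus:
  assumes "smooth f"
  shows "smooth (\<lambda>x. - f x)" "partial i (\<lambda>x. - f x) = (\<lambda>x. - partial i f x)"
  using smooth_scaleR[OF assms, where c="-1"] by auto

lemma smooth_diff:
  assumes "smooth f" "smooth g"
  shows "smooth (\<lambda>x. f x - g x)" "partial i (\<lambda>x. f x - g x) = (\<lambda>x. partial i f x - partial i g x)"
  using smooth_add[OF assms(1) smooth_uminus(1)[OF assms(2)]]
  by (simp_all add: smooth_uminus(2)[OF assms(2)])

lemma smooth_zero:
  "smooth (\<lambda>x. 0 :: 'a::real_normed_vector)"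
  "partial i (\<lambda>x. 0 :: 'a::real_normed_vector) = (\<lambda>x. 0)"
proof -
  have P: "partial i (\<lambda>x. 0 :: 'a) = (\<lambda>x. 0)" for i
    by (rule ext, subst partial_eqI[where D="\<lambda>h. 0"]) auto
  then show "partial i (\<lambda>x. 0 :: 'a) = (\<lambda>x. 0)" .
  show "smooth (\<lambda>x. 0 :: 'a)"
    by (rule smooth_coinduct[where X="\<lambda>f. f = (\<lambda>x. 0)"]) (auto simp: P)
qed

lemma smooth_sum:
  assumes "\<And>j. j \<in> J \<Longrightarrow> smooth (f j)"
  shows "smooth (\<lambda>x. \<Sum>j\<in>J. f j x) \<and> partial i (\<lambda>x. \<Sum>j\<in>J. f j x) = (\<lambda>x. \<Sum>j\<in>J. partial i (f j) x)"
  using assms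
proof (induction J rule: infinite_finite_induct)
  case (insert j J)
  then show ?case using smooth_add[of "f j" "\<lambda>x. \<Sum>j\<in>J. f j x"] by simp
qed (simp_all add: smooth_zero)

lemma smooth_nth:
  fixes w :: "plane \<Rightarrow> real^2"
  assumes "smooth w"
  shows "smooth (\<lambda>x. w x $ j)" "partial i (\<lambda>x. w x $ j) = (\<lambda>x. partial i w x $ j)"
  using smooth_bounded_linear[OF bounded_linear_vec_nth assms] by auto

lemma smooth_inner:
  fixes w :: "plane \<Rightarrow> real^2"
  assumes "smooth w"
  shows "smooth (\<lambda>x. w x \<bullet> v)" "partial i (\<lambda>x. w x \<bullet> v) = (\<lambda>x. partial i w x \<bullet> v)"
  using smooth_bounded_linear[OF bounded_linear_inner_left assms] by auto

lemma smooth_scaleR_left: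
  fixes f :: "plane \<Rightarrow> real"
  assumes "smooth f"
  shows "smooth (\<lambda>x. f x *\<^sub>R v)" "partial i (\<lambda>x. f x *\<^sub>R v) = (\<lambda>x. partial i f x *\<^sub>R v)"
  using smooth_bounded_linear[OF bounded_linear_scaleR_left assms] by auto

lemma has_derivative_act: "(act g has_derivative (\<lambda>h. snd g *v h)) (at x)"
  unfolding act_def
  by (auto intro!: derivative_eq_intros bounded_linear_imp_has_derivative
      matrix_vector_mul_bounded_linear)

lemma smooth_act:
  assumes "smooth f"
  shows "smooth (\<lambda>x. f (act g x))"
    "partial i (\<lambda>x. f (act g x)) =
      (\<lambda>x. snd g $ 1 $ i *\<^sub>R partial 1 f (act g x) + snd g $ 2 $ i *\<^sub>R partial 2 f (act g x))"
proof -
  have D: "((\<lambda>x. f (act g x)) has_derivative (\<lambda>h. (snd g *v h) $ 1 *\<^sub>R partial 1 f (act g x)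
      + (snd g *v h) $ 2 *\<^sub>R partial 2 f (act g x))) (at x)" if "smooth f" for f :: "plane \<Rightarrow> 'a" and x
    by (rule has_derivative_compose[OF has_derivative_act smooth_has_derivative[OF that]])
  have P: "partial i (\<lambda>x. f (act g x)) =
      (\<lambda>x. snd g $ 1 $ i *\<^sub>R partial 1 f (act g x) + snd g $ 2 $ i *\<^sub>R partial 2 f (act g x))"
    if "smooth f" for f :: "plane \<Rightarrow> 'a" and i
    by (auto simp: partial_eqI[OF D[OF that]] matrix_vector_mul_component inner_axis fun_eq_iff)
  show "partial i (\<lambda>x. f (act g x)) =
      (\<lambda>x. snd g $ 1 $ i *\<^sub>R partial 1 f (act g x) + snd g $ 2 $ i *\<^sub>R partial 2 f (act g x))"
    using P assms by blast
  show "smooth (\<lambda>x. f (act g x))"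
  proof (rule smooth_coinduct[where X="\<lambda>h. \<exists>f. smooth f \<and> h = (\<lambda>x. f (act g x))"])
    show "\<exists>f'. smooth f' \<and> (\<lambda>x. f (act g x)) = (\<lambda>x. f' (act g x))" using assms by blast
    fix h :: "plane \<Rightarrow> 'a" assume "\<exists>f. smooth f \<and> h = (\<lambda>x. f (act g x))"
    then obtain f where f: "smooth f" "h = (\<lambda>x. f (act g x))" by blast
    have "\<exists>f'. smooth f' \<and> partial i h = (\<lambda>x. f' (act g x))" for i
      unfolding f P[OF f(1)]
      \<comment> \<open>The coefficients are constant entries of the linear part, so the derivative
        is again a smooth function composed with the same motion.\<close>
      by (intro exI[of _ "\<lambda>y. snd g $ 1 $ i *\<^sub>R partial 1 f y + snd g $ 2 $ i *\<^sub>R partial 2 f y"]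
          conjI smooth_add smooth_scaleR smooth_partial f) auto
    then show "(\<forall>x. h differentiable at x) \<and> (\<forall>i. \<exists>f. smooth f \<and> partial i h = (\<lambda>x. f (act g x)))"
      using D[OF f(1)] f(2) by (auto simp: differentiable_def)
  qed
qed

lemma continuous_on_pt [continuous_intros]:
  "continuous_on S f \<Longrightarrow> continuous_on S g \<Longrightarrow> continuous_on S (\<lambda>x. pt (f x) (g x))"
  unfolding pt_axis by (intro continuous_intros)

lemma smooth_continuous_on_pt [continuous_intros]:
  assumes "smooth F" "continuous_on S f" "continuous_on S g"
  shows "continuous_on S (\<lambda>x. F (pt (f x) (g x)))"
  by (rule continuous_on_compose2[OF smooth_continuous_on[OF assms(1)] continuous_on_pt[OF assms(2,3)]])
    auto

text \<open>Symmetry of second derivatives by integration: f(s, t) is f(s, b - 1) plus the integral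
  of its second partial derivative over [b - 1, t]. Differentiating under the integral in s and then
  by the upper limit t gives one order of differentiation; differentiating f directly gives the
  other.\<close>

lemma partial_commute:
  fixes f :: "plane \<Rightarrow> real"
  assumes f: "smooth f"
  shows "partial 1 (partial 2 f) x = partial 2 (partial 1 f) x"
proof -
  define a b where "a = x $ 1" and "b = x $ 2"
  let ?U = "{a - 1..a + 1}" and ?V = "{b - 1..b + 1}"
  note [simp] = smooth_partial[OF f]
  have eq: "f (pt s t) = f (pt s (b - 1)) + integral {b - 1..t} (\<lambda>r. partial 2 f (pt s r))"
    if "t \<in> ?V" for s t
  proof -
    have "((\<lambda>r. partial 2 f (pt s r)) has_integral f (pt s t) - f (pt s (b - 1))) {b - 1..t}"
      by (rule fundamental_theorem_of_calculus)
        (use that in \<open>auto intro!: has_vector_derivative_pt smooth_differentiable f\<close>)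
    then show ?thesis by (simp add: integral_unique)
  qed
  have D1: "partial 1 f (pt a t) = partial 1 f (pt a (b - 1))
      + integral {b - 1..t} (\<lambda>r. partial 1 (partial 2 f) (pt a r))" if t: "t \<in> ?V" for t
  proof -
    have "((\<lambda>s. integral (cbox (b - 1) t) (\<lambda>r. partial 2 f (pt s r))) has_vector_derivative
        integral (cbox (b - 1) t) (\<lambda>r. partial 1 (partial 2 f) (pt a r))) (at a within ?U)"
      by (rule leibniz_rule_vector_derivative)
        (auto simp: split_def intro!: has_vector_derivative_pt smooth_differentiable integrable_continuous_real
          continuous_intros smooth_partial f)
    moreover have "((\<lambda>s. f (pt s (b - 1))) has_vector_derivative partial 1 f (pt a (b - 1))) (at a within ?U)"
      by (intro has_vector_derivative_pt smooth_differentiable f)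
    ultimately have "((\<lambda>s. f (pt s (b - 1)) + integral {b - 1..t} (\<lambda>r. partial 2 f (pt s r)))
       has_vector_derivative partial 1 f (pt a (b - 1))
        + integral {b - 1..t} (\<lambda>r. partial 1 (partial 2 f) (pt a r))) (at a within ?U)"
      unfolding interval_cbox by (intro has_vector_derivative_add)
    then have "((\<lambda>s. f (pt s t)) has_vector_derivative partial 1 f (pt a (b - 1))
        + integral {b - 1..t} (\<lambda>r. partial 1 (partial 2 f) (pt a r))) (at a within ?U)"
      using eq[OF t] by simp
    moreover have "((\<lambda>s. f (pt s t)) has_vector_derivative partial 1 f (pt a t)) (at a within ?U)"
      by (intro has_vector_derivative_pt smooth_differentiable f)
    ultimately show ?thesis
      using vector_derivative_unique_within_closed_interval[of "a - 1" "a + 1" a] by auto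
  qed
  have "((\<lambda>t. integral {b - 1..t} (\<lambda>r. partial 1 (partial 2 f) (pt a r))) has_vector_derivative
      partial 1 (partial 2 f) (pt a b)) (at b within ?V)"
    by (rule integral_has_vector_derivative) (auto intro!: continuous_intros smooth_partial f)
  then have "((\<lambda>t. partial 1 f (pt a (b - 1)) + integral {b - 1..t} (\<lambda>r. partial 1 (partial 2 f) (pt a r)))
      has_vector_derivative partial 1 (partial 2 f) (pt a b)) (at b within ?V)"
    by (auto intro!: derivative_eq_intros)
  then have "((\<lambda>t. partial 1 f (pt a t)) has_vector_derivative partial 1 (partial 2 f) (pt a b)) (at b within ?V)"
    by (rule has_vector_derivative_transform[rotated 2]) (simp_all add: D1[symmetric])
  moreover have "((\<lambda>t. partial 1 f (pt a t)) has_vector_derivative partial 2 (partial 1 f) (pt a b)) (at b within ?V)"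
    by (intro has_vector_derivative_pt smooth_differentiable smooth_partial f)
  ultimately have "partial 1 (partial 2 f) (pt a b) = partial 2 (partial 1 f) (pt a b)"
    using vector_derivative_unique_within_closed_interval[of "b - 1" "b + 1" b] by auto
  then show ?thesis by (simp add: a_def b_def)
qed

section \<open>The Hodge Laplacian in components and under motions\<close>

lemma d0_nth: "d0 f x $ i = partial i f x"
  using exhaust_2[of i] by (auto simp: d0_def)

lemma hodge_laplacian0_eq:
  "hodge_laplacian0 f x = - (partial 1 (partial 1 f) x + partial 2 (partial 2 f) x)"
  unfolding hodge_laplacian0_def codiff1_def by (simp add: d0_nth)

text \<open>In Cartesian coordinates the mixed second derivatives coming from d codiff and codiff d
  cancel by \<open>partial_commute\<close>; what remains is the scalar Laplacian of each
  component.\<close>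

lemma hodge_laplacian1_nth:
  assumes w: "smooth w"
  shows "hodge_laplacian1 w x $ i = hodge_laplacian0 (\<lambda>y. w y $ i) x"
proof -
  note s = smooth_partial[OF smooth_nth(1)[OF w]]
  have c: "codiff1 w = (\<lambda>x. - (partial 1 (\<lambda>y. w y $ 1) x + partial 2 (\<lambda>y. w y $ 2) x))"
    and d: "d1 w = (\<lambda>x. partial 1 (\<lambda>y. w y $ 2) x - partial 2 (\<lambda>y. w y $ 1) x)"
    by (auto simp: codiff1_def d1_def)
  note comm = partial_commute[OF smooth_nth(1)[OF w]]
  have "partial j (codiff1 w) x = - (partial j (partial 1 (\<lambda>y. w y $ 1)) x + partial j (partial 2 (\<lambda>y. w y $ 2)) x)" for j
    unfolding c by (subst smooth_uminus(2), intro smooth_add s, subst smooth_add(2)[OF s s]) auto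
  moreover have "partial j (d1 w) x = partial j (partial 1 (\<lambda>y. w y $ 2)) x - partial j (partial 2 (\<lambda>y. w y $ 1)) x" for j
    unfolding d by (subst smooth_diff(2)[OF s s]) auto
  ultimately show ?thesis
    using exhaust_2[of i] by (auto simp: hodge_laplacian1_def hodge_laplacian0_eq d0_nth codiff2_def comm)
qed

lemma hodge_laplacian1_eq_iff:
  assumes "smooth w"
  shows "hodge_laplacian1 w x = ev *\<^sub>R w x \<longleftrightarrow>
    (\<forall>i. hodge_laplacian0 (\<lambda>y. w y $ i) x = ev * w x $ i)"
  by (simp add: vec_eq_iff hodge_laplacian1_nth[OF assms])

lemma hodge_laplacian0_add:
  assumes "smooth f" "smooth g"
  shows "hodge_laplacian0 (\<lambda>x. f x + g x) x = hodge_laplacian0 f x + hodge_laplacian0 g x"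
  unfolding hodge_laplacian0_eq
  by (simp add: smooth_add(2)[OF assms] smooth_add(2)[OF smooth_partial smooth_partial, OF assms])

lemma hodge_laplacian0_mult:
  assumes "smooth f"
  shows "hodge_laplacian0 (\<lambda>x. c * f x) x = c * hodge_laplacian0 f x"
  unfolding hodge_laplacian0_eq
  by (simp add: smooth_mult_const(2)[OF assms] smooth_mult_const(2)[OF smooth_partial, OF assms] algebra_simps)

lemma hodge_laplacian0_sum:
  assumes "\<And>j. j \<in> J \<Longrightarrow> smooth (f j)"
  shows "hodge_laplacian0 (\<lambda>x. \<Sum>j\<in>J. f j x) x = (\<Sum>j\<in>J. hodge_laplacian0 (f j) x)"
proof -
  have 1: "partial i (\<lambda>x. \<Sum>j\<in>J. f j x) = (\<lambda>x. \<Sum>j\<in>J. partial i (f j) x)" for i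
    by (rule smooth_sum[THEN conjunct2, OF assms])
  have 2: "partial i (\<lambda>x. \<Sum>j\<in>J. partial i (f j) x) = (\<lambda>x. \<Sum>j\<in>J. partial i (partial i (f j)) x)" for i
    by (rule smooth_sum[THEN conjunct2, OF smooth_partial, OF assms])
  show ?thesis
    unfolding hodge_laplacian0_eq 1 2 by (simp only: sum.distrib sum_negf)
qed

text \<open>By the chain rule the pure second derivatives of \<open>f\<close> acquire the squared
  lengths of the rows of the linear part and the mixed one acquires their inner product. The rows
  are orthonormal.\<close>

lemma hodge_laplacian0_act:
  assumes f: "smooth f" and A: "orthogonal_matrix (snd g)"
  shows "hodge_laplacian0 (\<lambda>x. f (act g x)) x = hodge_laplacian0 f (act g x)"
proof -
  let ?A = "snd g"
  have "?A ** transpose ?A = mat 1"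
    using A by (simp add: orthogonal_matrix_def)
  then have o: "?A$1$1 * ?A$1$1 + ?A$1$2 * ?A$1$2 = 1" "?A$2$1 * ?A$2$1 + ?A$2$2 * ?A$2$2 = 1"
    "?A$1$1 * ?A$2$1 + ?A$1$2 * ?A$2$2 = 0"
    by (auto simp: matrix_matrix_mult_def transpose_def mat_def vec_eq_iff forall_2 sum_2)
  note s = smooth_partial[OF f]
  have P2: "partial i (\<lambda>x. c * partial 1 f (act g x) + d * partial 2 f (act g x)) x
      = c * partial i (\<lambda>x. partial 1 f (act g x)) x + d * partial i (\<lambda>x. partial 2 f (act g x)) x" for i c d
    using s by (simp add: smooth_add(2) smooth_mult_const smooth_act(1))
  note comm = partial_commute[OF f, of "act g x"]
  define p q r where "p = partial 1 (partial 1 f) (act g x)" and "q = partial 2 (partial 1 f) (act g x)"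
    and "r = partial 2 (partial 2 f) (act g x)"
  have P: "partial i (partial i (\<lambda>x. f (act g x))) x =
      ?A$1$i * (?A$1$i * p + ?A$2$i * q) + ?A$2$i * (?A$1$i * q + ?A$2$i * r)" for i
    unfolding smooth_act(2)[OF f] real_scaleR_def P2 p_def q_def r_def
    by (simp add: smooth_act(2)[OF s] comm)
  have "partial 1 (partial 1 (\<lambda>x. f (act g x))) x + partial 2 (partial 2 (\<lambda>x. f (act g x))) x =
      (?A$1$1 * ?A$1$1 + ?A$1$2 * ?A$1$2) * p + 2 * (?A$1$1 * ?A$2$1 + ?A$1$2 * ?A$2$2) * q
      + (?A$2$1 * ?A$2$1 + ?A$2$2 * ?A$2$2) * r"
    unfolding P by (simp add: algebra_simps)
  then show ?thesis
    unfolding hodge_laplacian0_eq o by (simp add: p_def r_def)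
qed

lemma hodge_laplacian1_eq:
  assumes w: "smooth w"
  shows "hodge_laplacian1 w x = - (partial 1 (partial 1 w) x + partial 2 (partial 2 w) x)"
  by (simp add: vec_eq_iff hodge_laplacian1_nth[OF w] hodge_laplacian0_eq smooth_nth(2)[OF w]
      smooth_nth(2)[OF smooth_partial[OF w]])

lemma hodge_laplacian0_inner:
  assumes w: "smooth w"
  shows "hodge_laplacian0 (\<lambda>x. w x \<bullet> v) x = hodge_laplacian1 w x \<bullet> v"
  by (simp add: hodge_laplacian1_eq[OF w] hodge_laplacian0_eq smooth_inner(2)[OF w]
      smooth_inner(2)[OF smooth_partial[OF w]] inner_left_distrib inner_diff_left)

section \<open>Dimensions of function spaces\<close>

text \<open>Linearity is asked of \<open>T\<close> on all functions, injectivity only on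
  \<open>V\<close>. Closure of \<open>V\<close> makes a basis of \<open>V\<close> span exactly
  \<open>V\<close>, so its image is independent and spans the same space as
  \<open>W\<close>.\<close>

lemma fun_dim_image:
  fixes T :: "('a \<Rightarrow> 'b::real_vector) \<Rightarrow> 'c \<Rightarrow> 'd::real_vector"
  assumes add: "\<And>f g. T (\<lambda>x. f x + g x) = (\<lambda>x. T f x + T g x)"
    and scale: "\<And>c f. T (\<lambda>x. c *\<^sub>R f x) = (\<lambda>x. c *\<^sub>R T f x)"
    and V: "(\<lambda>x. 0) \<in> V" "\<And>f g. f \<in> V \<Longrightarrow> g \<in> V \<Longrightarrow> (\<lambda>x. f x + g x) \<in> V"
      "\<And>c f. f \<in> V \<Longrightarrow> (\<lambda>x. c *\<^sub>R f x) \<in> V"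
    and inj: "inj_on T V" and image: "T ` V = W"
  shows "fun_dim V = fun_dim W"
proof -
  interpret v: vector_space "fun_scale :: real \<Rightarrow> ('a \<Rightarrow> 'b) \<Rightarrow> _" by (rule vector_space_fun_scale)
  interpret w: vector_space "fun_scale :: real \<Rightarrow> ('c \<Rightarrow> 'd) \<Rightarrow> _" by (rule vector_space_fun_scale)
  interpret p: vector_space_pair "fun_scale :: real \<Rightarrow> ('a \<Rightarrow> 'b) \<Rightarrow> _"
    "fun_scale :: real \<Rightarrow> ('c \<Rightarrow> 'd) \<Rightarrow> _" ..
  have lin: "Vector_Spaces.linear fun_scale fun_scale T"
    by unfold_locales (use add scale in \<open>auto simp: fun_scale_def plus_fun_def\<close>)
  have "v.subspace V"
    unfolding v.subspace_def using V by (auto simp: fun_scale_def plus_fun_def zero_fun_def)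
  then have span: "v.span V = V" by simp
  obtain B where B: "B \<subseteq> V" "v.independent B" "V \<subseteq> v.span B" "card B = v.dim V"
    by (rule v.basis_exists)
  have BV: "v.span B = V"
    using B v.span_mono[OF B(1)] span by auto
  have "w.independent (T ` B)"
    by (rule p.linear_independent_injective_image[OF lin B(2)]) (use BV inj in simp)
  moreover have "w.span (T ` B) = w.span W"
    using image BV p.linear_span_image[OF lin] by (metis v.span_span)
  ultimately have "w.dim W = card (T ` B)"
    by (intro w.dim_eq_card) auto
  also have "\<dots> = card B"
    by (rule card_image) (use inj B(1) inj_on_subset in blast)
  finally show ?thesis using B(4) by (simp add: fun_dim_def)
qed

lemma fun_dim_0: "fun_dim {\<lambda>x. 0} = 0"
proof -
  interpret v: vector_space "fun_scale :: real \<Rightarrow> ('a \<Rightarrow> 'b::real_vector) \<Rightarrow> _"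
    by (rule vector_space_fun_scale)
  show ?thesis
    unfolding fun_dim_def by (rule v.dim_unique[of "{}"]) (auto simp: zero_fun_def v.independent_empty)
qed

lemma fun_dim_1:
  fixes u :: "'a \<Rightarrow> real"
  assumes u: "u p \<noteq> 0"
  shows "fun_dim (range (\<lambda>c x. c * u x)) = 1"
proof -
  interpret v: vector_space "fun_scale :: real \<Rightarrow> ('a \<Rightarrow> real) \<Rightarrow> _"
    by (rule vector_space_fun_scale)
  have "u \<noteq> 0" using u by auto
  then have "v.independent {u}" by simp
  moreover have "u = (\<lambda>x. 1 * u x)" by simp
  then have "{u} \<subseteq> range (\<lambda>c x. c * u x)" by (metis empty_subsetI insert_subset rangeI)
  ultimately show ?thesis
    unfolding fun_dim_def by (intro v.dim_unique[of "{u}"]) (auto simp: v.span_singleton fun_scale_def)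
qed

text \<open>Independence is certified by a nonzero 2 by 2 determinant of values at two sample
  points.\<close>

lemma fun_dim_2:
  fixes u v :: "'a \<Rightarrow> real"
  assumes uv: "u p * v q \<noteq> u q * v p"
  shows "fun_dim {\<lambda>x. c * u x + d * v x | c d. True} = 2"
proof -
  interpret v: vector_space "fun_scale :: real \<Rightarrow> ('a \<Rightarrow> real) \<Rightarrow> _"
    by (rule vector_space_fun_scale)
  have "v \<noteq> 0" using uv by auto
  moreover have nin: "u \<notin> v.span {v}"
  proof
    assume "u \<in> v.span {v}"
    then obtain k where "u = (\<lambda>x. k * v x)" by (auto simp: v.span_singleton fun_scale_def)
    then show False using uv by simp
  qed
  ultimately have ind: "v.independent {u, v}"
    using v.span_base[of v "{v}"] by (auto simp: v.independent_insert)
  have "u \<noteq> v" using uv by auto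
  then have c: "card {u, v} = 2" by simp
  have "u = (\<lambda>x. 1 * u x + 0 * v x)" "v = (\<lambda>x. 0 * u x + 1 * v x)" by auto
  then have "{u, v} \<subseteq> {\<lambda>x. c * u x + d * v x | c d. True}" by blast
  moreover have "(\<lambda>x. c * u x + d * v x) \<in> v.span {u, v}" for c d
  proof -
    have "(\<lambda>x. c * u x + d * v x) = fun_scale c u + fun_scale d v"
      by (auto simp: fun_scale_def)
    then show ?thesis by (simp add: v.span_add v.span_base v.span_scale)
  qed
  then have "{\<lambda>x. c * u x + d * v x | c d. True} \<subseteq> v.span {u, v}" by blast
  ultimately show ?thesis
    unfolding fun_dim_def using ind c by (intro v.dim_unique) auto
qed

section \<open>The crystallographic groups\<close>

text \<open>The period 2 pi makes trigonometric functions of integer frequency periodic, so the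
  eigenvalues are sums of two integer squares and the cell of pmm is the square of side pi.\<close>

definition period_lattice :: "plane set" where
  "period_lattice = {t. \<forall>i. \<exists>k::int. t $ i = 2 * pi * of_int k}"

lemma lattice_zero [simp]: "0 \<in> period_lattice"
  unfolding period_lattice_def by (auto intro: exI[of _ "0::int"])

lemma lattice_add: "s \<in> period_lattice \<Longrightarrow> t \<in> period_lattice \<Longrightarrow> s + t \<in> period_lattice"
  unfolding period_lattice_def mem_Collect_eq
  by (metis (no_types, opaque_lifting) distrib_left of_int_add vector_add_component)

lemma lattice_uminus: "t \<in> period_lattice \<Longrightarrow> - t \<in> period_lattice"
  unfolding period_lattice_def mem_Collect_eq
  by (metis (no_types, opaque_lifting) mult_minus_right of_int_minus vector_uminus_component)

lemma lattice_uminus_iff [simp]: "- t \<in> period_lattice \<longleftrightarrow> t \<in> period_lattice"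
  using lattice_uminus by fastforce

lemma lattice_diff: "s \<in> period_lattice \<Longrightarrow> t \<in> period_lattice \<Longrightarrow> s - t \<in> period_lattice"
  using lattice_add[of s "- t"] lattice_uminus by simp

lemma lattice_small:
  assumes "t \<in> period_lattice" "norm t < 1"
  shows "t = 0"
proof -
  have "t $ i = 0" for i
  proof -
    obtain k :: int where k: "t $ i = 2 * pi * of_int k"
      using assms(1) by (auto simp: period_lattice_def)
    have "\<bar>t $ i\<bar> < 1" using component_le_norm_cart[of t i] assms(2) by simp
    then have "2 * pi * \<bar>real_of_int k\<bar> < 1" using k by (simp add: abs_mult)
    moreover have "2 * pi * 1 \<le> 2 * pi * \<bar>real_of_int k\<bar>" if "k \<noteq> 0"
      using that by (intro mult_left_mono) auto
    ultimately have "k = 0" using pi_gt3 by fastforce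
    then show ?thesis using k by simp
  qed
  then show ?thesis by (simp add: vec_eq_iff)
qed

lemma lattice_pt: "pt x y \<in> period_lattice \<longleftrightarrow> (\<exists>k::int. x = 2 * pi * of_int k) \<and> (\<exists>k::int. y = 2 * pi * of_int k)"
  by (simp add: period_lattice_def forall_2)

text \<open>Linear part \<open>- A\<close> carries the same translation class \<open>b\<close> as
  \<open>A\<close>: multiplying (\<open>b\<close>, \<open>A\<close>) by the half-turn gives
  translation part \<open>- b\<close>, which agrees with \<open>b\<close> modulo the lattice once
  \<open>b + b\<close> is a lattice vector.\<close>

definition crys :: "real^2^2 \<Rightarrow> plane \<Rightarrow> motion set" where
  "crys A b = {(t, B). (B = mat 1 \<or> B = - mat 1) \<and> t \<in> period_lattice \<or>
     (B = A \<or> B = - A) \<and> t - b \<in> period_lattice}"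

lemma matrix_uminus_simps [simp]:
  fixes A B :: "real^2^2"
  shows "(- A) *v x = - (A *v x)" "A *v (- x) = - (A *v x)" "(- A) ** B = - (A ** B)"
    "A ** (- B) = - (A ** B)" "transpose (- A) = - transpose A"
  by (simp_all add: matrix_vector_mult_def matrix_matrix_mult_def transpose_def vec_eq_iff sum_negf)

lemma act_pair: "act (t, B) x = B *v x + t"
  by (simp add: act_def)

text \<open>The square of the motion (\<open>b\<close>, \<open>A\<close>) has linear part
  \<open>A ** A\<close> and translation \<open>b + A *v b\<close>; \<open>sq\<close>,
  \<open>b2\<close> and \<open>Ab\<close> place it back in the group, with \<open>sq\<close>
  admitting both reflections (+1) and the quarter-turn (-1). \<open>ne\<close> keeps the two cosets
  of linear parts apart.\<close>

locale crystal =
  fixes A :: "real^2^2" and b :: plane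
  assumes orth: "orthogonal_matrix A"
    and lat: "t \<in> period_lattice \<Longrightarrow> A *v t \<in> period_lattice"
    and sq: "A ** A = mat 1 \<or> A ** A = - mat 1"
    and b2: "b + b \<in> period_lattice" and Ab: "A *v b - b \<in> period_lattice"
    and ne: "A \<noteq> mat 1" "A \<noteq> - mat 1"
begin

lemma transpose_A: "transpose A = A \<or> transpose A = - A"
proof -
  have "transpose A ** (A ** A) = A"
    using orth by (simp add: matrix_mul_assoc orthogonal_matrix_def)
  then show ?thesis using sq by (metis matrix_uminus_simps(4) matrix_mul_rid minus_minus)
qed

lemma Ab': "A *v b + b \<in> period_lattice"
  using lattice_add[OF Ab b2] by (simp add: add.commute)

lemma crysI1: "t \<in> period_lattice \<Longrightarrow> (t, mat 1) \<in> crys A b" "t \<in> period_lattice \<Longrightarrow> (t, - mat 1) \<in> crys A b"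
  by (auto simp: crys_def)

lemma crysI2: "t - b \<in> period_lattice \<Longrightarrow> (t, A) \<in> crys A b" "t - b \<in> period_lattice \<Longrightarrow> (t, - A) \<in> crys A b"
  by (auto simp: crys_def)

lemma crysE:
  assumes "(t, B) \<in> crys A b"
  obtains "B = mat 1" "t \<in> period_lattice" | "B = - mat 1" "t \<in> period_lattice"
  | "B = A" "t - b \<in> period_lattice" | "B = - A" "t - b \<in> period_lattice"
  using assms by (auto simp: crys_def)

lemma subgroup_crys: "subgroup (crys A b) motion_group"
proof -
  interpret group motion_group by (rule group_motion_group)
  have orth': "orthogonal_matrix (- A)" "orthogonal_matrix (- mat 1 :: real^2^2)"
    using orth by (auto simp: orthogonal_matrix_def)
  have sub: "crys A b \<subseteq> carrier motion_group"
    using orth orth' by (auto simp: crys_def motion_group_def orthogonal_matrix_id)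
  have mult: "g \<otimes>\<^bsub>motion_group\<^esub> h \<in> crys A b" if gh: "g \<in> crys A b" "h \<in> crys A b" for g h
  proof -
    obtain t B s C where [simp]: "g = (t, B)" "h = (s, C)" by (cases g, cases h) auto
    have [simp]: "g \<otimes>\<^bsub>motion_group\<^esub> h = (t + B *v s, B ** C)" by (simp add: motion_group_def)
    have B: "(t, B) \<in> crys A b" and C: "(s, C) \<in> crys A b" using gh by auto
    \<comment> \<open>Translation parts of the sixteen products. With exactly one factor from the
      class of \<open>b\<close> (\<open>k\<close>, \<open>k'\<close>, \<open>m\<close>,
      \<open>m'\<close>) the result stays in that class, where -b counts as b because of
      \<open>b2\<close>; with two such factors (\<open>a\<close>, \<open>a'\<close>) it falls back
      into the lattice.\<close>
    have k: "t + s - b \<in> period_lattice" if "t \<in> period_lattice" "s - b \<in> period_lattice" for t s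
      using lattice_add[OF that] by (simp add: algebra_simps)
    have k': "t + s - b \<in> period_lattice" if "s \<in> period_lattice" "t - b \<in> period_lattice" for t s
      using k[OF that] by (simp add: algebra_simps)
    have m: "t - s - b \<in> period_lattice" if "t \<in> period_lattice" "s - b \<in> period_lattice" for t s
      using lattice_diff[OF lattice_diff[OF that] b2] by (simp add: algebra_simps)
    have a: "t + A *v s \<in> period_lattice" if "t - b \<in> period_lattice" "s - b \<in> period_lattice" for t s
      using lattice_add[OF lattice_add[OF that(1) lat[OF that(2)]] Ab']
      by (simp add: algebra_simps matrix_vector_mult_diff_distrib)
    have a': "t - A *v s \<in> period_lattice" if "t - b \<in> period_lattice" "s - b \<in> period_lattice" for t s
      using lattice_diff[OF lattice_diff[OF that(1) lat[OF that(2)]] Ab]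
      by (simp add: algebra_simps matrix_vector_mult_diff_distrib)
    have m': "t - s - b \<in> period_lattice" if "s \<in> period_lattice" "t - b \<in> period_lattice" for t s
      using k'[OF lattice_uminus[OF that(1)] that(2)] by simp
    have "(t + B *v s, B ** C) \<in> crys A b"
      by (rule crysE[OF B]; rule crysE[OF C])
        (use sq in \<open>fastforce intro: crysI1 crysI2 lattice_add lattice_diff k k' m m' a a' lat\<close>)+
    then show ?thesis by (simp add: motion_group_def)
  qed
  have inv: "inv\<^bsub>motion_group\<^esub> g \<in> crys A b" if g: "g \<in> crys A b" for g
  proof -
    obtain t B where gt[simp]: "g = (t, B)" by (cases g) auto
    have o: "orthogonal_matrix B" using g sub by (auto simp: motion_group_def)
    have tB: "transpose B = B \<or> transpose B = - B"
      by (rule crysE[OF g[unfolded gt]]) (use transpose_A in auto)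
    have "inv\<^bsub>motion_group\<^esub> g = (- (transpose B *v t), transpose B)"
      by (rule inv_equality) (use o g sub in \<open>auto simp: motion_group_def orthogonal_matrix_def\<close>)
    moreover have "(- (transpose B *v t), transpose B) \<in> crys A b"
    proof -
      have 1: "A *v t - b \<in> period_lattice" "- (A *v t) - b \<in> period_lattice" if t: "t - b \<in> period_lattice"
        using lattice_add[OF lat[OF t] Ab] lattice_diff[OF lattice_uminus[OF lat[OF t]] Ab']
        by (auto simp: matrix_vector_mult_diff_distrib uminus_add_conv_diff minus_diff_eq)
          (metis add.commute add_diff_eq diff_conv_add_uminus minus_diff_eq)?
      show ?thesis
        by (rule crysE[OF g[unfolded gt]]; rule disjE[OF tB])
          (use 1 in \<open>auto intro!: crysI1 crysI2\<close>)
    qed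
    ultimately show ?thesis by simp
  qed
  show ?thesis
    by (rule subgroupI) (use sub mult inv crysI1[OF lattice_zero] in auto)
qed

lemma discrete_crys: "discrete (crys A b)"
proof (rule discreteI)
  fix g assume g: "g \<in> crys A b"
  obtain t B where [simp]: "g = (t, B)" by (cases g)
  \<comment> \<open>Removing the finitely many other linear parts fixes the linear part near
    \<open>g\<close>; the unit ball then fixes the translation by
    \<open>lattice_small\<close>.\<close>
  define F where "F = {mat 1, - mat 1, A, - A} - {B}"
  have "open (ball t 1 \<times> (- F))"
    by (intro open_Times open_ball open_Compl finite_imp_closed) (simp add: F_def)
  moreover have "(ball t 1 \<times> (- F)) \<inter> crys A b = {g}"
  proof -
    have "t' = t \<and> B' = B" if "(t', B') \<in> crys A b" "t' \<in> ball t 1" "B' \<notin> F" for t' B'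
    proof -
      have "B' = B" using that(1,3) by (auto simp: F_def crys_def)
      moreover have "t' - t \<in> period_lattice"
      proof (cases "B = A \<or> B = - A")
        case True
        \<comment> \<open>Since \<open>A\<close> is not plus or minus the identity, a linear part
          \<open>A\<close> or \<open>- A\<close> can only come from the second clause of
          \<open>crys\<close>, so both translations lie in the class of \<open>b\<close>.\<close>
        then have "\<not> (B = mat 1 \<or> B = - mat 1)" using ne by (metis minus_minus)
        then have "t - b \<in> period_lattice" "t' - b \<in> period_lattice"
          using g that(1) \<open>B' = B\<close> by (auto simp: crys_def)
        from lattice_diff[OF this(2,1)] show ?thesis by simp
      qed (use g that(1) \<open>B' = B\<close> lattice_diff in \<open>auto simp: crys_def\<close>)
      then have "t' - t = 0"
        using that(2) by (intro lattice_small) (auto simp: dist_norm norm_minus_commute)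
      ultimately show ?thesis by simp
    qed
    then show ?thesis using g by (auto simp: F_def)
  qed
  ultimately show "g isolated_in crys A b"
    using g unfolding isolated_in_def by blast
qed

text \<open>Invariance needs testing only on generators. The pullback condition for
  (\<open>b\<close>, \<open>A\<close>), multiplied by \<open>A\<close>, becomes equivariance;
  conversely every element is a generator, or the negative of one, followed by a lattice
  translation.\<close>

lemma forms1_crys:
  "w \<in> forms1 (crys A b) \<longleftrightarrow> smooth w \<and> (\<forall>t\<in>period_lattice. \<forall>x. w (x + t) = w x) \<and>
     (\<forall>x. w (- x) = - w x) \<and> (\<forall>x. w (A *v x + b) = A *v w x)" (is "_ \<longleftrightarrow> ?R")
proof
  assume w: "w \<in> forms1 (crys A b)"
  then have *: "transpose B *v w (B *v x + t) = w x" if "(t, B) \<in> crys A b" for t B x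
    using that by (fastforce simp: forms1_def act_def)
  have "w (- x) = - w x" for x
    using *[OF crysI1(2)[OF lattice_zero], of x] by (simp add: minus_equation_iff eq_commute)
  moreover have "w (x + t) = w x" if "t \<in> period_lattice" for t x
    using *[OF crysI1(1)[OF that], of x] by simp
  moreover have "w (A *v x + b) = A *v w x" for x
  proof -
    have "A *v (transpose A *v w (A *v x + b)) = A *v w x"
      using *[OF crysI2(1), of b x] by simp
    then show ?thesis
      using orth by (simp add: matrix_vector_mul_assoc orthogonal_matrix_def del: transpose_matrix_vector)
  qed
  ultimately show ?R using w by (simp add: forms1_def)
next
  assume R: ?R
  have "transpose B *v w (B *v x + t) = w x" if "(t, B) \<in> crys A b" for t B x
    using that
  proof (cases rule: crysE)
    case 3
    have "B *v x + t = (A *v x + b) + (t - b)" using 3 by simp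
    then have "w (B *v x + t) = A *v w x" using R 3 by metis
    then show ?thesis using 3 orth by (simp add: matrix_vector_mul_assoc orthogonal_matrix_def)
  next
    case 4
    \<comment> \<open>The negative of the generator has translation \<open>- b\<close>, so the
      remaining translation is t + b, written as t - b plus the lattice vector
      \<open>b + b\<close>.\<close>
    have "B *v x + t = - (A *v x + b) + (t - b + (b + b))" using 4 by simp
    then have "w (B *v x + t) = - (A *v w x)" using R 4 b2 lattice_add by metis
    then show ?thesis using 4 orth by (simp add: matrix_vector_mul_assoc orthogonal_matrix_def)
  next
    case 2
    have "B *v x + t = - x + t" using 2 by simp
    then have "w (B *v x + t) = - w x" using R 2 by metis
    then show ?thesis using 2 by simp
  qed (use R in auto)
  then show "w \<in> forms1 (crys A b)"
    using R by (auto simp: forms1_def act_def)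
qed

lemma forms0_crys:
  "f \<in> forms0 (crys A b) \<longleftrightarrow> smooth f \<and> (\<forall>t\<in>period_lattice. \<forall>x. f (x + t) = f x) \<and>
     (\<forall>x. f (- x) = f x) \<and> (\<forall>x. f (A *v x + b) = f x)" (is "_ \<longleftrightarrow> ?R")
proof
  assume f: "f \<in> forms0 (crys A b)"
  then have *: "f (B *v x + t) = f x" if "(t, B) \<in> crys A b" for t B x
    using that by (fastforce simp: forms0_def act_def)
  show ?R
    using *[OF crysI1(2)[OF lattice_zero]] *[OF crysI1(1)] *[OF crysI2(1), of b] f
    by (auto simp: forms0_def)
next
  assume R: ?R
  have "f (B *v x + t) = f x" if "(t, B) \<in> crys A b" for t B x
    using that
  proof (cases rule: crysE)
    case 3
    have "B *v x + t = (A *v x + b) + (t - b)" using 3 by simp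
    then show ?thesis using R 3 by metis
  next
    case 4
    have "B *v x + t = - (A *v x + b) + (t - b + (b + b))" using 4 by simp
    then show ?thesis using R 4 b2 lattice_add by metis
  next
    case 2
    have "B *v x + t = - x + t" using 2 by simp
    then show ?thesis using R 2 by metis
  qed (use R in auto)
  then show "f \<in> forms0 (crys A b)"
    using R by (auto simp: forms0_def act_def)
qed

end

section \<open>Eigenforms and the common model of the five 1-spectra\<close>

definition eigenforms1 :: "motion set \<Rightarrow> real \<Rightarrow> (plane \<Rightarrow> real^2) set" where
  "eigenforms1 \<Sigma> ev = {w \<in> forms1 \<Sigma>. \<forall>x. hodge_laplacian1 w x = ev *\<^sub>R w x}"

lemma eigenforms1_zero: "(\<lambda>x. 0) \<in> eigenforms1 \<Sigma> ev"
  by (simp add: eigenforms1_def forms1_def smooth_zero hodge_laplacian1_eq del: transpose_matrix_vector)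

lemma eigenforms1_add:
  assumes "w \<in> eigenforms1 \<Sigma> ev" "w' \<in> eigenforms1 \<Sigma> ev"
  shows "(\<lambda>x. w x + w' x) \<in> eigenforms1 \<Sigma> ev"
proof -
  have s: "smooth w" "smooth w'" using assms by (auto simp: eigenforms1_def forms1_def)
  have "hodge_laplacian1 (\<lambda>x. w x + w' x) x = hodge_laplacian1 w x + hodge_laplacian1 w' x" for x
    by (simp add: hodge_laplacian1_eq s smooth_add smooth_partial)
  then show ?thesis
    using assms by (auto simp: eigenforms1_def forms1_def smooth_add matrix_vector_right_distrib
        scaleR_add_right simp del: transpose_matrix_vector)
qed

lemma eigenforms1_scaleR:
  assumes "w \<in> eigenforms1 \<Sigma> ev"
  shows "(\<lambda>x. c *\<^sub>R w x) \<in> eigenforms1 \<Sigma> ev"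
proof -
  have s: "smooth w" using assms by (auto simp: eigenforms1_def forms1_def)
  have "hodge_laplacian1 (\<lambda>x. c *\<^sub>R w x) x = c *\<^sub>R hodge_laplacian1 w x" for x
    by (simp add: hodge_laplacian1_eq s smooth_scaleR smooth_partial algebra_simps)
  then show ?thesis
    using assms by (auto simp: eigenforms1_def forms1_def smooth_scaleR matrix_vector_mult_scaleR
        simp del: transpose_matrix_vector)
qed

text \<open>Refers only to the lattice and -1. Being free of \<open>A\<close> and \<open>b\<close>,
  it can serve as the same model for all five groups.\<close>

definition odd_eigenfunctions :: "real \<Rightarrow> (plane \<Rightarrow> real) set" where
  "odd_eigenfunctions ev = {f. smooth f \<and> (\<forall>t\<in>period_lattice. \<forall>x. f (x + t) = f x) \<and>
     (\<forall>x. f (- x) = - f x) \<and> (\<forall>x. hodge_laplacian0 f x = ev * f x)}"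

text \<open>The covectors \<open>v\<close> and \<open>transpose A *v v\<close> form a basis with dual basis \<open>A *v q\<close>, \<open>q\<close>. So an
  invariant form \<open>w\<close> is recovered from the function \<open>w \<bullet> v\<close> and its translate under the motion
  \<open>(b, A)\<close>, whatever the translation part \<open>b\<close> is.\<close>

lemma (in crystal) spectrum1_crys:
  fixes q v :: plane
  assumes dual: "\<And>w. (w \<bullet> v) *\<^sub>R (A *v q) + ((A *v w) \<bullet> v) *\<^sub>R q = w"
    and qv: "(A *v q) \<bullet> v = 1" "q \<bullet> v = 0"
  shows "spectrum1 (crys A b) ev = fun_dim (odd_eigenfunctions ev)"
proof -
  define V where "V = eigenforms1 (crys A b) ev"
  have V: "w \<in> V \<longleftrightarrow> smooth w \<and> (\<forall>t\<in>period_lattice. \<forall>x. w (x + t) = w x) \<and> (\<forall>x. w (- x) = - w x) \<and>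
      (\<forall>x. w (A *v x + b) = A *v w x) \<and> (\<forall>x. hodge_laplacian1 w x = ev *\<^sub>R w x)" for w
    by (simp add: V_def eigenforms1_def forms1_crys)
  define T :: "(plane \<Rightarrow> real^2) \<Rightarrow> plane \<Rightarrow> real" where "T w x = w x \<bullet> v" for w x
  have TV: "T w \<in> odd_eigenfunctions ev" if "w \<in> V" for w
    using that hodge_laplacian0_inner[of w v]
    by (auto simp: V odd_eigenfunctions_def T_def[abs_def] smooth_inner(1))
  have inj: "inj_on T V"
  proof (rule inj_onI)
    fix w w' assume w: "w \<in> V" "w' \<in> V" and eq: "T w = T w'"
    have "w x = w' x" for x
    proof -
      have "w x \<bullet> v = w' x \<bullet> v" using eq by (metis T_def)
      moreover have "(A *v w x) \<bullet> v = (A *v w' x) \<bullet> v"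
        using w eq by (metis T_def V)
      ultimately show ?thesis by (metis dual)
    qed
    then show "w = w'" by auto
  qed
  have "odd_eigenfunctions ev \<subseteq> T ` V"
  proof
    fix f assume f: "f \<in> odd_eigenfunctions ev"
    then have sm: "smooth f" and per: "\<And>t x. t \<in> period_lattice \<Longrightarrow> f (x + t) = f x"
      and odd: "\<And>x. f (- x) = - f x" and lap: "\<And>x. hodge_laplacian0 f x = ev * f x"
      by (auto simp: odd_eigenfunctions_def)
    \<comment> \<open>The choice is forced: if w is \<open>f\<close> times \<open>A *v q\<close>
      plus \<open>g\<close> times \<open>q\<close>, then comparing the coefficients of
      \<open>A *v q\<close> in w(A x + b) = A w(x) gives g(x) = f(A x + b).\<close>
    define g where "g x = f (act (b, A) x)" for x
    have g: "smooth g" "g x = f (A *v x + b)" "hodge_laplacian0 g x = ev * g x" for x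
      using smooth_act(1)[OF sm, of "(b, A)"] hodge_laplacian0_act[OF sm, of "(b, A)"] orth lap
      unfolding g_def by (simp_all add: act_def)
    define w where "w x = f x *\<^sub>R (A *v q) + g x *\<^sub>R q" for x
    have sw: "smooth w"
      unfolding w_def by (intro smooth_add smooth_scaleR_left sm g)
    have gp: "g (x + t) = g x" if "t \<in> period_lattice" for x t
    proof -
      have "A *v (x + t) + b = (A *v x + b) + A *v t"
        by (simp add: matrix_vector_right_distrib)
      then show ?thesis unfolding g(2) using per[OF lat[OF that]] by metis
    qed
    have go: "g (- x) = - g x" for x
    proof -
      have "A *v (- x) + b = - (A *v x + b) + (b + b)" by simp
      then show ?thesis unfolding g(2) using per[OF b2] odd by metis
    qed
    have wA: "w (A *v x + b) = A *v w x" for x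
    proof -
      have e: "A *v (A *v x + b) + b = (A ** A) *v x + (A *v b + b)"
        by (simp add: matrix_vector_right_distrib matrix_vector_mul_assoc)
      have Aq: "A *v (A *v q) = (A ** A) *v q" by (simp add: matrix_vector_mul_assoc)
      \<comment> \<open>The coefficient of \<open>q\<close>: applying the motion twice replaces x by
        plus or minus x up to a period. Oddness of \<open>f\<close> turns this sign into a factor,
        and it is the same sign with which \<open>A ** A\<close> acts on \<open>q\<close>.\<close>
      have "g (A *v x + b) *\<^sub>R q = f x *\<^sub>R (A *v (A *v q))"
        using sq unfolding g(2) e per[OF Ab'] Aq by (auto simp: odd)
      then show ?thesis
        by (simp add: w_def g(2) matrix_vector_right_distrib scaleR_matrix_vector_assoc[symmetric]
            matrix_vector_mult_scaleR add.commute)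
    qed
    have "hodge_laplacian1 w x = ev *\<^sub>R w x" for x
    proof -
      have "hodge_laplacian0 (\<lambda>y. w y $ i) x = ev * w x $ i" for i
      proof -
        have "(\<lambda>y. w y $ i) = (\<lambda>y. (A *v q) $ i * f y + q $ i * g y)"
          by (auto simp: w_def)
        then have "hodge_laplacian0 (\<lambda>y. w y $ i) x = (A *v q) $ i * (ev * f x) + q $ i * (ev * g x)"
          by (simp only: hodge_laplacian0_add[OF smooth_mult_const(1)[OF sm] smooth_mult_const(1)[OF g(1)]]
              hodge_laplacian0_mult[OF sm] hodge_laplacian0_mult[OF g(1)] lap g(3))
        then show ?thesis by (simp add: w_def algebra_simps)
      qed
      then show ?thesis using hodge_laplacian1_eq_iff[OF sw] by blast
    qed
    then have "w \<in> V" using sw wA per gp odd go by (auto simp: V w_def)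
    moreover have "T w = f" using qv by (auto simp: T_def w_def inner_left_distrib)
    ultimately show "f \<in> T ` V" by blast
  qed
  then have image: "T ` V = odd_eigenfunctions ev" using TV by blast
  have "fun_dim V = fun_dim (odd_eigenfunctions ev)"
  proof (rule fun_dim_image[where T=T])
  qed (use inj image in \<open>auto simp: T_def inner_left_distrib V_def eigenforms1_zero eigenforms1_add
      eigenforms1_scaleR\<close>)
  then show ?thesis by (simp add: spectrum1_def V_def eigenforms1_def)
qed

section \<open>Trigonometric expansions on a square\<close>

text \<open>The flag \<open>s\<close> selects the Dirichlet (\<open>True\<close>) or the Neumann (\<open>False\<close>) condition on \<open>[0, \<pi>]\<close>.\<close>

definition trig :: "bool \<Rightarrow> nat \<Rightarrow> real \<Rightarrow> real" where
  "trig s m x = (if s then sin (real m * x) else cos (real m * x))"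

definition trig_deriv :: "bool \<Rightarrow> nat \<Rightarrow> real \<Rightarrow> real" where
  "trig_deriv s m x = (if s then 1 else - 1) * real m * trig (\<not> s) m x"

definition bc :: "bool \<Rightarrow> (real \<Rightarrow> real) \<Rightarrow> (real \<Rightarrow> real) \<Rightarrow> bool" where
  "bc s u u' \<longleftrightarrow> (if s then u 0 = 0 \<and> u pi = 0 else u' 0 = 0 \<and> u' pi = 0)"

lemma has_derivative_trig [derivative_intros]:
  "(g has_real_derivative g') (at x within S) \<Longrightarrow>
    ((\<lambda>x. trig s m (g x)) has_real_derivative trig_deriv s m (g x) * g') (at x within S)"
  unfolding trig_def trig_deriv_def by (cases s) (auto intro!: derivative_eq_intros)

lemma has_derivative_trig_deriv:
  "(trig_deriv s m has_real_derivative - (real m)\<^sup>2 * trig s m x) (at x within S)"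
  unfolding trig_deriv_def
  by (auto intro!: derivative_eq_intros simp: trig_deriv_def power2_eq_square)

lemma continuous_on_trig [continuous_intros]:
  fixes g :: "'a::t2_space \<Rightarrow> real"
  shows "continuous_on S g \<Longrightarrow> continuous_on S (\<lambda>x. trig s m (g x))"
  unfolding trig_def by (cases s) (auto intro!: continuous_intros)

lemma bc_trig: "bc s (trig s m) (trig_deriv s m)"
  by (auto simp: bc_def trig_def trig_deriv_def)

text \<open>The integrand u'' trig + m^2 u trig is the derivative of the Wronskian u' trig - u
  trig'. This vanishes at both ends because \<open>u\<close> and \<open>trig s m\<close> satisfy the
  same boundary condition.\<close>

lemma integral_deriv2_trig:
  assumes u: "\<And>x. x \<in> {0..pi} \<Longrightarrow> (u has_real_derivative u' x) (at x within {0..pi})"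
    and u': "\<And>x. x \<in> {0..pi} \<Longrightarrow> (u' has_real_derivative u'' x) (at x within {0..pi})"
    and c: "continuous_on {0..pi} u''" and bc: "bc s u u'"
  shows "integral {0..pi} (\<lambda>x. u'' x * trig s m x) = - (real m)\<^sup>2 * integral {0..pi} (\<lambda>x. u x * trig s m x)"
proof -
  have cu: "continuous_on {0..pi} u"
    using u by (rule DERIV_continuous_on)
  have "((\<lambda>x. u'' x * trig s m x + (real m)\<^sup>2 * (u x * trig s m x)) has_integral
      (u' pi * trig s m pi - u pi * trig_deriv s m pi) - (u' 0 * trig s m 0 - u 0 * trig_deriv s m 0)) {0..pi}"
  proof (rule fundamental_theorem_of_calculus)
    fix x assume x: "x \<in> {0..pi}"
    show "((\<lambda>x. u' x * trig s m x - u x * trig_deriv s m x) has_vector_derivative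
        u'' x * trig s m x + (real m)\<^sup>2 * (u x * trig s m x)) (at x within {0..pi})"
      unfolding has_real_derivative_iff_has_vector_derivative[symmetric]
      by (auto intro!: derivative_eq_intros u[OF x] u'[OF x] has_derivative_trig_deriv simp: algebra_simps)
  qed simp
  also have "(u' pi * trig s m pi - u pi * trig_deriv s m pi) - (u' 0 * trig s m 0 - u 0 * trig_deriv s m 0) = 0"
    using bc bc_trig[of s m] by (auto simp: bc_def split: if_splits)
  finally have "integral {0..pi} (\<lambda>x. u'' x * trig s m x + (real m)\<^sup>2 * (u x * trig s m x)) = 0"
    by (rule integral_unique)
  moreover have "integral {0..pi} (\<lambda>x. u'' x * trig s m x + (real m)\<^sup>2 * (u x * trig s m x)) =
      integral {0..pi} (\<lambda>x. u'' x * trig s m x) + (real m)\<^sup>2 * integral {0..pi} (\<lambda>x. u x * trig s m x)"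
    by (subst integral_add)
      (auto intro!: integrable_continuous_real continuous_intros c cu)
  ultimately show ?thesis by simp
qed

text \<open>Two eigenvalues of one symmetric operator: integrating the second derivative of one
  factor against the other gives both -k^2 and -m^2 times the same integral.\<close>

lemma trig_orthogonal:
  assumes "k \<noteq> m"
  shows "integral {0..pi} (\<lambda>x. trig s k x * trig s m x) = 0"
proof -
  let ?I = "integral {0..pi} (\<lambda>x. trig s k x * trig s m x)"
  have "integral {0..pi} (\<lambda>x. (- (real k)\<^sup>2 * trig s k x) * trig s m x) = - (real m)\<^sup>2 * ?I"
    by (rule integral_deriv2_trig[where u' = "trig_deriv s k"])
      (auto intro!: derivative_eq_intros has_derivative_trig_deriv[THEN DERIV_cong] continuous_intros bc_trig)
  moreover have "integral {0..pi} (\<lambda>x. (- (real k)\<^sup>2 * trig s k x) * trig s m x) = - (real k)\<^sup>2 * ?I"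
    unfolding mult.assoc by simp
  ultimately have "((real m)\<^sup>2 - (real k)\<^sup>2) * ?I = 0" by (simp add: algebra_simps)
  then show ?thesis using assms by simp
qed

text \<open>The span of the cosines, an algebra by the product-to-sum formula. It contains the
  constants (frequency 0) and separates points of [0, pi], where cosine is injective; these are the
  requirements of Stone-Weierstrass.\<close>

inductive cos_poly :: "(real \<Rightarrow> real) \<Rightarrow> bool" where
  base: "cos_poly (\<lambda>x. c * cos (real m * x))"
| add: "cos_poly f \<Longrightarrow> cos_poly g \<Longrightarrow> cos_poly (\<lambda>x. f x + g x)"

lemma cos_poly_mult_base: "cos_poly f \<Longrightarrow> cos_poly (\<lambda>x. f x * (d * cos (real n * x)))"
proof (induction rule: cos_poly.induct)
  case (base c m)
  \<comment> \<open>Frequencies are natural numbers, so the difference frequency enters through its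
    absolute value, which cosine does not notice.\<close>
  have "c * cos (real m * x) * (d * cos (real n * x)) =
      (c * d / 2) * cos (real (m + n) * x) + (c * d / 2) * cos (real (nat \<bar>int m - int n\<bar>) * x)" for x
  proof -
    have "cos (real (nat \<bar>int m - int n\<bar>) * x) = cos ((real m - real n) * x)"
    proof (cases "m \<le> n")
      case True
      then have "real (nat \<bar>int m - int n\<bar>) * x = - ((real m - real n) * x)" by (simp add: algebra_simps)
      then show ?thesis by (metis cos_minus)
    next
      case False
      then have "real (nat \<bar>int m - int n\<bar>) = real m - real n" by linarith
      then show ?thesis by simp
    qed
    then show ?thesis
      by (simp add: cos_times_cos algebra_simps add_divide_distrib)
  qed
  then show ?case by (simp only:) (intro cos_poly.intros)
next
  case (add f g)
  then show ?case unfolding distrib_right by (intro cos_poly.add)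
qed

lemma cos_poly_mult: "cos_poly g \<Longrightarrow> cos_poly f \<Longrightarrow> cos_poly (\<lambda>x. f x * g x)"
proof (induction rule: cos_poly.induct)
  case (base c m)
  then show ?case by (rule cos_poly_mult_base)
next
  case (add g h)
  then show ?case unfolding distrib_left by (intro cos_poly.add)
qed

lemma cos_poly_continuous: "cos_poly f \<Longrightarrow> continuous_on S f"
  by (induction rule: cos_poly.induct) (auto intro!: continuous_intros)

text \<open>If f is a cosine polynomial within e of \<open>g\<close>, then the integral of g^2
  equals that of g (g - f), since \<open>g\<close> is orthogonal to f. It is therefore at most e
  times the integral of |g|, for every e > 0.\<close>

lemma cos_complete:
  assumes g: "continuous_on {0..pi} g"
    and 0: "\<And>m. integral {0..pi} (\<lambda>x. g x * cos (real m * x)) = 0" and x: "x \<in> {0..pi}"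
  shows "g x = 0"
proof -
  have gf: "(\<lambda>x. g x * f x) integrable_on {0..pi}" if "cos_poly f" for f
    by (intro integrable_continuous_real continuous_on_mult g cos_poly_continuous that)
  have P0: "integral {0..pi} (\<lambda>x. g x * f x) = 0" if "cos_poly f" for f
    using that
  proof (induction rule: cos_poly.induct)
    case (base c m)
    have "integral {0..pi} (\<lambda>x. c * (g x * cos (real m * x))) = 0" using 0 by simp
    then show ?case by (simp add: mult.left_commute)
  next
    case (add f h)
    have "integral {0..pi} (\<lambda>x. g x * f x + g x * h x) = 0"
      using integral_add[OF gf gf, OF add.hyps] add.IH by simp
    then show ?case by (simp add: distrib_left)
  qed
  define K where "K = integral {0..pi} (\<lambda>x. \<bar>g x\<bar>)"
  have K: "K \<ge> 0" unfolding K_def by (rule integral_nonneg) (auto intro!: integrable_continuous_real continuous_intros g)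
  have le: "integral {0..pi} (\<lambda>x. g x * g x) \<le> e * K" if e: "e > 0" for e
  proof -
    obtain f where f: "cos_poly f" "\<And>x. x \<in> {0..pi} \<Longrightarrow> \<bar>g x - f x\<bar> < e"
    proof (rule exE[OF Stone_Weierstrass_HOL[of "{0..pi}" cos_poly g e]])
      show "cos_poly (\<lambda>x. c)" for c using cos_poly.base[of c 0] by simp
      show "\<exists>f. cos_poly f \<and> f x \<noteq> f y" if "x \<in> {0..pi} \<and> y \<in> {0..pi} \<and> x \<noteq> y" for x y
        using that cos_poly.base[of 1 1] cos_inj_pi[of x y] by (intro exI[of _ cos]) auto
      show "cos_poly (\<lambda>x. f x + h x)" "cos_poly (\<lambda>x. f x * h x)" if "cos_poly f \<and> cos_poly h" for f h
        using that cos_poly.add[of f h] cos_poly_mult[of h f] by blast+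
      show "continuous_on {0..pi} f" if "cos_poly f" for f
        using that by (rule cos_poly_continuous)
    qed (use e g in auto)
    have "integral {0..pi} (\<lambda>x. g x * g x) = integral {0..pi} (\<lambda>x. g x * g x) - integral {0..pi} (\<lambda>x. g x * f x)"
      using P0[OF f(1)] by simp
    also have "\<dots> = integral {0..pi} (\<lambda>x. g x * g x - g x * f x)"
      by (rule integral_diff[symmetric])
        (use gf[OF f(1)] in \<open>auto intro!: integrable_continuous_real continuous_intros g\<close>)
    also have "\<dots> \<le> integral {0..pi} (\<lambda>x. e * \<bar>g x\<bar>)"
    proof (rule integral_le)
      fix x assume "x \<in> {0..pi}"
      have "g x * g x - g x * f x = g x * (g x - f x)" by (simp add: algebra_simps)
      also have "\<dots> \<le> \<bar>g x\<bar> * \<bar>g x - f x\<bar>" by (metis abs_ge_self abs_mult)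
      also have "\<dots> \<le> \<bar>g x\<bar> * e"
        using f(2)[OF \<open>x \<in> {0..pi}\<close>] by (intro mult_left_mono) auto
      finally show "g x * g x - g x * f x \<le> e * \<bar>g x\<bar>" by (simp add: mult.commute)
    qed (use gf[OF f(1)] in \<open>auto intro!: integrable_diff integrable_continuous_real continuous_intros g cos_poly_continuous[OF f(1)]\<close>)
    also have "\<dots> = e * K" by (simp add: K_def)
    finally show ?thesis .
  qed
  have "integral {0..pi} (\<lambda>x. g x * g x) \<le> 0"
  proof (rule field_le_epsilon)
    fix e :: real assume e: "e > 0"
    \<comment> \<open>The denominator K + 1 instead of K covers the case K = 0.\<close>
    have "integral {0..pi} (\<lambda>x. g x * g x) \<le> e / (K + 1) * K"
      using e K by (intro le) auto
    also have "\<dots> \<le> e" using e K by (simp add: divide_simps)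
    finally show "integral {0..pi} (\<lambda>x. g x * g x) \<le> 0 + e" by simp
  qed
  moreover have "integral {0..pi} (\<lambda>x. g x * g x) \<ge> 0"
    by (rule integral_nonneg) (auto intro!: integrable_continuous_real continuous_intros g)
  ultimately have "integral {0..pi} (\<lambda>x. g x * g x) = 0" by simp
  then have "\<forall>x\<in>{0..pi}. g x * g x = 0"
    by (subst (asm) integral_eq_0_iff) (auto intro!: continuous_intros g)
  then show ?thesis using x by simp
qed

text \<open>The sine case reduces to the cosine case for g(x) sin x, because 2 sin x cos(m x) =
  sin((m + 1) x) - sin((m - 1) x). Dividing by sin x afterwards is possible only in the open
  interval.\<close>

lemma trig_complete:
  assumes g: "continuous_on {0..pi} g"
    and 0: "\<And>m. integral {0..pi} (\<lambda>x. g x * trig s m x) = 0" and x: "x \<in> {0<..<pi}"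
  shows "g x = 0"
proof (cases s)
  case False
  then show ?thesis using cos_complete[OF g] 0 x by (auto simp: trig_def)
next
  case True
  then have 0: "integral {0..pi} (\<lambda>x. g x * sin (real m * x)) = 0" for m
    using 0[of m] by (simp add: trig_def)
  have "integral {0..pi} (\<lambda>x. g x * sin x * cos (real m * x)) = 0" for m
  proof (cases m)
    case 0
    then show ?thesis using \<open>integral {0..pi} (\<lambda>x. g x * sin (real 1 * x)) = 0\<close> by simp
  next
    case (Suc k)
    have "g x * sin x * cos (real m * x) =
        (1 / 2) * (g x * sin (real (Suc m) * x)) - (1 / 2) * (g x * sin (real k * x))" for x
    proof -
      have "sin (real (Suc m) * x) - sin (real k * x) = 2 * (sin x * cos (real m * x))"
        using Suc sin_diff_sin[of "real (Suc m) * x" "real k * x"] by (simp add: algebra_simps add_divide_distrib)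
      then show ?thesis by (simp add: algebra_simps)
    qed
    then have "integral {0..pi} (\<lambda>x. g x * sin x * cos (real m * x)) =
        integral {0..pi} (\<lambda>x. (1 / 2) * (g x * sin (real (Suc m) * x)))
        - integral {0..pi} (\<lambda>x. (1 / 2) * (g x * sin (real k * x)))"
      by (simp only:) (rule integral_diff; auto intro!: integrable_continuous_real continuous_intros g)
    also have "\<dots> = 0" using 0[of "Suc m"] 0[of k] by (simp only: integral_mult_right)
    finally show ?thesis .
  qed
  then have "g x * sin x = 0"
    using x by (intro cos_complete[of "\<lambda>x. g x * sin x"]) (auto intro!: continuous_intros g)
  then show ?thesis using x sin_gt_zero[of x] by auto
qed

section \<open>Fourier coefficients on the square, as iterated integrals\<close>

definition coef :: "bool \<Rightarrow> bool \<Rightarrow> (real \<Rightarrow> real \<Rightarrow> real) \<Rightarrow> nat \<Rightarrow> nat \<Rightarrow> real" where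
  "coef s t F m n = integral {0..pi} (\<lambda>x. integral {0..pi} (\<lambda>y. F x y * trig t n y) * trig s m x)"

abbreviation sq2 :: "(real \<times> real) set" where "sq2 \<equiv> {0..pi} \<times> {0..pi}"

lemma coef_inner_continuous:
  assumes "continuous_on sq2 (\<lambda>(x, y). F x y)"
  shows "continuous_on {0..pi} (\<lambda>x. integral {0..pi} (\<lambda>y. F x y * trig t n y))"
  unfolding interval_cbox
  by (rule integral_continuous_on_param)
    (use assms in \<open>auto simp: split_def intro!: continuous_intros\<close>)

lemma continuous_on_section:
  assumes "continuous_on sq2 (\<lambda>(x, y). F x y)" "x \<in> {0..pi}"
  shows "continuous_on {0..pi} (F x)"
proof -
  have "continuous_on {0..pi} (\<lambda>y. (\<lambda>(x, y). F x y) (x, y))"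
    by (rule continuous_on_compose2[OF assms(1)]) (use assms(2) in \<open>auto intro!: continuous_intros\<close>)
  then show ?thesis by simp
qed

text \<open>Completeness in x makes each inner integral vanish at interior x; completeness in y then
  applies to the section of \<open>F\<close> at that x.\<close>

lemma coef_complete:
  assumes F: "continuous_on sq2 (\<lambda>(x, y). F x y)" and 0: "\<And>m n. coef s t F m n = 0"
    and x: "x \<in> {0<..<pi}" and y: "y \<in> {0<..<pi}"
  shows "F x y = 0"
proof -
  have "integral {0..pi} (\<lambda>y. F x y * trig t n y) = 0" for n
    using coef_inner_continuous[OF F] 0 x unfolding coef_def by (rule trig_complete)
  then show ?thesis
    using continuous_on_section[OF F, of x] x y by (intro trig_complete[of "F x" t y]) auto
qed

text \<open>Fubini. Integration by parts is carried out in the inner variable, so the x-derivative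
  is treated after exchanging the two integrals.\<close>

lemma coef_swap:
  assumes F: "continuous_on sq2 (\<lambda>(x, y). F x y)"
  shows "coef s t F m n = coef t s (\<lambda>y x. F x y) n m"
proof -
  let ?G = "\<lambda>x y. F x y * trig t n y * trig s m x"
  have G: "continuous_on (cbox (0, 0) (pi, pi)) (\<lambda>(x, y). ?G x y)"
    using F by (auto simp: split_def cbox_Pair_eq intro!: continuous_intros)
  have "coef s t F m n = integral (cbox 0 pi) (\<lambda>x. integral (cbox 0 pi) (?G x))"
    unfolding coef_def by simp
  also have "\<dots> = integral (cbox 0 pi) (\<lambda>y. integral (cbox 0 pi) (\<lambda>x. ?G x y))"
    by (rule integral_swap_continuous[OF G])
  also have "(\<lambda>x y. ?G x y) = (\<lambda>x y. F x y * trig s m x * trig t n y)"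
    by (auto simp: algebra_simps)
  finally show ?thesis unfolding coef_def by simp
qed

lemma coef_add:
  assumes "continuous_on sq2 (\<lambda>(x, y). F x y)" "continuous_on sq2 (\<lambda>(x, y). G x y)"
  shows "coef s t (\<lambda>x y. F x y + G x y) m n = coef s t F m n + coef s t G m n"
proof -
  have "integral {0..pi} (\<lambda>y. (F x y + G x y) * trig t n y) * trig s m x =
      integral {0..pi} (\<lambda>y. F x y * trig t n y) * trig s m x
      + integral {0..pi} (\<lambda>y. G x y * trig t n y) * trig s m x" if "x \<in> {0..pi}" for x
    unfolding distrib_right
    by (subst integral_add) (auto intro!: integrable_continuous_real continuous_intros
        continuous_on_section[OF assms(1) that] continuous_on_section[OF assms(2) that] simp: distrib_right)
  then have "coef s t (\<lambda>x y. F x y + G x y) m n = integral {0..pi} (\<lambda>x.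
      integral {0..pi} (\<lambda>y. F x y * trig t n y) * trig s m x
      + integral {0..pi} (\<lambda>y. G x y * trig t n y) * trig s m x)"
    unfolding coef_def by (intro integral_cong) auto
  also have "\<dots> = coef s t F m n + coef s t G m n"
    unfolding coef_def
    by (rule integral_add) (auto intro!: integrable_continuous_real continuous_intros
        coef_inner_continuous assms)
  finally show ?thesis .
qed

lemma coef_mult: "coef s t (\<lambda>x y. c * F x y) m n = c * coef s t F m n"
  by (simp add: coef_def mult.assoc)

lemma coef_zero: "coef s t (\<lambda>x y. 0) m n = 0"
  by (simp add: coef_def)

lemma coef_cong:
  assumes "\<And>x y. x \<in> {0..pi} \<Longrightarrow> y \<in> {0..pi} \<Longrightarrow> F x y = G x y"
  shows "coef s t F m n = coef s t G m n"
  unfolding coef_def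
  by (intro integral_cong arg_cong2[where f="(*)"] refl) (use assms in auto)

definition trig2 :: "bool \<Rightarrow> bool \<Rightarrow> nat \<times> nat \<Rightarrow> plane \<Rightarrow> real" where
  "trig2 s t k p = trig s (fst k) (p $ 1) * trig t (snd k) (p $ 2)"

lemma has_derivative_nth: "((\<lambda>p. p $ i) has_derivative (\<lambda>h. h $ i)) (at x within S)"
  by (rule bounded_linear_imp_has_derivative) (rule bounded_linear_vec_nth)

lemma has_derivative_trig2:
  "(trig2 s t k has_derivative (\<lambda>h. trig s (fst k) (p $ 1) * (h $ 2 * trig_deriv t (snd k) (p $ 2))
     + h $ 1 * trig_deriv s (fst k) (p $ 1) * trig t (snd k) (p $ 2))) (at p)"
proof -
  have D: "((\<lambda>p. trig s m (p $ i)) has_derivative (\<lambda>h. h $ i * trig_deriv s m (p $ i))) (at p)"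
    for s m and i :: 2
    by (rule DERIV_compose_FDERIV[OF _ has_derivative_nth])
      (auto intro!: derivative_eq_intros)
  show ?thesis
    unfolding trig2_def[abs_def] by (rule has_derivative_mult[OF D D])
qed

lemma partial_trig2:
  "partial 1 (trig2 s t k) = (\<lambda>p. ((if s then 1 else - 1) * real (fst k)) * trig2 (\<not> s) t k p)"
  "partial 2 (trig2 s t k) = (\<lambda>p. ((if t then 1 else - 1) * real (snd k)) * trig2 s (\<not> t) k p)"
  by (auto simp: fun_eq_iff partial_eqI[OF has_derivative_trig2] axis_def trig2_def trig_deriv_def)

lemma smooth_trig2: "smooth (trig2 s t k)"
proof (rule smooth_coinduct[where X="\<lambda>f. \<exists>c s t. f = (\<lambda>p. c * trig2 s t k p)"])
  show "\<exists>c s' t'. trig2 s t k = (\<lambda>p. c * trig2 s' t' k p)"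
    by (rule exI[of _ 1]) auto
  fix f assume "\<exists>c s t. f = (\<lambda>p. c * trig2 s t k p)"
  then obtain c s t where f: "f = (\<lambda>p. c * trig2 s t k p)" by blast
  have D: "(f has_derivative (\<lambda>h. c * (trig s (fst k) (p $ 1) * (h $ 2 * trig_deriv t (snd k) (p $ 2))
     + h $ 1 * trig_deriv s (fst k) (p $ 1) * trig t (snd k) (p $ 2)))) (at p)" for p
    unfolding f by (rule has_derivative_mult_right[OF has_derivative_trig2])
  have "partial 1 f = (\<lambda>p. (c * ((if s then 1 else - 1) * real (fst k))) * trig2 (\<not> s) t k p)"
    "partial 2 f = (\<lambda>p. (c * ((if t then 1 else - 1) * real (snd k))) * trig2 s (\<not> t) k p)"
    by (auto simp: fun_eq_iff partial_eqI[OF D] axis_def trig2_def trig_deriv_def)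
  then have "\<exists>c s t. partial i f = (\<lambda>p. c * trig2 s t k p)" if "i = 1 \<or> i = 2" for i
    using that by (elim disjE) (hypsubst, intro exI, assumption)+
  then have "\<exists>c s t. partial i f = (\<lambda>p. c * trig2 s t k p)" for i
    using exhaust_2[of i] by blast
  then show "(\<forall>x. f differentiable at x) \<and> (\<forall>i. \<exists>c s t. partial i f = (\<lambda>p. c * trig2 s t k p))"
    using D by (auto simp: differentiable_def)
qed

lemma hodge_laplacian0_trig2:
  "hodge_laplacian0 (trig2 s t k) p = ((real (fst k))\<^sup>2 + (real (snd k))\<^sup>2) * trig2 s t k p"
  unfolding hodge_laplacian0_eq partial_trig2 smooth_mult_const(2)[OF smooth_trig2]
  by (auto simp: power2_eq_square algebra_simps)

lemma trig_period: "trig s m (x + 2 * pi * of_int k) = trig s m x"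
proof -
  have "real m * (x + 2 * pi * of_int k) = real m * x + 2 * pi * of_int (int m * k)"
    by (simp add: algebra_simps)
  then have "sin (real m * (x + 2 * pi * of_int k)) = sin (real m * x) \<and>
      cos (real m * (x + 2 * pi * of_int k)) = cos (real m * x)"
    unfolding sin_cos_eq_iff by blast
  then show ?thesis unfolding trig_def by simp
qed

lemma trig_minus: "trig s m (- x) = (if s then - trig s m x else trig s m x)"
  by (simp add: trig_def)

lemma trig2_period: "t \<in> period_lattice \<Longrightarrow> trig2 s u k (p + t) = trig2 s u k p"
  unfolding period_lattice_def trig2_def forall_2 by (auto simp: trig_period)

lemma mem_square: "p \<in> square a \<longleftrightarrow> p $ 1 \<in> {0..a} \<and> p $ 2 \<in> {0..a}"
  by (auto simp: square_def forall_2)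

lemma continuous_on_smooth_pt:
  "smooth f \<Longrightarrow> continuous_on S (\<lambda>(x, y). f (pt x y))"
  by (auto simp: split_def intro!: continuous_intros)

text \<open>The flag \<open>s\<close> governs the two vertical sides, \<open>t\<close> the two
  horizontal ones.\<close>

definition bc2 :: "bool \<Rightarrow> bool \<Rightarrow> (plane \<Rightarrow> real) \<Rightarrow> bool" where
  "bc2 s t f \<longleftrightarrow> (\<forall>y\<in>{0..pi}. bc s (\<lambda>x. f (pt x y)) (\<lambda>x. partial 1 f (pt x y))) \<and>
     (\<forall>x\<in>{0..pi}. bc t (\<lambda>y. f (pt x y)) (\<lambda>y. partial 2 f (pt x y)))"

abbreviation pcoef :: "bool \<Rightarrow> bool \<Rightarrow> (plane \<Rightarrow> real) \<Rightarrow> nat \<times> nat \<Rightarrow> real" where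
  "pcoef s t f k \<equiv> coef s t (\<lambda>x y. f (pt x y)) (fst k) (snd k)"

text \<open>Frequency 0 is kept also in a Dirichlet direction, where the corresponding
  \<open>trig2\<close> is the zero function. Such pairs are harmless in sums, but their norms
  vanish.\<close>

definition modes :: "real \<Rightarrow> (nat \<times> nat) set" where
  "modes ev = {k. (real (fst k))\<^sup>2 + (real (snd k))\<^sup>2 = ev}"

lemma finite_modes: "finite (modes ev)"
proof (rule finite_subset)
  show "modes ev \<subseteq> {..nat \<lceil>ev\<rceil>} \<times> {..nat \<lceil>ev\<rceil>}"
  proof
    fix k assume "k \<in> modes ev"
    then have k: "(real (fst k))\<^sup>2 + (real (snd k))\<^sup>2 = ev" by (simp add: modes_def)
    have le: "real m \<le> (real m)\<^sup>2" for m
      by (cases m) (auto simp: power2_eq_square)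
    have "real (fst k) \<le> ev" "real (snd k) \<le> ev"
      using k le[of "fst k"] le[of "snd k"] zero_le_power2[of "real (fst k)"]
        zero_le_power2[of "real (snd k)"] by linarith+
    then have "fst k \<le> nat \<lceil>ev\<rceil>" "snd k \<le> nat \<lceil>ev\<rceil>" by linarith+
    then show "k \<in> {..nat \<lceil>ev\<rceil>} \<times> {..nat \<lceil>ev\<rceil>}" by (cases k) auto
  qed
qed simp

text \<open>Green's formula in each variable moves the Laplacian onto the trigonometric product,
  which gives (ev - m^2 - n^2) times the coefficient equal to 0. The eigenvalue equation is used on
  the square only, so the lemma serves forms given merely there.\<close>

lemma pcoef_eigen:
  assumes f: "smooth f" and bc: "bc2 s t f"
    and lap: "\<And>p. p \<in> square pi \<Longrightarrow> hodge_laplacian0 f p = ev * f p" and k: "k \<notin> modes ev"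
  shows "pcoef s t f k = 0"
proof -
  obtain m n where [simp]: "k = (m, n)" by (cases k)
  note sp = smooth_partial[OF smooth_partial[OF f]]
  let ?f1 = "partial 1 (partial 1 f)" and ?f2 = "partial 2 (partial 2 f)"
  have 2: "pcoef s t ?f2 k = - (real n)\<^sup>2 * pcoef s t f k"
  proof -
    have "integral {0..pi} (\<lambda>y. ?f2 (pt x y) * trig t n y) * trig s m x =
        - (real n)\<^sup>2 * (integral {0..pi} (\<lambda>y. f (pt x y) * trig t n y) * trig s m x)"
      if "x \<in> {0..pi}" for x
      by (subst integral_deriv2_trig[where u="\<lambda>y. f (pt x y)" and u'="\<lambda>y. partial 2 f (pt x y)"])
        (use bc that in \<open>auto simp: bc2_def has_real_derivative_iff_has_vector_derivative
          intro!: has_vector_derivative_pt smooth_differentiable smooth_partial f continuous_intros\<close>)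
    then have "pcoef s t ?f2 k = integral {0..pi} (\<lambda>x.
        - (real n)\<^sup>2 * (integral {0..pi} (\<lambda>y. f (pt x y) * trig t n y) * trig s m x))"
      unfolding coef_def by (intro integral_cong) simp
    then show ?thesis by (simp add: coef_def)
  qed
  have 1: "pcoef s t ?f1 k = - (real m)\<^sup>2 * pcoef s t f k"
  proof -
    have "integral {0..pi} (\<lambda>x. ?f1 (pt x y) * trig s m x) * trig t n y =
        - (real m)\<^sup>2 * (integral {0..pi} (\<lambda>x. f (pt x y) * trig s m x) * trig t n y)"
      if "y \<in> {0..pi}" for y
      by (subst integral_deriv2_trig[where u="\<lambda>x. f (pt x y)" and u'="\<lambda>x. partial 1 f (pt x y)"])
        (use bc that in \<open>auto simp: bc2_def has_real_derivative_iff_has_vector_derivative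
          intro!: has_vector_derivative_pt smooth_differentiable smooth_partial f continuous_intros\<close>)
    then have "coef t s (\<lambda>y x. ?f1 (pt x y)) n m = integral {0..pi} (\<lambda>y.
        - (real m)\<^sup>2 * (integral {0..pi} (\<lambda>x. f (pt x y) * trig s m x) * trig t n y))"
      unfolding coef_def by (intro integral_cong) simp
    also have "\<dots> = - (real m)\<^sup>2 * coef t s (\<lambda>y x. f (pt x y)) n m" by (simp add: coef_def)
    finally show ?thesis
      using coef_swap[OF continuous_on_smooth_pt[OF sp]] coef_swap[OF continuous_on_smooth_pt[OF f]]
      by simp
  qed
  have "ev * pcoef s t f k = pcoef s t (\<lambda>p. ev * f p) k" by (simp add: coef_mult)
  also have "\<dots> = pcoef s t (\<lambda>p. (- 1) * (?f1 p + ?f2 p)) k"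
    by (intro coef_cong) (use lap in \<open>auto simp: mem_square hodge_laplacian0_eq\<close>)
  also have "\<dots> = (- 1) * (pcoef s t ?f1 k + pcoef s t ?f2 k)"
    unfolding coef_mult by (subst coef_add) (auto intro: continuous_on_smooth_pt sp)
  also have "\<dots> = ((real m)\<^sup>2 + (real n)\<^sup>2) * pcoef s t f k"
    unfolding 1 2 by (simp add: algebra_simps)
  finally have "(ev - ((real m)\<^sup>2 + (real n)\<^sup>2)) * pcoef s t f k = 0" by (simp add: algebra_simps)
  then show ?thesis using k by (auto simp: modes_def)
qed

lemma pcoef_sum:
  assumes "\<And>j. j \<in> J \<Longrightarrow> smooth (f j)"
  shows "pcoef s t (\<lambda>p. \<Sum>j\<in>J. f j p) k = (\<Sum>j\<in>J. pcoef s t (f j) k)"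
  using assms
proof (induction J rule: infinite_finite_induct)
  case (insert j J)
  have "smooth (\<lambda>p. \<Sum>j\<in>J. f j p)" using smooth_sum[of J f] insert.prems by blast
  then show ?case
    using insert coef_add[OF continuous_on_smooth_pt continuous_on_smooth_pt, of "f j" "\<lambda>p. \<Sum>j\<in>J. f j p"]
    by simp
qed (simp_all add: coef_zero)

abbreviation trig_norm :: "bool \<Rightarrow> nat \<Rightarrow> real" where
  "trig_norm s m \<equiv> integral {0..pi} (\<lambda>x. trig s m x * trig s m x)"

lemma trig_norm_zero:
  assumes "trig_norm s m = 0" "x \<in> {0..pi}"
  shows "trig s m x = 0"
proof -
  have "\<forall>x\<in>{0..pi}. trig s m x * trig s m x = 0"
    using assms(1) by (subst (asm) integral_eq_0_iff) (auto intro!: continuous_intros)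
  then show ?thesis using assms(2) by simp
qed

lemma pcoef_trig2:
  "pcoef s t (trig2 s t j) k =
     (if j = k then trig_norm s (fst k) * trig_norm t (snd k) else 0)"
proof -
  have "pcoef s t (trig2 s t j) k = integral {0..pi} (\<lambda>x. trig s (fst j) x * trig s (fst k) x)
      * integral {0..pi} (\<lambda>y. trig t (snd j) y * trig t (snd k) y)"
  proof -
    have "integral {0..pi} (\<lambda>y. trig2 s t j (pt x y) * trig t (snd k) y) * trig s (fst k) x =
        integral {0..pi} (\<lambda>y. trig t (snd j) y * trig t (snd k) y) * (trig s (fst j) x * trig s (fst k) x)" for x
      by (simp add: trig2_def mult.assoc)
    then show ?thesis unfolding coef_def by (simp only:) simp
  qed
  then show ?thesis
    using trig_orthogonal[of "fst j" "fst k" s] trig_orthogonal[of "snd j" "snd k" t]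
    by (auto simp: prod_eq_iff)
qed

text \<open>The difference of \<open>f\<close> and the finite sum over \<open>modes ev\<close> has
  only zero coefficients: inside \<open>modes ev\<close> by the choice of \<open>c\<close>, outside
  by \<open>pcoef_eigen\<close> and orthogonality. Completeness makes it vanish in the open square,
  continuity on the closed one.\<close>

lemma trig_expansion:
  assumes f: "smooth f" and bc: "bc2 s t f"
    and lap: "\<And>p. p \<in> square pi \<Longrightarrow> hodge_laplacian0 f p = ev * f p"
  obtains c where "\<And>p. p \<in> square pi \<Longrightarrow> f p = (\<Sum>k\<in>modes ev. c k * trig2 s t k p)"
proof -
  \<comment> \<open>For a sine of frequency 0 the norm is 0 and the quotient is 0 by convention. The
    coefficient of \<open>f\<close> is then 0 as well, so \<open>cn\<close> holds without
    exception.\<close>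
  define c where "c k = pcoef s t f k / (trig_norm s (fst k) * trig_norm t (snd k))" for k
  define g where "g p = (\<Sum>k\<in>modes ev. c k * trig2 s t k p)" for p
  have g: "smooth g"
    unfolding g_def by (rule smooth_sum[THEN conjunct1]) (intro smooth_mult_const smooth_trig2)
  have cn: "c k * (trig_norm s (fst k) * trig_norm t (snd k)) = pcoef s t f k" for k
  proof (cases "trig_norm s (fst k) = 0 \<or> trig_norm t (snd k) = 0")
    case True
    have "coef s t (\<lambda>x y. f (pt x y)) (fst k) (snd k) = coef s t (\<lambda>x y. 0) (fst k) (snd k)"
      unfolding coef_def
    proof (intro integral_cong)
      fix x assume x: "x \<in> {0..pi}"
      show "integral {0..pi} (\<lambda>y. f (pt x y) * trig t (snd k) y) * trig s (fst k) x =
          integral {0..pi} (\<lambda>y. 0 * trig t (snd k) y) * trig s (fst k) x"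
      proof (cases "trig_norm s (fst k) = 0")
        case True
        have "trig s (fst k) x = 0" by (rule trig_norm_zero[OF True x])
        then show ?thesis by simp
      next
        case False
        then have n: "trig_norm t (snd k) = 0" using True by blast
        have "integral {0..pi} (\<lambda>y. f (pt x y) * trig t (snd k) y) = integral {0..pi} (\<lambda>y. 0 * trig t (snd k) y)"
        proof (rule integral_cong)
          fix y assume "y \<in> {0..pi}"
          then have "trig t (snd k) y = 0" by (rule trig_norm_zero[OF n])
          then show "f (pt x y) * trig t (snd k) y = 0 * trig t (snd k) y" by simp
        qed
        then show ?thesis by simp
      qed
    qed
    then show ?thesis using True by (auto simp: coef_zero)
  qed (simp add: c_def)
  have "pcoef s t g k = pcoef s t f k" for k
  proof -
    have "pcoef s t g k = (\<Sum>j\<in>modes ev. pcoef s t (\<lambda>p. c j * trig2 s t j p) k)"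
      unfolding g_def by (rule pcoef_sum) (intro smooth_mult_const smooth_trig2)
    also have "\<dots> = (\<Sum>j\<in>modes ev. if j = k then c j * (trig_norm s (fst j) * trig_norm t (snd j)) else 0)"
      by (intro sum.cong refl) (simp add: coef_mult pcoef_trig2)
    also have "\<dots> = (if k \<in> modes ev then pcoef s t f k else 0)"
      using finite_modes by (simp add: cn)
    also have "\<dots> = pcoef s t f k"
      using pcoef_eigen[OF f bc lap] by auto
    finally show ?thesis .
  qed
  then have 0: "coef s t (\<lambda>x y. f (pt x y) + (- 1) * g (pt x y)) m n = 0" for m n
  proof -
    have "coef s t (\<lambda>x y. f (pt x y) + (- 1) * g (pt x y)) m n =
        pcoef s t f (m, n) + (- 1) * pcoef s t g (m, n)"
      using coef_add[OF continuous_on_smooth_pt[OF f] continuous_on_smooth_pt[OF smooth_mult_const(1)[OF g]]]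
      by (simp only: coef_mult fst_conv snd_conv)
    then show ?thesis using \<open>pcoef s t g (m, n) = pcoef s t f (m, n)\<close> by (simp only:)
  qed
  have cont: "continuous_on sq2 (\<lambda>(x, y). f (pt x y) + (- 1) * g (pt x y))"
    using continuous_on_smooth_pt[OF smooth_add(1)[OF f smooth_mult_const(1)[OF g, of "- 1"]]] .
  have z: "f p + (- 1) * g p = 0" if "p \<in> box 0 (pt pi pi)" for p
  proof -
    have "p $ 1 \<in> {0<..<pi}" "p $ 2 \<in> {0<..<pi}"
      using that by (auto simp: mem_box_cart forall_2)
    then have "f (pt (p $ 1) (p $ 2)) + (- 1) * g (pt (p $ 1) (p $ 2)) = 0"
      using coef_complete[OF cont 0] by blast
    then show ?thesis by (simp only: pt_eta)
  qed
  \<comment> \<open>A point of the open box, which must be nonempty for its closure to be the closed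
    box.\<close>
  have "pt 1 1 \<in> box 0 (pt pi pi)" using pi_gt3 by (simp add: mem_box_cart forall_2)
  then have cl: "closure (box 0 (pt pi pi)) = cbox 0 (pt pi pi)" by (intro closure_box) auto
  show ?thesis
  proof (rule that[of c])
    fix p assume "p \<in> square pi"
    then have "p \<in> closure (box 0 (pt pi pi))"
      unfolding cl by (simp add: mem_square mem_box_cart forall_2)
    then have "f p + (- 1) * g p = 0"
      by (rule continuous_constant_on_closure[of "box 0 (pt pi pi)" "\<lambda>p. f p + (- 1) * g p", rotated 2])
        (intro smooth_continuous_on smooth_add smooth_mult_const f g, rule z)
    then show "f p = (\<Sum>k\<in>modes ev. c k * trig2 s t k p)" by (simp add: g_def)
  qed
qed

section \<open>The five groups\<close>

definition refl_matrix :: "real^2^2" where "refl_matrix = vector [vector [1, 0], vector [0, - 1]]"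
definition swap_matrix :: "real^2^2" where "swap_matrix = vector [vector [0, 1], vector [1, 0]]"
definition rot_matrix :: "real^2^2" where "rot_matrix = vector [vector [0, - 1], vector [1, 0]]"

lemma refl_matrix_mult [simp]: "refl_matrix *v p = pt (p $ 1) (- p $ 2)"
  and swap_matrix_mult [simp]: "swap_matrix *v p = pt (p $ 2) (p $ 1)"
  and rot_matrix_mult [simp]: "rot_matrix *v p = pt (- p $ 2) (p $ 1)"
  by (simp_all add: refl_matrix_def swap_matrix_def rot_matrix_def matrix_vector_mult_def plane_eq_iff sum_2)

lemma matrix2_eq_iff: "M = N \<longleftrightarrow> M $ 1 $ 1 = N $ 1 $ 1 \<and> M $ 1 $ 2 = N $ 1 $ 2 \<and>
    M $ 2 $ 1 = N $ 2 $ 1 \<and> M $ 2 $ 2 = N $ 2 $ (2::2)" for M N :: "real^2^2"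
  by (auto simp: plane_eq_iff)

lemma matrix2_simps:
  "(A ** B) $ i $ j = A $ i $ 1 * B $ 1 $ j + A $ i $ 2 * B $ 2 $ j"
  "transpose A $ i $ j = A $ j $ i" "(mat 1 :: real^2^2) $ i $ j = (if i = j then 1 else 0)"
  for A B :: "real^2^2"
  by (simp_all add: matrix_matrix_mult_def transpose_def mat_def sum_2)

lemma matrix_nth [simp]:
  "refl_matrix $ 1 $ 1 = 1" "refl_matrix $ 1 $ 2 = 0" "refl_matrix $ 2 $ 1 = 0" "refl_matrix $ 2 $ 2 = - 1"
  "swap_matrix $ 1 $ 1 = 0" "swap_matrix $ 1 $ 2 = 1" "swap_matrix $ 2 $ 1 = 1" "swap_matrix $ 2 $ 2 = 0"
  "rot_matrix $ 1 $ 1 = 0" "rot_matrix $ 1 $ 2 = - 1" "rot_matrix $ 2 $ 1 = 1" "rot_matrix $ 2 $ 2 = 0"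
  by (simp_all add: refl_matrix_def swap_matrix_def rot_matrix_def)

lemma period_lattice_nth:
  "t \<in> period_lattice \<longleftrightarrow> (\<exists>k::int. t $ 1 = 2 * pi * of_int k) \<and> (\<exists>k::int. t $ 2 = 2 * pi * of_int k)"
  by (simp add: period_lattice_def forall_2)

lemma period_minus: "(\<exists>k::int. - x = 2 * pi * of_int k) \<longleftrightarrow> (\<exists>k::int. x = 2 * pi * of_int k)"
  by (metis add.inverse_inverse mult_minus_right of_int_minus)

lemma period_two_pi: "\<exists>k::int. 2 * pi = 2 * pi * of_int k" "\<exists>k::int. pi + pi = 2 * pi * of_int k"
  "\<exists>k::int. - pi - pi = 2 * pi * of_int k"
  by (auto intro: exI[of _ 1] exI[of _ "- 1"])

lemma crystal_refl: "b \<in> {0, pt pi 0, pt pi pi} \<Longrightarrow> crystal refl_matrix b"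
  by unfold_locales
    (auto simp: period_lattice_nth orthogonal_matrix_def matrix2_eq_iff matrix2_simps period_minus
      intro: period_two_pi exI[of _ "- 1"])

lemma crystal_swap: "crystal swap_matrix 0"
  and crystal_rot: "crystal rot_matrix 0"
  by unfold_locales
    (auto simp: period_lattice_nth orthogonal_matrix_def matrix2_eq_iff matrix2_simps period_minus)

text \<open>For the reflection y to -y, a half period along x makes a glide, while a half period
  along y only displaces the mirror; for its negative the roles are exchanged. So
  \<open>pt pi 0\<close> leaves the mirrors x = pi/2 modulo pi, and \<open>pt pi pi\<close> turns
  every mirror into a glide.\<close>

definition pmm :: "motion set" where "pmm = crys refl_matrix 0"
definition pmg :: "motion set" where "pmg = crys refl_matrix (pt pi 0)"
definition pgg :: "motion set" where "pgg = crys refl_matrix (pt pi pi)"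
definition cmm :: "motion set" where "cmm = crys swap_matrix 0"
definition p4 :: "motion set" where "p4 = crys rot_matrix 0"

interpretation pmm: crystal refl_matrix 0
  rewrites "crys refl_matrix 0 = pmm"
  by (simp_all add: crystal_refl pmm_def)
interpretation pmg: crystal refl_matrix "pt pi 0"
  rewrites "crys refl_matrix (pt pi 0) = pmg"
  by (simp_all add: crystal_refl pmg_def)
interpretation pgg: crystal refl_matrix "pt pi pi"
  rewrites "crys refl_matrix (pt pi pi) = pgg"
  by (simp_all add: crystal_refl pgg_def)
interpretation cmm: crystal swap_matrix 0
  rewrites "crys swap_matrix 0 = cmm"
  by (simp_all add: crystal_swap cmm_def)
interpretation p4: crystal rot_matrix 0
  rewrites "crys rot_matrix 0 = p4"
  by (simp_all add: crystal_rot p4_def)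

lemma inner_plane: "p \<bullet> q = p $ 1 * q $ 1 + p $ 2 * q $ 2" for p q :: plane
  by (simp add: inner_vec_def sum_2)

lemma spectrum1_eq:
  assumes "G \<in> {pmm, pmg, pgg, cmm, p4}"
  shows "spectrum1 G ev = fun_dim (odd_eigenfunctions ev)"
proof -
  \<comment> \<open>The covector \<open>v\<close> must not be an eigenvector of the transposed
    matrix. This excludes the coordinate covectors for the diagonal reflection and
    \<open>pt 1 1\<close> for the swap, hence the different choice for cmm. The vector
    \<open>q\<close> is orthogonal to \<open>v\<close> and scaled so that \<open>A *v q\<close>
    pairs with \<open>v\<close> to 1.\<close>
  have "spectrum1 pmm ev = fun_dim (odd_eigenfunctions ev)"
    by (rule pmm.spectrum1_crys[where v="pt 1 1" and q="pt (1/2) (-1/2)"])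
      (auto simp: inner_plane plane_eq_iff field_simps)
  moreover have "spectrum1 pmg ev = fun_dim (odd_eigenfunctions ev)"
    by (rule pmg.spectrum1_crys[where v="pt 1 1" and q="pt (1/2) (-1/2)"])
      (auto simp: inner_plane plane_eq_iff field_simps)
  moreover have "spectrum1 pgg ev = fun_dim (odd_eigenfunctions ev)"
    by (rule pgg.spectrum1_crys[where v="pt 1 1" and q="pt (1/2) (-1/2)"])
      (auto simp: inner_plane plane_eq_iff field_simps)
  moreover have "spectrum1 cmm ev = fun_dim (odd_eigenfunctions ev)"
    by (rule cmm.spectrum1_crys[where v="pt 1 0" and q="pt 0 1"])
      (auto simp: inner_plane plane_eq_iff field_simps)
  moreover have "spectrum1 p4 ev = fun_dim (odd_eigenfunctions ev)"
    by (rule p4.spectrum1_crys[where v="pt 1 1" and q="pt (1/2) (-1/2)"])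
      (auto simp: inner_plane plane_eq_iff field_simps)
  ultimately show ?thesis using assms by blast
qed

lemma isospectral1_groups: "pairwise isospectral1 {pmm, pmg, pgg, cmm, p4}"
  unfolding pairwise_def isospectral1_def using spectrum1_eq by (auto simp: fun_eq_iff)

section \<open>Reduction to the square\<close>

lemma fold_interval:
  obtains e :: real and k :: int where "e = 1 \<or> e = - 1" "e * x + 2 * pi * of_int k \<in> {0..pi}"
proof -
  \<comment> \<open>This rounding places x - 2 pi k in [-pi, pi); a change of sign then brings it
    into [0, pi].\<close>
  define k where "k = \<lfloor>(x + pi) / (2 * pi)\<rfloor>"
  have "of_int k \<le> (x + pi) / (2 * pi)" "(x + pi) / (2 * pi) < of_int k + 1"
    unfolding k_def by linarith+
  then have k: "2 * pi * of_int k \<le> x + pi" "x + pi < 2 * pi * of_int k + 2 * pi"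
    by (auto simp: field_simps)
  show ?thesis
  proof (cases "x - 2 * pi * of_int k \<ge> 0")
    case True
    then show ?thesis using k by (intro that[of 1 "- k"]) auto
  next
    case False
    then show ?thesis using k by (intro that[of "- 1" "k"]) auto
  qed
qed

definition diag2 :: "real \<Rightarrow> real \<Rightarrow> real^2^2" where
  "diag2 c d = vector [vector [c, 0], vector [0, d]]"

lemma diag2_nth [simp]: "diag2 c d $ 1 $ 1 = c" "diag2 c d $ 1 $ 2 = 0"
    "diag2 c d $ 2 $ 1 = 0" "diag2 c d $ 2 $ 2 = d"
  by (simp_all add: diag2_def)

lemma diag2_mult [simp]: "diag2 c d *v p = pt (c * p $ 1) (d * p $ 2)"
  by (simp add: matrix_vector_mult_def plane_eq_iff sum_2)

lemma diag2_cases: "mat 1 = diag2 1 1" "refl_matrix = diag2 1 (- 1)" "- diag2 c d = diag2 (- c) (- d)"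
  by (auto simp: matrix2_eq_iff matrix2_simps)

lemma pmm_iff: "(t, B) \<in> pmm \<longleftrightarrow> t \<in> period_lattice \<and>
    (\<exists>c d. (c = 1 \<or> c = - 1) \<and> (d = 1 \<or> d = - 1) \<and> B = diag2 c d)"
  unfolding pmm_def crys_def diag2_cases by auto

lemma fold_square:
  obtains g where "g \<in> pmm" "act g p \<in> square pi"
proof -
  obtain c k where c: "c = 1 \<or> c = - 1" "c * p $ 1 + 2 * pi * of_int k \<in> {0..pi}"
    by (rule fold_interval)
  obtain d l where d: "d = 1 \<or> d = - 1" "d * p $ 2 + 2 * pi * of_int l \<in> {0..pi}"
    by (rule fold_interval)
  show ?thesis
    by (rule that[of "(pt (2 * pi * of_int k) (2 * pi * of_int l), diag2 c d)"])
      (use c d in \<open>auto simp: pmm_iff lattice_pt act_pair mem_square\<close>)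
qed

text \<open>Under these assumptions |h| is invariant under pmm, and every orbit of pmm meets the
  square. The absolute values treat even and odd symmetry at once.\<close>

lemma zero_from_square:
  fixes h :: "plane \<Rightarrow> real"
  assumes per: "\<And>t p. t \<in> period_lattice \<Longrightarrow> h (p + t) = h p"
    and sym: "\<And>p. \<bar>h (- p)\<bar> = \<bar>h p\<bar>" "\<And>p. \<bar>h (refl_matrix *v p)\<bar> = \<bar>h p\<bar>"
    and 0: "\<And>p. p \<in> square pi \<Longrightarrow> h p = 0"
  shows "h p = 0"
proof -
  have per': "h (t - p) = h (- p)" if "t \<in> period_lattice" for t p
    using per[OF that, of "- p"] by simp
  have inv: "\<bar>h (act g p)\<bar> = \<bar>h p\<bar>" if "g \<in> pmm" for g
    using that sym(1)[of p] sym(2)[of p] sym(1)[of "refl_matrix *v p"] per per'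
    by (cases g) (auto simp: pmm_def crys_def act_pair simp del: refl_matrix_mult)
  obtain g where "g \<in> pmm" "act g p \<in> square pi" by (rule fold_square)
  then show ?thesis using inv[of g] 0 by simp
qed

text \<open>The chain rule at a fixed point of a motion with diagonal linear part. Where the
  diagonal entry differs from \<open>e\<close>, the partial derivative must vanish: this is the
  source of Neumann conditions.\<close>

lemma partial_fixed_point:
  fixes f :: "plane \<Rightarrow> real"
  assumes f: "smooth f" and sym: "\<And>p. f (act (t, diag2 c d) p) = e * f p"
    and p: "act (t, diag2 c d) p = p"
  shows "c * partial 1 f p = e * partial 1 f p" "d * partial 2 f p = e * partial 2 f p"
  using fun_cong[OF smooth_act(2)[OF f, of 1 "(t, diag2 c d)"], of p]
    fun_cong[OF smooth_act(2)[OF f, of 2 "(t, diag2 c d)"], of p]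
  by (auto simp: sym p smooth_mult_const(2)[OF f])

text \<open>Periodicity turns a symmetry about the line x = 0 into one about x = pi. On such a line
  an odd function vanishes and an even one has zero normal derivative; likewise in y.\<close>

lemma bc2_symmetric:
  assumes f: "smooth f" and per: "\<And>t p. t \<in> period_lattice \<Longrightarrow> f (p + t) = f p"
    and sym1: "\<And>p. f (diag2 (- 1) 1 *v p) = (if s then - f p else f p)"
    and sym2: "\<And>p. f (diag2 1 (- 1) *v p) = (if t then - f p else f p)"
  shows "bc2 s t f"
proof -
  define e where "e u = (if u then - 1 else 1 :: real)" for u
  \<comment> \<open>The reflection in the vertical line at \<open>x\<close> is p1 to 2
    \<open>x\<close> - p1, and 2 \<open>x\<close> is 0 or 2 pi, hence a period.\<close>
  have 1: "f (act (pt (2 * x) 0, diag2 (- 1) 1) p) = e s * f p" if x: "x = 0 \<or> x = pi" for x p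
  proof -
    have "pt (2 * x) 0 \<in> period_lattice"
      using x by (auto simp: lattice_pt intro: period_two_pi exI[of _ "0::int"])
    then show ?thesis using sym1 per unfolding act_pair by (auto simp: e_def)
  qed
  have 2: "f (act (pt 0 (2 * y), diag2 1 (- 1)) p) = e t * f p" if y: "y = 0 \<or> y = pi" for y p
  proof -
    have "pt 0 (2 * y) \<in> period_lattice"
      using y by (auto simp: lattice_pt intro: period_two_pi exI[of _ "0::int"])
    then show ?thesis using sym2 per unfolding act_pair by (auto simp: e_def)
  qed
  have fix1: "act (pt (2 * x) 0, diag2 (- 1) 1) (pt x y) = pt x y"
    and fix2: "act (pt 0 (2 * y), diag2 1 (- 1)) (pt x y) = pt x y" for x y
    by (auto simp: act_pair plane_eq_iff)
  have "(if s then f (pt x y) = 0 else partial 1 f (pt x y) = 0)" if "x = 0 \<or> x = pi" for x y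
    using 1[OF that, of "pt x y"] partial_fixed_point(1)[OF f 1[OF that] fix1, of y]
    by (auto simp: e_def fix1)
  moreover have "(if t then f (pt x y) = 0 else partial 2 f (pt x y) = 0)" if "y = 0 \<or> y = pi" for x y
    using 2[OF that, of "pt x y"] partial_fixed_point(2)[OF f 2[OF that] fix2, of x]
    by (auto simp: e_def fix2)
  ultimately show ?thesis by (auto simp: bc2_def bc_def)
qed

lemma trig2_diag: "c = 1 \<or> c = - 1 \<Longrightarrow> d = 1 \<or> d = - 1 \<Longrightarrow>
    trig2 s t k (diag2 c d *v p) = (if s then c else 1) * (if t then d else 1) * trig2 s t k p"
  by (auto simp: trig2_def trig_minus)

lemma trig2_minus: "trig2 s t k (- p) = (if s = t then trig2 s t k p else - trig2 s t k p)"
  by (auto simp: trig2_def trig_minus)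

text \<open>Splitting \<open>f\<close> by the reflection in the x-axis gives two parts. Since
  \<open>f\<close> is even under -1, one part is even in each variable and the other odd in each, so
  they satisfy pure Neumann and pure Dirichlet conditions: products of two cosines and products of
  two sines.\<close>

lemma even_expansion:
  assumes f: "smooth f" and per: "\<And>t p. t \<in> period_lattice \<Longrightarrow> f (p + t) = f p"
    and even: "\<And>p. f (- p) = f p" and lap: "\<And>p. hodge_laplacian0 f p = ev * f p"
  obtains c d where "\<And>p. f p = (\<Sum>k\<in>modes ev. c k * trig2 False False k p + d k * trig2 True True k p)"
proof -
  define r where "r p = f (act (0, refl_matrix) p)" for p
  have r: "smooth r" "hodge_laplacian0 r p = ev * r p" for p
    using smooth_act(1)[OF f, of "(0, refl_matrix)"] hodge_laplacian0_act[OF f, of "(0, refl_matrix)"] pmm.orth lap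
    unfolding r_def by simp_all
  have r_eq: "r p = f (refl_matrix *v p)" for p by (simp add: r_def act_pair)
  have rper: "r (p + t) = r p" if "t \<in> period_lattice" for t p
    using per[OF pmm.lat[OF that], of "refl_matrix *v p"] unfolding r_eq by (simp only: matrix_vector_right_distrib)
  have reven: "r (- p) = r p" for p
    using even[of "refl_matrix *v p"] unfolding r_eq by (simp only: matrix_uminus_simps)
  have rr: "r (refl_matrix *v p) = f p" for p unfolding r_eq by simp
  have rm: "diag2 (- 1) 1 *v p = - (refl_matrix *v p)" "diag2 1 (- 1) *v p = refl_matrix *v p" for p
    by (auto simp: plane_eq_iff)
  have ex: "\<exists>c. \<forall>p. f p + e * r p = (\<Sum>k\<in>modes ev. c k * trig2 s s k p)"
    if e: "e = (if s then - 1 else 1)" for e s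
  proof -
    define h where "h p = f p + e * r p" for p
    have h: "smooth h" unfolding h_def by (intro smooth_add smooth_mult_const f r)
    have hl: "hodge_laplacian0 h p = ev * h p" for p
      unfolding h_def using hodge_laplacian0_add[OF f smooth_mult_const(1)[OF r(1)]]
      by (simp only: hodge_laplacian0_mult[OF r(1)] r(2) lap) (simp add: algebra_simps)
    have hp: "h (p + t) = h p" if "t \<in> period_lattice" for t p
      using per rper that by (simp add: h_def)
    have he: "h (- p) = h p" for p by (simp add: h_def even reven)
    have hr: "h (refl_matrix *v p) = e * h p" for p
      unfolding h_def rr r_eq[symmetric] using e by auto
    have "bc2 s s h"
      by (rule bc2_symmetric) (use h hp he hr e in \<open>auto simp: rm simp del: refl_matrix_mult diag2_mult\<close>)
    then obtain c where c: "\<And>p. p \<in> square pi \<Longrightarrow> h p = (\<Sum>k\<in>modes ev. c k * trig2 s s k p)"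
      using trig_expansion[OF h, of s s ev] hl by metis
    \<comment> \<open>The expansion is known on the square only; both sides have the same periods
      and parities, which carries it to the plane.\<close>
    have "h p - (\<Sum>k\<in>modes ev. c k * trig2 s s k p) = 0" for p
    proof (rule zero_from_square)
      show "h (p + t) - (\<Sum>k\<in>modes ev. c k * trig2 s s k (p + t)) =
          h p - (\<Sum>k\<in>modes ev. c k * trig2 s s k p)" if "t \<in> period_lattice" for t p
        using that by (simp add: hp trig2_period)
      show "\<bar>h (- p) - (\<Sum>k\<in>modes ev. c k * trig2 s s k (- p))\<bar> =
          \<bar>h p - (\<Sum>k\<in>modes ev. c k * trig2 s s k p)\<bar>" for p
        by (simp add: he trig2_minus)
      have "(\<Sum>k\<in>modes ev. c k * trig2 s s k (refl_matrix *v p)) = e * (\<Sum>k\<in>modes ev. c k * trig2 s s k p)" for p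
        unfolding sum_distrib_left rm(2)[symmetric]
        by (intro sum.cong refl, subst trig2_diag) (auto simp: e)
      then have "h (refl_matrix *v p) - (\<Sum>k\<in>modes ev. c k * trig2 s s k (refl_matrix *v p)) =
          e * (h p - (\<Sum>k\<in>modes ev. c k * trig2 s s k p))" for p
        unfolding hr by (simp only: right_diff_distrib)
      then show "\<bar>h (refl_matrix *v p) - (\<Sum>k\<in>modes ev. c k * trig2 s s k (refl_matrix *v p))\<bar> =
          \<bar>h p - (\<Sum>k\<in>modes ev. c k * trig2 s s k p)\<bar>" for p
        by (simp only: abs_mult) (simp add: e)
    qed (use c in simp)
    then show ?thesis unfolding h_def by (intro exI[of _ c]) simp
  qed
  obtain c where c: "\<And>p. f p + 1 * r p = (\<Sum>k\<in>modes ev. c k * trig2 False False k p)"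
    using ex[of 1 False] by auto
  obtain d where d: "\<And>p. f p + (- 1) * r p = (\<Sum>k\<in>modes ev. d k * trig2 True True k p)"
    using ex[of "- 1" True] by auto
  show ?thesis
  proof (rule that[of "\<lambda>k. c k / 2" "\<lambda>k. d k / 2"])
    fix p
    have "f p = (1 / 2) * (\<Sum>k\<in>modes ev. c k * trig2 False False k p)
        + (1 / 2) * (\<Sum>k\<in>modes ev. d k * trig2 True True k p)"
      unfolding c[symmetric] d[symmetric] by (simp add: field_simps)
    also have "\<dots> = (\<Sum>k\<in>modes ev. c k / 2 * trig2 False False k p + d k / 2 * trig2 True True k p)"
      by (simp add: sum_distrib_left sum.distrib)
    finally show "f p = (\<Sum>k\<in>modes ev. c k / 2 * trig2 False False k p + d k / 2 * trig2 True True k p)" .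
  qed
qed


section \<open>The spectrum of the square\<close>

lemma forms1_pmm:
  assumes "w \<in> forms1 pmm"
  shows "t \<in> period_lattice \<Longrightarrow> w (p + t) = w p"
    and "w (diag2 (- 1) 1 *v p) = diag2 (- 1) 1 *v w p"
    and "w (diag2 1 (- 1) *v p) = diag2 1 (- 1) *v w p"
proof -
  have w: "\<forall>t\<in>period_lattice. \<forall>x. w (x + t) = w x" "w (- x) = - w x" "w (refl_matrix *v x) = refl_matrix *v w x" for x
    using assms pmm.forms1_crys[of w] by (auto simp del: refl_matrix_mult)
  show "t \<in> period_lattice \<Longrightarrow> w (p + t) = w p" using w(1) by blast
  show "w (diag2 1 (- 1) *v p) = diag2 1 (- 1) *v w p"
    using w(3)[of p] by (simp only: diag2_cases)
  have "diag2 (- 1) 1 *v x = - (refl_matrix *v x)" for x by (simp add: plane_eq_iff)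
  then show "w (diag2 (- 1) 1 *v p) = diag2 (- 1) 1 *v w p"
    using w(2)[of "refl_matrix *v p"] w(3)[of p] by (simp only:)
qed

lemma forms1_pmm_bc2:
  assumes "w \<in> forms1 pmm"
  shows "bc2 True False (\<lambda>p. w p $ 1)" "bc2 False True (\<lambda>p. w p $ 2)"
proof -
  have sm: "smooth w" using assms by (simp add: forms1_def)
  show "bc2 True False (\<lambda>p. w p $ 1)" "bc2 False True (\<lambda>p. w p $ 2)"
    by (rule bc2_symmetric;
        use forms1_pmm[OF assms] smooth_nth(1)[OF sm] in \<open>simp del: diag2_mult, simp?\<close>)+
qed

text \<open>The interior product of a covector with a normal is its normal component up to sign, and
  that of \<open>d1 w\<close> is \<open>d1 w\<close> times a unit covector, so the second condition
  says \<open>d1 w = 0\<close> along each side.\<close>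

lemma absolute_bc_iff:
  "absolute_bc pi w \<longleftrightarrow> (\<forall>z\<in>{0, pi}. \<forall>x\<in>{0..pi}.
     w (pt z x) $ 1 = 0 \<and> d1 w (pt z x) = 0 \<and> w (pt x z) $ 2 = 0 \<and> d1 w (pt x z) = 0)"
    (is "?L \<longleftrightarrow> ?R")
proof
  have comp: "w p $ i = 0 \<and> d1 w p = 0" if L: ?L and "p \<in> square pi" "p $ i = 0 \<or> p $ i = pi" for p i
  proof -
    define \<nu> :: plane where "\<nu> = (if p $ i = 0 then - axis i 1 else axis i 1)"
    have "outward_normal pi p \<nu>" unfolding outward_normal_def \<nu>_def using that by auto
    then have "interior_product1 \<nu> (w p) = 0" "interior_product2 \<nu> (d1 w p) = 0"
      using L unfolding absolute_bc_def by auto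
    then show ?thesis
      using exhaust_2[of i] unfolding interior_product1_def interior_product2_def \<nu>_def
      by (auto simp: inner_axis axis_def plane_eq_iff inner_plane split: if_splits)
  qed
  assume L: ?L
  show ?R
    using comp[OF L, of "pt _ _" 1] comp[OF L, of "pt _ _" 2] by (auto simp: mem_square)
next
  assume R: ?R
  have "w p $ i = 0 \<and> d1 w p = 0" if "p \<in> square pi" "p $ i = 0 \<or> p $ i = pi" for p i
  proof -
    have "i = 1 \<or> i = 2" by (rule exhaust_2)
    then show ?thesis
    proof
      assume [simp]: "i = 1"
      show ?thesis using R that bspec[OF bspec[OF R, of "p $ 1"], of "p $ 2"]
        by (auto simp: mem_square)
    next
      assume [simp]: "i = 2"
      show ?thesis using R that bspec[OF bspec[OF R, of "p $ 2"], of "p $ 1"]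
        by (auto simp: mem_square)
    qed
  qed
  then show ?L
    unfolding absolute_bc_def outward_normal_def interior_product1_def interior_product2_def
    by (auto simp: inner_axis plane_eq_iff[of "vector _"])
qed

text \<open>A function that is zero along a side has zero tangential derivative there. The side
  function \<open>u\<close> is kept abstract so that one argument serves horizontal and vertical
  sides.\<close>

lemma deriv_zero_on_edge:
  assumes f: "smooth f" and z: "\<And>x. x \<in> {0..pi} \<Longrightarrow> u x = (0::real)" and x: "x \<in> {0..pi}"
  shows "u = (\<lambda>x. f (pt x y)) \<Longrightarrow> partial 1 f (pt x y) = 0"
    and "u = (\<lambda>x. f (pt y x)) \<Longrightarrow> partial 2 f (pt y x) = 0"
proof -
  have *: "d = 0" if "(u has_vector_derivative d) (at x within {0..pi})" for d
  proof -
    have "((\<lambda>x. 0) has_vector_derivative d) (at x within {0..pi})"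
      by (rule has_vector_derivative_transform[OF x _ that]) (use z in auto)
    moreover have "((\<lambda>x. 0) has_vector_derivative 0) (at x within {0..pi})" by simp
    ultimately show ?thesis
      using vector_derivative_unique_within_closed_interval[of 0 pi x "\<lambda>x. 0" d 0] x by auto
  qed
  show "u = (\<lambda>x. f (pt x y)) \<Longrightarrow> partial 1 f (pt x y) = 0"
    and "u = (\<lambda>x. f (pt y x)) \<Longrightarrow> partial 2 f (pt y x) = 0"
    by (rule *; simp add: has_vector_derivative_pt smooth_differentiable f)+
qed

text \<open>On a side the normal component vanishes, hence so does its tangential derivative; the
  condition \<open>d1 w = 0\<close> then reduces to a Neumann condition for the tangential
  component.\<close>

lemma absolute_bc_bc2:
  assumes w: "smooth w" and bc: "absolute_bc pi w"
  shows "bc2 True False (\<lambda>p. w p $ 1)" "bc2 False True (\<lambda>p. w p $ 2)"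
proof -
  note bc' = bc[unfolded absolute_bc_iff, rule_format]
  note s1 = smooth_nth(1)[OF w, of 1] and s2 = smooth_nth(1)[OF w, of 2]
  have "partial 2 (\<lambda>p. w p $ 1) (pt x z) = 0" if "z \<in> {0, pi}" "x \<in> {0..pi}" for x z
  proof -
    have "partial 1 (\<lambda>p. w p $ 2) (pt x z) = 0"
      by (rule deriv_zero_on_edge(1)[OF s2 _ that(2) refl]) (use bc' that(1) in blast)
    then show ?thesis using bc'[OF that] by (simp add: d1_def)
  qed
  then show "bc2 True False (\<lambda>p. w p $ 1)" using bc' by (auto simp: bc2_def bc_def)
  have "partial 1 (\<lambda>p. w p $ 2) (pt z x) = 0" if "z \<in> {0, pi}" "x \<in> {0..pi}" for x z
  proof -
    have "partial 2 (\<lambda>p. w p $ 1) (pt z x) = 0"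
      by (rule deriv_zero_on_edge(2)[OF s1 _ that(2) refl]) (use bc' that(1) in blast)
    then show ?thesis using bc'[OF that] by (simp add: d1_def)
  qed
  then show "bc2 False True (\<lambda>p. w p $ 2)" using bc' by (auto simp: bc2_def bc_def)
qed

lemma bc2_absolute_bc:
  assumes w: "smooth w" and bc: "bc2 True False (\<lambda>p. w p $ 1)" "bc2 False True (\<lambda>p. w p $ 2)"
  shows "absolute_bc pi w"
proof -
  note s1 = smooth_nth(1)[OF w, of 1] and s2 = smooth_nth(1)[OF w, of 2]
  have 1: "w (pt z x) $ 1 = 0" "w (pt x z) $ 2 = 0"
    "partial 1 (\<lambda>p. w p $ 2) (pt z x) = 0" "partial 2 (\<lambda>p. w p $ 1) (pt x z) = 0"
    if "z \<in> {0, pi}" "x \<in> {0..pi}" for x z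
    using bc that by (auto simp: bc2_def bc_def)
  have "partial 2 (\<lambda>p. w p $ 1) (pt z x) = 0" "partial 1 (\<lambda>p. w p $ 2) (pt x z) = 0"
    if "z \<in> {0, pi}" "x \<in> {0..pi}" for x z
  proof -
    show "partial 2 (\<lambda>p. w p $ 1) (pt z x) = 0"
      by (rule deriv_zero_on_edge(2)[OF s1 _ that(2) refl]) (use 1 that(1) in blast)
    show "partial 1 (\<lambda>p. w p $ 2) (pt x z) = 0"
      by (rule deriv_zero_on_edge(1)[OF s2 _ that(2) refl]) (use 1 that(1) in blast)
  qed
  then show ?thesis using 1 by (auto simp: absolute_bc_iff d1_def)
qed

text \<open>The isomorphism is restriction \<open>R\<close>. It is injective because each orbit of
  pmm meets the square, and surjective because the trigonometric expansions of the components on the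
  square define an invariant form on the plane.\<close>

lemma spectrum1_square: "spectrum1 pmm ev = square_abs_spectrum1 pi ev"
proof -
  define V where "V = eigenforms1 pmm ev"
  define W where "W = {(\<lambda>x. if x \<in> square pi then w x else 0) | w.
        smooth w \<and> absolute_bc pi w \<and> (\<forall>x\<in>square pi. hodge_laplacian1 w x = ev *\<^sub>R w x)}"
  define R :: "(plane \<Rightarrow> real^2) \<Rightarrow> plane \<Rightarrow> real^2" where
    "R w x = (if x \<in> square pi then w x else 0)" for w x
  have RV: "R w \<in> W" if "w \<in> V" for w
  proof -
    have "smooth w" "w \<in> forms1 pmm" using that by (auto simp: V_def eigenforms1_def forms1_def)
    then have "absolute_bc pi w" by (intro bc2_absolute_bc forms1_pmm_bc2)
    then show ?thesis
      using that \<open>smooth w\<close> unfolding W_def V_def eigenforms1_def R_def by blast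
  qed
  have WR: "W \<subseteq> R ` V"
  proof
    fix v assume "v \<in> W"
    then obtain w where v: "v = R w" and w: "smooth w" and abc: "absolute_bc pi w"
      and lap: "\<And>x. x \<in> square pi \<Longrightarrow> hodge_laplacian1 w x = ev *\<^sub>R w x"
      by (auto simp: W_def R_def[abs_def])
    have lap': "hodge_laplacian0 (\<lambda>p. w p $ i) x = ev * w x $ i" if "x \<in> square pi" for i x
      using lap[OF that] hodge_laplacian1_eq_iff[OF w] by blast
    obtain c where c: "\<And>p. p \<in> square pi \<Longrightarrow> w p $ 1 = (\<Sum>k\<in>modes ev. c k * trig2 True False k p)"
      using trig_expansion[OF smooth_nth(1)[OF w] absolute_bc_bc2(1)[OF w abc] lap'] by metis
    obtain d where d: "\<And>p. p \<in> square pi \<Longrightarrow> w p $ 2 = (\<Sum>k\<in>modes ev. d k * trig2 False True k p)"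
      using trig_expansion[OF smooth_nth(1)[OF w] absolute_bc_bc2(2)[OF w abc] lap'] by metis
    \<comment> \<open>These sums extend the two components of \<open>w\<close>. Outside the square
      they may differ from \<open>w\<close> itself, whose values there are arbitrary.\<close>
    define f where "f p = (\<Sum>k\<in>modes ev. c k * trig2 True False k p)" for p
    define g where "g p = (\<Sum>k\<in>modes ev. d k * trig2 False True k p)" for p
    have f: "smooth f" unfolding f_def
      by (rule smooth_sum[THEN conjunct1]) (intro smooth_mult_const smooth_trig2)
    have g: "smooth g" unfolding g_def
      by (rule smooth_sum[THEN conjunct1]) (intro smooth_mult_const smooth_trig2)
    have lf: "hodge_laplacian0 f p = ev * f p" for p
      unfolding f_def
      by (subst hodge_laplacian0_sum) (auto simp: smooth_mult_const smooth_trig2 hodge_laplacian0_mult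
          hodge_laplacian0_trig2 modes_def sum_distrib_left intro!: sum.cong)
    have lg: "hodge_laplacian0 g p = ev * g p" for p
      unfolding g_def
      by (subst hodge_laplacian0_sum) (auto simp: smooth_mult_const smooth_trig2 hodge_laplacian0_mult
          hodge_laplacian0_trig2 modes_def sum_distrib_left intro!: sum.cong)
    define u :: "plane \<Rightarrow> real^2" where "u p = f p *\<^sub>R axis 1 1 + g p *\<^sub>R axis 2 1" for p
    have u_pt: "u p = pt (f p) (g p)" for p by (simp add: u_def pt_axis)
    have u: "smooth u" unfolding u_def by (intro smooth_add smooth_scaleR_left f g)
    have "hodge_laplacian1 u x = ev *\<^sub>R u x" for x
    proof -
      have "\<forall>i. hodge_laplacian0 (\<lambda>y. u y $ i) x = ev * u x $ i"
        unfolding forall_2 by (simp add: u_pt lf lg)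
      then show ?thesis using hodge_laplacian1_eq_iff[OF u] by blast
    qed
    moreover have "u \<in> forms1 pmm"
      unfolding pmm.forms1_crys
    proof (intro conjI ballI allI u)
      fix t x assume "t \<in> period_lattice"
      then show "u (x + t) = u x" by (simp add: u_pt f_def g_def trig2_period)
    next
      fix x
      show "u (- x) = - u x"
        by (simp add: u_pt f_def g_def trig2_minus plane_eq_iff sum_negf)
      have "f (refl_matrix *v x) = f x" "g (refl_matrix *v x) = - g x"
        unfolding diag2_cases f_def g_def by (simp_all add: trig2_diag sum_negf del: diag2_mult)
      then show "u (refl_matrix *v x + 0) = refl_matrix *v u x"
        by (simp add: u_pt)
    qed
    ultimately have "u \<in> V" by (simp add: V_def eigenforms1_def)
    moreover have "R u = v"
      using c d by (auto simp: v R_def u_pt plane_eq_iff f_def g_def fun_eq_iff)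
    ultimately show "v \<in> R ` V" by blast
  qed
  have inj: "inj_on R V"
  proof (rule inj_onI, rule ext)
    fix w w' x assume w: "w \<in> V" "w' \<in> V" and eq: "R w = R w'"
    obtain g where g: "g \<in> pmm" "act g x \<in> square pi" by (rule fold_square)
    then have "w (act g x) = w' (act g x)" using fun_cong[OF eq, of "act g x"] by (simp add: R_def)
    moreover have "transpose (snd g) *v w (act g x) = w x" "transpose (snd g) *v w' (act g x) = w' x"
      using w g(1) unfolding V_def eigenforms1_def forms1_def by blast+
    ultimately show "w x = w' x" by simp
  qed
  have "fun_dim V = fun_dim W"
  proof (rule fun_dim_image[where T=R])
  qed (use RV WR inj in \<open>auto simp: R_def V_def eigenforms1_zero eigenforms1_add eigenforms1_scaleR\<close>)
  then show ?thesis
    by (simp add: spectrum1_def square_abs_spectrum1_def V_def eigenforms1_def W_def)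
qed


section \<open>Distinguishing the 0-spectra\<close>

definition even_eigenfunctions :: "real \<Rightarrow> (plane \<Rightarrow> real) set" where
  "even_eigenfunctions ev = {f. smooth f \<and> (\<forall>t\<in>period_lattice. \<forall>x. f (x + t) = f x) \<and>
     (\<forall>x. f (- x) = f x) \<and> (\<forall>x. hodge_laplacian0 f x = ev * f x)}"

lemma trig2_even_eigenfunction: "k \<in> modes ev \<Longrightarrow> trig2 s s k \<in> even_eigenfunctions ev"
  by (auto simp: even_eigenfunctions_def smooth_trig2 trig2_period trig2_minus hodge_laplacian0_trig2
      modes_def)

context crystal
begin

context
  fixes ev :: real and u v :: "plane \<Rightarrow> real"
  assumes uv: "u \<in> even_eigenfunctions ev" "v \<in> even_eigenfunctions ev"
    and expansion: "\<And>f. f \<in> even_eigenfunctions ev \<Longrightarrow> \<exists>c d. f = (\<lambda>p. c * u p + d * v p)"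
begin

text \<open>Functions invariant under the lattice and -1 are common to the five groups; with the
  eigenspace spanned by \<open>u\<close> and \<open>v\<close>, the group enters only through the
  action of one motion on this span. The lemmas below treat the four actions that occur: trivial,
  interchange, sign change of \<open>u\<close>, sign change of both.\<close>

lemma eigenforms0_crys:
  "{f \<in> forms0 (crys A b). \<forall>x. hodge_laplacian0 f x = ev * f x} = {\<lambda>p. c * u p + d * v p | c d.
     \<forall>p. c * u (A *v p + b) + d * v (A *v p + b) = c * u p + d * v p}" (is "?L = ?R")
proof
  show "?L \<subseteq> ?R"
  proof
    fix f assume f: "f \<in> ?L"
    then have "f \<in> even_eigenfunctions ev" by (auto simp: forms0_crys even_eigenfunctions_def)
    from expansion[OF this] obtain c d where cd: "f = (\<lambda>p. c * u p + d * v p)" by (elim exE)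
    have "\<forall>p. f (A *v p + b) = f p" using f by (simp add: forms0_crys)
    then have "\<forall>p. c * u (A *v p + b) + d * v (A *v p + b) = c * u p + d * v p"
      unfolding cd .
    then show "f \<in> ?R" unfolding mem_Collect_eq using cd by (intro exI conjI)
  qed
  show "?R \<subseteq> ?L"
  proof
    fix f assume "f \<in> ?R"
    then obtain c d where f: "f = (\<lambda>p. c * u p + d * v p)"
      and inv: "\<forall>p. c * u (A *v p + b) + d * v (A *v p + b) = c * u p + d * v p"
      unfolding mem_Collect_eq by (elim exE conjE)
    have s: "smooth u" "smooth v" using uv by (auto simp: even_eigenfunctions_def)
    have l: "hodge_laplacian0 u x = ev * u x" "hodge_laplacian0 v x = ev * v x" for x
      using uv by (auto simp: even_eigenfunctions_def)
    have "hodge_laplacian0 f x = ev * f x" for x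
      unfolding f hodge_laplacian0_add[OF smooth_mult_const(1)[OF s(1)] smooth_mult_const(1)[OF s(2)]]
        hodge_laplacian0_mult[OF s(1)] hodge_laplacian0_mult[OF s(2)] l by (simp add: algebra_simps)
    moreover have "smooth f" unfolding f by (intro smooth_add smooth_mult_const s)
    moreover have "\<forall>t\<in>period_lattice. \<forall>x. f (x + t) = f x" "\<forall>x. f (- x) = f x"
      using uv by (simp_all add: f even_eigenfunctions_def)
    moreover have "\<forall>p. f (A *v p + b) = f p" unfolding f by (rule inv)
    ultimately show "f \<in> ?L" by (simp add: forms0_crys)
  qed
qed

lemma spectrum0_both_invariant:
  assumes inv: "\<And>p. u (A *v p + b) = u p" "\<And>p. v (A *v p + b) = v p"
    and ind: "u p * v q \<noteq> u q * v p"
  shows "spectrum0 (crys A b) ev = 2"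
proof -
  have "spectrum0 (crys A b) ev = fun_dim {\<lambda>p. c * u p + d * v p | c d. True}"
    unfolding spectrum0_def eigenforms0_crys inv by (intro arg_cong[where f=fun_dim] Collect_cong) blast
  then show ?thesis using fun_dim_2[OF ind] by (simp only:)
qed

lemma spectrum0_swapped:
  assumes inv: "\<And>p. u (A *v p + b) = v p" "\<And>p. v (A *v p + b) = u p" and p: "u p \<noteq> v p"
    and q: "u q + v q \<noteq> 0"
  shows "spectrum0 (crys A b) ev = 1"
proof -
  have "(\<forall>p. c * v p + d * u p = c * u p + d * v p) \<longleftrightarrow> c = d" for c d
  proof
    assume "\<forall>p. c * v p + d * u p = c * u p + d * v p"
    from spec[OF this, of p] have "(c - d) * (u p - v p) = 0" by (simp add: algebra_simps)
    then show "c = d" using p by simp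
  qed simp
  then have "spectrum0 (crys A b) ev = fun_dim {\<lambda>p. c * u p + d * v p | c d. c = d}"
    unfolding spectrum0_def eigenforms0_crys inv by (simp only:)
  also have "{\<lambda>p. c * u p + d * v p | c d. c = d} = range (\<lambda>c p. c * (u p + v p))"
    by (simp add: full_SetCompr_eq distrib_left)
  finally show ?thesis using fun_dim_1[of "\<lambda>p. u p + v p", OF q] by (simp only:)
qed

lemma spectrum0_negated:
  assumes inv: "\<And>p. u (A *v p + b) = - u p" "\<And>p. v (A *v p + b) = v p"
    and p: "u p \<noteq> 0" and q: "v q \<noteq> 0"
  shows "spectrum0 (crys A b) ev = 1"
proof -
  have "(\<forall>p. c * - u p + d * v p = c * u p + d * v p) \<longleftrightarrow> c = 0" for c d
  proof
    assume "\<forall>p. c * - u p + d * v p = c * u p + d * v p"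
    from spec[OF this, of p] show "c = 0" using p by simp
  qed simp
  then have "spectrum0 (crys A b) ev = fun_dim {\<lambda>p. c * u p + d * v p | c d. c = 0}"
    unfolding spectrum0_def eigenforms0_crys inv by (simp only:)
  also have "{\<lambda>p. c * u p + d * v p | c d. c = 0} = range (\<lambda>c p. c * v p)"
    by (simp add: full_SetCompr_eq)
  finally show ?thesis using fun_dim_1[of v, OF q] by (simp only:)
qed

lemma spectrum0_both_negated:
  assumes inv: "\<And>p. u (A *v p + b) = - u p" "\<And>p. v (A *v p + b) = - v p"
  shows "spectrum0 (crys A b) ev = 0"
proof -
  have "{\<lambda>p. c * u p + d * v p | c d. \<forall>p. c * - u p + d * - v p = c * u p + d * v p} = {\<lambda>p. 0}"
  proof (intro subset_antisym subsetI)
    fix f assume "f \<in> {\<lambda>p. c * u p + d * v p | c d. \<forall>p. c * - u p + d * - v p = c * u p + d * v p}"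
    then obtain c d where f: "f = (\<lambda>p. c * u p + d * v p)"
      and z: "\<forall>p. c * - u p + d * - v p = c * u p + d * v p"
      unfolding mem_Collect_eq by (elim exE conjE)
    have "c * u p + d * v p = 0" for p using spec[OF z, of p] by simp
    then show "f \<in> {\<lambda>p. 0}" unfolding f by simp
  next
    fix f :: "plane \<Rightarrow> real" assume "f \<in> {\<lambda>p. 0}"
    then show "f \<in> {\<lambda>p. c * u p + d * v p | c d. \<forall>p. c * - u p + d * - v p = c * u p + d * v p}"
      unfolding mem_Collect_eq by (intro exI[of _ 0]) simp
  qed
  then show ?thesis
    unfolding spectrum0_def eigenforms0_crys inv by (simp only: fun_dim_0)
qed

end

end

section \<open>The eigenvalues 1, 2 and 4\<close>

lemma modes_iff: "(m, n) \<in> modes (real N) \<longleftrightarrow> m\<^sup>2 + n\<^sup>2 = N"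
proof -
  have "(m, n) \<in> modes (real N) \<longleftrightarrow> real (m\<^sup>2 + n\<^sup>2) = real N" by (simp add: modes_def)
  then show ?thesis by (simp only: of_nat_eq_iff)
qed

lemma sum_squares_le: "m\<^sup>2 + n\<^sup>2 = N \<Longrightarrow> m \<le> N \<and> n \<le> N" for m n N :: nat
proof -
  have "k \<le> k\<^sup>2" for k :: nat by (cases k) (auto simp: power2_eq_square)
  from this[of m] this[of n] show "m\<^sup>2 + n\<^sup>2 = N \<Longrightarrow> m \<le> N \<and> n \<le> N" by linarith
qed

lemma modes_1: "modes 1 = {(1, 0), (0, 1)}"
proof -
  have "m\<^sup>2 + n\<^sup>2 = 1 \<longleftrightarrow> m = 1 \<and> n = 0 \<or> m = 0 \<and> n = 1" for m n :: nat
  proof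
    assume h: "m\<^sup>2 + n\<^sup>2 = 1"
    then have "m = 0 \<or> m = 1" "n = 0 \<or> n = 1" using sum_squares_le[OF h] by linarith+
    then show "m = 1 \<and> n = 0 \<or> m = 0 \<and> n = 1" using h by (elim disjE) simp_all
  qed auto
  then have "(m, n) \<in> modes (real 1) \<longleftrightarrow> (m, n) \<in> {(1, 0), (0, 1)}" for m n
    unfolding modes_iff by simp
  then show ?thesis unfolding set_eq_iff split_paired_All by simp
qed

lemma modes_2: "modes 2 = {(1, 1)}"
proof -
  have "m\<^sup>2 + n\<^sup>2 = 2 \<longleftrightarrow> m = 1 \<and> n = 1" for m n :: nat
  proof
    assume h: "m\<^sup>2 + n\<^sup>2 = 2"
    then have "m = 0 \<or> m = 1 \<or> m = 2" "n = 0 \<or> n = 1 \<or> n = 2" using sum_squares_le[OF h] by linarith+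
    then show "m = 1 \<and> n = 1" using h by (elim disjE) simp_all
  qed auto
  then have "(m, n) \<in> modes (real 2) \<longleftrightarrow> (m, n) \<in> {(1, 1)}" for m n
    unfolding modes_iff by simp
  then show ?thesis unfolding set_eq_iff split_paired_All by simp
qed

lemma modes_4: "modes 4 = {(2, 0), (0, 2)}"
proof -
  have "m\<^sup>2 + n\<^sup>2 = 4 \<longleftrightarrow> m = 2 \<and> n = 0 \<or> m = 0 \<and> n = 2" for m n :: nat
  proof
    assume h: "m\<^sup>2 + n\<^sup>2 = 4"
    then have "m = 0 \<or> m = 1 \<or> m = 2 \<or> m = 3 \<or> m = 4" "n = 0 \<or> n = 1 \<or> n = 2 \<or> n = 3 \<or> n = 4"
      using sum_squares_le[OF h] by linarith+
    then show "m = 2 \<and> n = 0 \<or> m = 0 \<and> n = 2" using h by (elim disjE) simp_all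
  qed auto
  then have "(m, n) \<in> modes (real 4) \<longleftrightarrow> (m, n) \<in> {(2, 0), (0, 2)}" for m n
    unfolding modes_iff by simp
  then show ?thesis unfolding set_eq_iff split_paired_All by simp
qed

text \<open>Each mode has a frequency 0, so the products of sines vanish and only cos x and cos y
  remain.\<close>

lemma expansion_1:
  assumes "f \<in> even_eigenfunctions 1"
  shows "\<exists>c d. f = (\<lambda>p. c * trig2 False False (1, 0) p + d * trig2 False False (0, 1) p)"
proof -
  obtain c d where "\<And>p. f p = (\<Sum>k\<in>modes 1. c k * trig2 False False k p + d k * trig2 True True k p)"
    using even_expansion[of f 1] assms by (auto simp: even_eigenfunctions_def)
  then have "f = (\<lambda>p. c (1, 0) * trig2 False False (1, 0) p + c (0, 1) * trig2 False False (0, 1) p)"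
    by (auto simp: modes_1 trig2_def trig_def fun_eq_iff)
  then show ?thesis by blast
qed

text \<open>The single mode (1, 1) contributes two functions here, sin x sin y and cos x cos
  y.\<close>

lemma expansion_2:
  assumes "f \<in> even_eigenfunctions 2"
  shows "\<exists>c d. f = (\<lambda>p. c * trig2 True True (1, 1) p + d * trig2 False False (1, 1) p)"
proof -
  obtain c d where "\<And>p. f p = (\<Sum>k\<in>modes 2. c k * trig2 False False k p + d k * trig2 True True k p)"
    using even_expansion[of f 2] assms by (auto simp: even_eigenfunctions_def)
  then have "f = (\<lambda>p. d (1, 1) * trig2 True True (1, 1) p + c (1, 1) * trig2 False False (1, 1) p)"
    by (auto simp: modes_2 fun_eq_iff)
  then show ?thesis by blast
qed

lemma expansion_4:
  assumes "f \<in> even_eigenfunctions 4"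
  shows "\<exists>c d. f = (\<lambda>p. c * trig2 False False (2, 0) p + d * trig2 False False (0, 2) p)"
proof -
  obtain c d where "\<And>p. f p = (\<Sum>k\<in>modes 4. c k * trig2 False False k p + d k * trig2 True True k p)"
    using even_expansion[of f 4] assms by (auto simp: even_eigenfunctions_def)
  then have "f = (\<lambda>p. c (2, 0) * trig2 False False (2, 0) p + c (0, 2) * trig2 False False (0, 2) p)"
    by (auto simp: modes_4 trig2_def trig_def fun_eq_iff)
  then show ?thesis by blast
qed

lemma trig2_in:
  "trig2 False False (1, 0) \<in> even_eigenfunctions 1" "trig2 False False (0, 1) \<in> even_eigenfunctions 1"
  "trig2 False False (2, 0) \<in> even_eigenfunctions 4" "trig2 False False (0, 2) \<in> even_eigenfunctions 4"
  "trig2 True True (1, 1) \<in> even_eigenfunctions 2" "trig2 False False (1, 1) \<in> even_eigenfunctions 2"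
  by (rule trig2_even_eigenfunction; simp add: modes_def)+

text \<open>The action on cos x and cos y: a shift of a coordinate by pi changes the sign of its
  cosine, while the swap and the quarter-turn interchange the two.\<close>

lemma spectrum0_values_1:
  "spectrum0 pmm 1 = 2" "spectrum0 pmg 1 = 1" "spectrum0 pgg 1 = 0" "spectrum0 cmm 1 = 1"
  "spectrum0 p4 1 = 1"
proof -
  note [simp] = trig2_def trig_def
  show "spectrum0 pmm 1 = 2"
    by (rule pmm.spectrum0_both_invariant[OF trig2_in(1,2) expansion_1, where p = "pt 0 (pi / 2)"
          and q = "pt (pi / 2) 0"]) auto
  show "spectrum0 pmg 1 = 1"
    by (rule pmg.spectrum0_negated[OF trig2_in(1,2) expansion_1, where p = 0 and q = 0]) auto
  show "spectrum0 pgg 1 = 0"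
    by (rule pgg.spectrum0_both_negated[OF trig2_in(1,2) expansion_1]) auto
  show "spectrum0 cmm 1 = 1"
    by (rule cmm.spectrum0_swapped[OF trig2_in(1,2) expansion_1, where p = "pt 0 (pi / 2)"
          and q = 0]) auto
  show "spectrum0 p4 1 = 1"
    by (rule p4.spectrum0_swapped[OF trig2_in(1,2) expansion_1, where p = "pt 0 (pi / 2)"
          and q = 0]) auto
qed

text \<open>Now cos 2x and cos 2y have period pi, so the shift in pmg is invisible, whereas cmm and
  p4 still interchange the two.\<close>

lemma spectrum0_values_4:
  "spectrum0 pmg 4 = 2" "spectrum0 cmm 4 = 1" "spectrum0 p4 4 = 1"
proof -
  note [simp] = trig2_def trig_def
  have c: "cos (2 * (x + pi)) = cos (2 * x)" for x :: real by (simp add: distrib_left)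
  have c': "cos (2 * (- x + pi)) = cos (2 * x)" "cos (2 * (pi - x)) = cos (2 * x)" for x :: real
    by (simp_all add: distrib_left right_diff_distrib cos_diff)
  show "spectrum0 pmg 4 = 2"
    by (rule pmg.spectrum0_both_invariant[OF trig2_in(3,4) expansion_4, where p = "pt 0 (pi / 4)"
          and q = "pt (pi / 4) 0"]) (auto simp: c c')
  show "spectrum0 cmm 4 = 1"
    by (rule cmm.spectrum0_swapped[OF trig2_in(3,4) expansion_4, where p = "pt 0 (pi / 4)"
          and q = 0]) auto
  show "spectrum0 p4 4 = 1"
    by (rule p4.spectrum0_swapped[OF trig2_in(3,4) expansion_4, where p = "pt 0 (pi / 4)"
          and q = 0]) auto
qed

text \<open>The swap preserves sin x sin y, but the quarter-turn changes its sign; both preserve cos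
  x cos y.\<close>

lemma spectrum0_values_2: "spectrum0 cmm 2 = 2" "spectrum0 p4 2 = 1"
proof -
  note [simp] = trig2_def trig_def
  show "spectrum0 cmm 2 = 2"
    by (rule cmm.spectrum0_both_invariant[OF trig2_in(5,6) expansion_2, where p = "pt (pi / 2) (pi / 2)"
          and q = "0"]) auto
  show "spectrum0 p4 2 = 1"
    by (rule p4.spectrum0_negated[OF trig2_in(5,6) expansion_2, where p = "pt (pi / 2) (pi / 2)"
          and q = "0"]) auto
qed

lemma not_isospectral0_groups:
  "pairwise (\<lambda>G G'. \<not> isospectral0 G G') {pmm, pmg, pgg, cmm, p4}"
proof -
  have "spectrum0 pmg \<noteq> spectrum0 cmm" "spectrum0 pmg \<noteq> spectrum0 p4" "spectrum0 cmm \<noteq> spectrum0 p4"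
    using spectrum0_values_4 spectrum0_values_2 by auto
  moreover have "spectrum0 pmm \<noteq> spectrum0 G" if "G \<in> {pmg, pgg, cmm, p4}" for G
    using that spectrum0_values_1 by auto
  moreover have "spectrum0 pgg \<noteq> spectrum0 G" if "G \<in> {pmg, cmm, p4}" for G
    using that spectrum0_values_1 by auto
  ultimately show ?thesis
    unfolding pairwise_def isospectral0_def by (metis empty_iff insert_iff)
qed

section \<open>Underlying spaces\<close>

lemma vec3_eq_iff: "u = v \<longleftrightarrow> u $ 1 = v $ 1 \<and> u $ 2 = v $ 2 \<and> u $ 3 = v $ 3" for u v :: "'a^3"
  by (simp add: vec_eq_iff forall_3)

definition pt3 :: "real \<Rightarrow> real \<Rightarrow> real \<Rightarrow> real^3" where
  "pt3 x y z = vector [x, y, z]"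

lemma pt3_nth [simp]: "pt3 x y z $ 1 = x" "pt3 x y z $ 2 = y" "pt3 x y z $ 3 = z"
  by (simp_all add: pt3_def)

lemma mem_sphere3: "u \<in> sphere 0 1 \<longleftrightarrow> (u $ 1)\<^sup>2 + (u $ 2)\<^sup>2 + (u $ 3)\<^sup>2 = 1" for u :: "real^3"
  by (simp add: norm_eq_1 inner_vec_def sum_3 power2_eq_square)

lemma continuous_on_pt3 [continuous_intros]:
  assumes "continuous_on S f" "continuous_on S g" "continuous_on S h"
  shows "continuous_on S (\<lambda>x. pt3 (f x) (g x) (h x))"
proof -
  have "pt3 a b c = a *\<^sub>R axis 1 1 + b *\<^sub>R axis 2 1 + c *\<^sub>R axis 3 1" for a b c
    by (simp add: vec3_eq_iff axis_def)
  then show ?thesis using assms by (auto intro!: continuous_intros)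
qed

text \<open>Coordinates for the torus modulo -1. The two cosines determine each coordinate up to an
  independent sign; the product of the sines records the relative sign.\<close>

definition pillow :: "plane \<Rightarrow> real^3" where
  "pillow p = pt3 (cos (p $ 1)) (cos (p $ 2)) (sin (p $ 1) * sin (p $ 2))"

lemma pillow_surface: "(pillow p $ 3)\<^sup>2 = (1 - (pillow p $ 1)\<^sup>2) * (1 - (pillow p $ 2)\<^sup>2)"
  by (simp add: pillow_def power_mult_distrib sin_squared_eq)

lemma pillow_le_1: "(pillow p $ 1)\<^sup>2 \<le> 1" "(pillow p $ 2)\<^sup>2 \<le> 1"
  by (simp_all add: pillow_def abs_square_le_1)

lemma pillow_nonzero: "pillow p \<noteq> 0"
  using pillow_surface[of p] by (auto simp: vec3_eq_iff)

lemma cos_eq_cases: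
  assumes "cos x = cos (y::real)"
  obtains k :: int where "y = x + 2 * pi * of_int k" | k :: int where "y = - x + 2 * pi * of_int k"
  using assms[symmetric] unfolding cos_eq by (auto elim!: Ints_cases simp: algebra_simps)

text \<open>Equal cosines give coordinates that agree up to sign and periods, separately. If the two
  signs differ, the product of sines equals its own negative and vanishes; then some coordinate is
  congruent to its negative, and its sign can be changed to match the other.\<close>

lemma pillow_eq_iff:
  "pillow x = pillow y \<longleftrightarrow> (\<exists>t\<in>period_lattice. y = x + t \<or> y = - x + t)"
    (is "_ \<longleftrightarrow> ?R")
proof
  assume "\<exists>t\<in>period_lattice. y = x + t \<or> y = - x + t"
  then obtain t where t: "t \<in> period_lattice" "y = x + t \<or> y = - x + t" by blast
  then obtain k l :: int where kl: "t = pt (2 * pi * of_int k) (2 * pi * of_int l)"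
    by (auto simp: period_lattice_nth plane_eq_iff)
  have per: "sin (a + 2 * pi * of_int k) = sin a \<and> cos (a + 2 * pi * of_int k) = cos a" for a :: real and k :: int
    unfolding sin_cos_eq_iff by blast
  have per': "sin (2 * pi * of_int k - a) = - sin a \<and> cos (2 * pi * of_int k - a) = cos a" for a :: real and k :: int
    using per[of "- a" k] by simp
  show "pillow x = pillow y" using t(2) by (auto simp: pillow_def kl per per')
next
  assume eq: "pillow x = pillow y"
  have L: "pt (2 * pi * of_int k) (2 * pi * of_int l) \<in> period_lattice" for k l :: int
    by (auto simp: lattice_pt)
  have I: ?R if "\<exists>k l :: int. (y $ 1 = x $ 1 + 2 * pi * of_int k \<and> y $ 2 = x $ 2 + 2 * pi * of_int l) \<or>
      (y $ 1 = - x $ 1 + 2 * pi * of_int k \<and> y $ 2 = - x $ 2 + 2 * pi * of_int l)"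
    using that L by (auto simp: plane_eq_iff intro!: bexI[where x="pt _ _"])
  have c: "cos (x $ 1) = cos (y $ 1)" "cos (x $ 2) = cos (y $ 2)"
    and s: "sin (x $ 1) * sin (x $ 2) = sin (y $ 1) * sin (y $ 2)"
    using eq by (auto simp: pillow_def vec3_eq_iff)
  have per: "sin (a + 2 * pi * of_int k) = sin a" for a :: real and k :: int
    using sin_cos_eq_iff by blast
  have Z: "(\<exists>m::int. x $ 1 = - x $ 1 + 2 * pi * of_int m) \<or> (\<exists>m::int. x $ 2 = - x $ 2 + 2 * pi * of_int m)"
    if "sin (x $ 1) * sin (x $ 2) = 0"
  proof -
    have "\<exists>m::int. a = - a + 2 * pi * of_int m" if "sin a = 0" for a :: real
      using that unfolding sin_zero_iff_int2 by (auto simp: algebra_simps)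
    then show ?thesis using that by auto
  qed
  obtain k :: int where k: "y $ 1 = x $ 1 + 2 * pi * of_int k \<or> y $ 1 = - x $ 1 + 2 * pi * of_int k"
    using c(1) by (metis cos_eq_cases)
  obtain l :: int where l: "y $ 2 = x $ 2 + 2 * pi * of_int l \<or> y $ 2 = - x $ 2 + 2 * pi * of_int l"
    using c(2) by (metis cos_eq_cases)
  consider "y $ 1 = x $ 1 + 2 * pi * of_int k" "y $ 2 = x $ 2 + 2 * pi * of_int l"
    | "y $ 1 = - x $ 1 + 2 * pi * of_int k" "y $ 2 = - x $ 2 + 2 * pi * of_int l"
    | "y $ 1 = x $ 1 + 2 * pi * of_int k" "y $ 2 = - x $ 2 + 2 * pi * of_int l"
    | "y $ 1 = - x $ 1 + 2 * pi * of_int k" "y $ 2 = x $ 2 + 2 * pi * of_int l"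
    using k l by blast
  then show ?R
  proof cases
    case 3
    then have "sin (x $ 1) * sin (x $ 2) = 0" using s per per[of "- x $ 2"] by auto
    then consider m :: int where "x $ 1 = - x $ 1 + 2 * pi * of_int m"
      | m :: int where "x $ 2 = - x $ 2 + 2 * pi * of_int m" using Z by blast
    then show ?R
    proof cases
      case (1 m)
      then have "y $ 1 = - x $ 1 + 2 * pi * of_int (k + m)" using 3 by (simp add: algebra_simps)
      then show ?R using 3 by (intro I) blast
    next
      case (2 m)
      then have "y $ 2 = x $ 2 + 2 * pi * of_int (l - m)" using 3 by (simp add: algebra_simps)
      then show ?R using 3 by (intro I) blast
    qed
  next
    case 4
    then have "sin (x $ 1) * sin (x $ 2) = 0" using s per per[of "- x $ 1"] by auto
    then consider m :: int where "x $ 1 = - x $ 1 + 2 * pi * of_int m"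
      | m :: int where "x $ 2 = - x $ 2 + 2 * pi * of_int m" using Z by blast
    then show ?R
    proof cases
      case (1 m)
      then have "y $ 1 = x $ 1 + 2 * pi * of_int (k - m)" using 4 by (simp add: algebra_simps)
      then show ?R using 4 by (intro I) blast
    next
      case (2 m)
      then have "y $ 2 = - x $ 2 + 2 * pi * of_int (l + m)" using 4 by (simp add: algebra_simps)
      then show ?R using 4 by (intro I) blast
    qed
  qed (blast intro: I)+
qed

text \<open>The pillow surface \<open>z\<^sup>2 = (1 - x\<^sup>2) (1 - y\<^sup>2)\<close> is star-shaped about the origin, so radial
  projection identifies it with the sphere.\<close>

definition pillow_sphere :: "plane \<Rightarrow> real^3" where
  "pillow_sphere p = pillow p /\<^sub>R norm (pillow p)"

lemma pillow_sphere_in: "pillow_sphere p \<in> sphere 0 1"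
  using pillow_nonzero[of p] by (simp add: pillow_sphere_def)

lemma continuous_on_pillow_sphere: "continuous_on S pillow_sphere"
proof -
  have "continuous_on S pillow"
    unfolding pillow_def by (intro continuous_intros)
  then show ?thesis
    unfolding pillow_sphere_def by (intro continuous_intros) (auto simp: pillow_nonzero)
qed

text \<open>A ray meets the surface once. For points differing by the factor t, with T = t^2 and a,
  b the squares of the first two coordinates, the surface equation becomes (1 - T) (1 - T a b) = 0;
  the bounds on a, b, T a and T b force T = 1 also in the second case.\<close>

lemma pillow_sphere_eq_iff: "pillow_sphere x = pillow_sphere y \<longleftrightarrow> pillow x = pillow y"
proof
  assume eq: "pillow_sphere x = pillow_sphere y"
  define t where "t = norm (pillow y) / norm (pillow x)"
  have t: "t > 0" using pillow_nonzero by (simp add: t_def)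
  have yx: "pillow y = t *\<^sub>R pillow x"
  proof -
    have "pillow y = norm (pillow y) *\<^sub>R pillow_sphere y" using pillow_nonzero by (simp add: pillow_sphere_def)
    also have "\<dots> = norm (pillow y) *\<^sub>R pillow_sphere x" using eq by simp
    also have "\<dots> = t *\<^sub>R pillow x" by (simp add: pillow_sphere_def t_def divide_inverse)
    finally show ?thesis .
  qed
  define T a b where "T = t\<^sup>2" and "a = (pillow x $ 1)\<^sup>2" and "b = (pillow x $ 2)\<^sup>2"
  have ab: "0 \<le> a" "a \<le> 1" "0 \<le> b" "b \<le> 1" "T * a \<le> 1" "T * b \<le> 1" "T > 0"
    using pillow_le_1[of x] pillow_le_1[of y] t by (auto simp: a_def b_def T_def yx power_mult_distrib)
  have "T * ((1 - a) * (1 - b)) = (1 - T * a) * (1 - T * b)"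
    using pillow_surface[of x] pillow_surface[of y] by (simp add: a_def b_def T_def yx power_mult_distrib)
  then have "(1 - T) * (1 - T * a * b) = 0" by (simp add: algebra_simps)
  then have "T = 1 \<or> T * a * b = 1" by auto
  moreover have "T = 1" if "T * a * b = 1"
  proof -
    have "T * a * b \<le> 1 * b" using ab by (intro mult_right_mono) auto
    then have "b = 1" using that ab by simp
    then have "T * a = 1" using that by simp
    moreover have "T * a * b \<le> T * b * 1" using ab mult_left_mono[of a 1 "T * b"] by (simp add: mult.commute mult.left_commute)
    ultimately show ?thesis using ab \<open>b = 1\<close> by simp
  qed
  ultimately have "t = 1" using t by (auto simp: T_def power2_eq_1_iff)
  then show "pillow x = pillow y" using yx by simp
qed (simp add: pillow_sphere_def)

definition period_box :: "plane set" where
  "period_box = cbox (pt (- pi) (- pi)) (pt pi pi)"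

lemma pillow_sphere_surj: "pillow_sphere ` period_box = sphere 0 1"
proof
  show "sphere 0 1 \<subseteq> pillow_sphere ` period_box"
  proof
    fix u :: "real^3" assume "u \<in> sphere 0 1"
    then have u1: "(u $ 1)\<^sup>2 + (u $ 2)\<^sup>2 + (u $ 3)\<^sup>2 = 1" and nu: "norm u = 1"
      unfolding mem_sphere3[symmetric] by simp_all
    define a b c where "a = (u $ 1)\<^sup>2" and "b = (u $ 2)\<^sup>2" and "c = (u $ 3)\<^sup>2"
    have abc: "a \<ge> 0" "b \<ge> 0" "c \<ge> 0" "a + b + c = 1" using u1 by (auto simp: a_def b_def c_def)
    \<comment> \<open>A zero of \<open>g\<close> at T means that the point sqrt T times
      \<open>u\<close> satisfies the surface equation; \<open>g 0 = 1\<close>, and the intermediate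
      value theorem supplies a zero up to \<open>m\<close>.\<close>
    define g where "g T = (1 - T * a) * (1 - T * b) - T * c" for T
    \<comment> \<open>The value of T at which the ray leaves the region where the first two
      coordinates are at most 1 in size. On the third axis it never leaves; there c = 1 and g(1) =
      0.\<close>
    define m where "m = (if max a b = 0 then 1 else 1 / max a b)"
    have m: "m > 0" "m * a \<le> 1" "m * b \<le> 1" "g m \<le> 0"
    proof -
      have M: "max a b \<ge> 0" "a \<le> max a b" "b \<le> max a b" using abc by auto
      show m0: "m > 0" using M by (auto simp: m_def)
      have mM: "m * max a b \<le> 1" by (simp add: m_def)
      show "m * a \<le> 1" "m * b \<le> 1"
        using mult_left_mono[OF M(2), of m] mult_left_mono[OF M(3), of m] m0 mM by linarith+
      show "g m \<le> 0"
      proof (cases "max a b = 0")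
        case True
        then have "a = 0" "b = 0" "m = 1" using abc by (auto simp: m_def max_def split: if_splits)
        then show ?thesis using abc by (simp add: g_def)
      next
        case False
        then have "m * max a b = 1" by (simp add: m_def)
        then have "m * a = 1 \<or> m * b = 1" by (auto simp: max_def split: if_splits)
        then show ?thesis using m0 abc by (auto simp: g_def)
      qed
    qed
    have "\<exists>T\<ge>0. T \<le> m \<and> g T = 0"
      by (rule IVT2') (use m in \<open>auto simp: g_def intro!: continuous_intros\<close>)
    then obtain T where T: "0 \<le> T" "T \<le> m" "g T = 0" by blast
    have "T \<noteq> 0" using T(3) by (auto simp: g_def)
    then have T0: "T > 0" using T(1) by simp
    have Ta: "T * a \<le> 1" "T * b \<le> 1"
      using mult_right_mono[OF T(2) abc(1)] mult_right_mono[OF T(2) abc(2)] m by auto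
    define t where "t = sqrt T"
    have t: "t > 0" "t\<^sup>2 = T" using T0 by (auto simp: t_def)
    have sq: "(t * u $ 1)\<^sup>2 = T * a" "(t * u $ 2)\<^sup>2 = T * b" "(t * u $ 3)\<^sup>2 = T * c"
      by (auto simp: power_mult_distrib t a_def b_def c_def)
    have le: "\<bar>t * u $ 1\<bar> \<le> 1" "\<bar>t * u $ 2\<bar> \<le> 1"
      using Ta by (auto simp flip: sq simp: abs_square_le_1)
    \<comment> \<open>Arccosines have nonnegative sine, so the sign of the third coordinate is put
      into the second angle, whose cosine ignores it.\<close>
    define s where "s = (if u $ 3 \<ge> 0 then 1 else - 1 :: real)"
    define x where "x = pt (arccos (t * u $ 1)) (s * arccos (t * u $ 2))"
    have sin: "sin (arccos (t * u $ 1)) = sqrt (1 - T * a)" "sin (arccos (t * u $ 2)) = sqrt (1 - T * b)"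
      using le by (auto simp: sin_arccos_abs sq)
    have "sqrt (1 - T * a) * sqrt (1 - T * b) = sqrt (T * c)"
      using T(3) by (simp add: g_def real_sqrt_mult[symmetric])
    also have "\<dots> = \<bar>t * u $ 3\<bar>" by (simp flip: sq)
    finally have "pillow x = t *\<^sub>R u"
      using le t(1) by (auto simp: pillow_def x_def vec3_eq_iff s_def sin cos_arccos_abs abs_mult)
    then have "pillow_sphere x = u" using t(1) nu by (simp add: pillow_sphere_def)
    moreover have "x \<in> period_box"
      using arccos_bounded[of "t * u $ 1"] arccos_bounded[of "t * u $ 2"] le
      by (auto simp: period_box_def mem_box_cart forall_2 x_def s_def abs_le_iff)
    ultimately show "u \<in> pillow_sphere ` period_box" by blast
  qed
qed (use pillow_sphere_in in blast)

lemma quotient_map_compact: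
  assumes "continuous_map X Y f" "compact_space X" "Hausdorff_space Y" "f ` topspace X = topspace Y"
  shows "quotient_map X Y f"
  using assms by (intro continuous_closed_imp_quotient_map continuous_imp_closed_map)

text \<open>The plane is not compact, but a period box already maps onto the sphere, and a
  continuous surjection from a compact to a Hausdorff space is a quotient map; the property then
  passes to the map on the whole plane.\<close>

lemma quotient_map_pillow_sphere: "quotient_map euclidean sphere_space pillow_sphere"
proof (rule quotient_map_from_composition)
  show "continuous_map (top_of_set period_box) euclidean id" by simp
  show "continuous_map euclidean sphere_space pillow_sphere"
    unfolding sphere_space_def continuous_map_in_subtopology
    using pillow_sphere_in continuous_on_pillow_sphere by auto
  show "quotient_map (top_of_set period_box) sphere_space (pillow_sphere \<circ> id)"
  proof (rule quotient_map_compact)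
    show "continuous_map (top_of_set period_box) sphere_space (pillow_sphere \<circ> id)"
      unfolding sphere_space_def continuous_map_in_subtopology
      using pillow_sphere_in continuous_on_pillow_sphere by auto
    show "compact_space (top_of_set period_box)"
      by (simp add: compact_space_subtopology period_box_def)
    show "Hausdorff_space sphere_space" by (simp add: sphere_space_def Hausdorff_space_subtopology)
  qed (use pillow_sphere_surj in \<open>simp add: sphere_space_def\<close>)
qed

lemma homeomorphic_quotients:
  assumes f: "quotient_map X Y f" and g: "quotient_map X Z g"
    and fibres: "\<And>x y. x \<in> topspace X \<Longrightarrow> y \<in> topspace X \<Longrightarrow> f x = f y \<longleftrightarrow> g x = g y"
  shows "Y homeomorphic_space Z"
proof -
  obtain h where h: "continuous_map Y Z h" "h ` topspace Y = g ` topspace X"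
    "\<And>x. x \<in> topspace X \<Longrightarrow> h (f x) = g x"
    by (rule quotient_map_lift_exists[OF f quotient_imp_continuous_map[OF g] fibres[THEN iffD1]]) (assumption | rule that)+
  obtain k where k: "continuous_map Z Y k" "k ` topspace Z = f ` topspace X"
    "\<And>x. x \<in> topspace X \<Longrightarrow> k (g x) = f x"
    by (rule quotient_map_lift_exists[OF g quotient_imp_continuous_map[OF f] fibres[THEN iffD2]]) (assumption | rule that)+
  have "homeomorphic_maps Y Z h k"
    unfolding homeomorphic_maps_def
    using h(1,3) k(1,3)
    by (auto simp flip: quotient_imp_surjective_map[OF f] quotient_imp_surjective_map[OF g])
  then show ?thesis by (auto simp: homeomorphic_space_def)
qed

section \<open>Orbit spaces as quotients of the sphere by one involution\<close>

context crystal
begin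

lemma orbit_eq_iff:
  "motion_orbit (crys A b) x = motion_orbit (crys A b) y \<longleftrightarrow> y \<in> motion_orbit (crys A b) x"
proof -
  interpret group motion_group by (rule group_motion_group)
  interpret S: subgroup "crys A b" motion_group by (rule subgroup_crys)
  have one: "act \<one>\<^bsub>motion_group\<^esub> x = x" for x by (simp add: motion_group_def act_def)
  have sub: "motion_orbit (crys A b) y \<subseteq> motion_orbit (crys A b) x"
    if "y \<in> motion_orbit (crys A b) x" for x y
    using that by (auto simp: motion_orbit_def act_mult[symmetric])
  have self: "x \<in> motion_orbit (crys A b) x" for x
    unfolding motion_orbit_def using one S.one_closed by (metis imageI)
  have sym: "x \<in> motion_orbit (crys A b) y" if y: "y \<in> motion_orbit (crys A b) x" for x y
  proof -
    obtain g where g: "g \<in> crys A b" "y = act g x" using y by (auto simp: motion_orbit_def)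
    then have "act (inv\<^bsub>motion_group\<^esub> g) y = x"
      using S.mem_carrier[OF g(1)] by (simp add: act_mult[symmetric] one)
    then show ?thesis using S.m_inv_closed[OF g(1)] by (auto simp: motion_orbit_def)
  qed
  show ?thesis using sub self sym by blast
qed

text \<open>An orbit is the union of the classes, modulo the lattice and -1, of x and of its image
  under (\<open>b\<close>, \<open>A\<close>); the sphere point is a complete invariant of such a
  class.\<close>

lemma mem_orbit_iff: "y \<in> motion_orbit (crys A b) x \<longleftrightarrow>
   pillow_sphere y = pillow_sphere x \<or> pillow_sphere y = pillow_sphere (A *v x + b)"
proof -
  have "y \<in> motion_orbit (crys A b) x \<longleftrightarrow> (\<exists>t\<in>period_lattice. y = x + t \<or> y = - x + t) \<or>
      (\<exists>t\<in>period_lattice. y = (A *v x + b) + t \<or> y = - (A *v x + b) + t)" (is "?L \<longleftrightarrow> ?R")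
  proof
    assume ?L
    then obtain t B where tB: "(t, B) \<in> crys A b" "y = B *v x + t"
      by (auto simp: motion_orbit_def act_pair)
    from tB(1) show ?R
    proof (cases rule: crysE)
      case 3
      then have "y = (A *v x + b) + (t - b)" using tB(2) by simp
      then show ?thesis using 3 by blast
    next
      case 4
      then have "y = - (A *v x + b) + ((t - b) + (b + b))" using tB(2) by simp
      then show ?thesis using 4 b2 lattice_add by blast
    qed (use tB(2) in auto)
  next
    assume ?R
    then obtain t where t: "t \<in> period_lattice" "y = x + t \<or> y = - x + t \<or>
        y = (A *v x + b) + t \<or> y = - (A *v x + b) + t" by blast
    have o: "B *v x + s \<in> motion_orbit (crys A b) x" if "(s, B) \<in> crys A b" for s B
      using that by (force simp: motion_orbit_def act_pair)
    have "(b + t) - b \<in> period_lattice" "(t - b) - b \<in> period_lattice"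
      using t(1) lattice_diff[OF t(1) b2] by (simp_all add: diff_diff_eq)
    then have "x + t \<in> motion_orbit (crys A b) x" "- x + t \<in> motion_orbit (crys A b) x"
      "A *v x + (b + t) \<in> motion_orbit (crys A b) x" "- (A *v x) + (t - b) \<in> motion_orbit (crys A b) x"
      using o[OF crysI1(1)[OF t(1)]] o[OF crysI1(2)[OF t(1)]] o[OF crysI2(1), of "b + t"]
        o[OF crysI2(2), of "t - b"] by simp_all
    moreover have "(A *v x + b) + t = A *v x + (b + t)" "- (A *v x + b) + t = - (A *v x) + (t - b)"
      by (simp_all add: add.assoc)
    ultimately show ?L using t(2) by metis
  qed
  moreover have "pillow_sphere y = pillow_sphere z \<longleftrightarrow> (\<exists>t\<in>period_lattice. y = z + t \<or> y = - z + t)" for z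
    using pillow_eq_iff[of z y] unfolding pillow_sphere_eq_iff by (simp only: eq_commute)
  ultimately show ?thesis by (simp only:)
qed

lemma compact_underlying_space: "compact_space (underlying_space (crys A b))"
proof -
  have "motion_orbit (crys A b) ` period_box = range (motion_orbit (crys A b))"
  proof -
    have "motion_orbit (crys A b) x \<in> motion_orbit (crys A b) ` period_box" for x
    proof -
      have "pillow_sphere x \<in> pillow_sphere ` period_box"
        unfolding pillow_sphere_surj by (rule pillow_sphere_in)
      then obtain k where k: "k \<in> period_box" "pillow_sphere x = pillow_sphere k" by blast
      then have "motion_orbit (crys A b) x = motion_orbit (crys A b) k"
        unfolding orbit_eq_iff mem_orbit_iff by simp
      then show ?thesis using k(1) by blast
    qed
    then show ?thesis by blast
  qed
  moreover have "compactin (underlying_space (crys A b)) (motion_orbit (crys A b) ` period_box)"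
    unfolding underlying_space_def
    by (rule image_compactin[OF _ quotient_imp_continuous_map[OF quotient_map_quotient_topology]])
      (simp add: period_box_def)
  ultimately show ?thesis
    by (simp add: compact_space_def underlying_space_def topspace_quotient_topology)
qed

lemma closed_flat_2_orbifold_crys: "closed_flat_2_orbifold (crys A b)"
  by (simp add: closed_flat_2_orbifold_def subgroup_crys discrete_crys compact_underlying_space)

text \<open>The motion (\<open>b\<close>, \<open>A\<close>) descends to the map \<open>M\<close> of
  the sphere. After composition with the map from the plane, \<open>h\<close> has exactly the orbits
  as fibres, and quotient maps with equal fibres have homeomorphic targets.\<close>

lemma underlying_space_homeomorphic:
  assumes M: "\<And>x. pillow_sphere (A *v x + b) = M (pillow_sphere x)"
    and h: "quotient_map sphere_space Y h"
    and fibres: "\<And>u v. u \<in> sphere 0 1 \<Longrightarrow> v \<in> sphere 0 1 \<Longrightarrow> h u = h v \<longleftrightarrow> v = u \<or> v = M u"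
  shows "underlying_space (crys A b) homeomorphic_space Y"
  unfolding underlying_space_def
proof (rule homeomorphic_quotients[OF quotient_map_quotient_topology])
  show "quotient_map euclidean Y (h \<circ> pillow_sphere)"
    by (rule quotient_map_compose[OF quotient_map_pillow_sphere h])
  show "motion_orbit (crys A b) x = motion_orbit (crys A b) y \<longleftrightarrow>
      (h \<circ> pillow_sphere) x = (h \<circ> pillow_sphere) y" for x y
    unfolding orbit_eq_iff mem_orbit_iff M using fibres[OF pillow_sphere_in pillow_sphere_in] by simp
qed

end

lemma quotient_map_sphere:
  fixes h :: "real^3 \<Rightarrow> 'a::real_normed_vector"
  assumes "continuous_on (sphere 0 1) h" "h ` sphere 0 1 = T"
  shows "quotient_map sphere_space (top_of_set T) h"
proof (rule quotient_map_compact)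
  show "continuous_map sphere_space (top_of_set T) h"
    using assms by (auto simp: sphere_space_def)
qed (use assms in \<open>auto simp: sphere_space_def compact_space_subtopology Hausdorff_space_subtopology\<close>)

text \<open>Norm-preserving linear maps commute with radial projection, so the action can be read
  off the trigonometric coordinates.\<close>

lemma pillow_sphere_linear:
  assumes "pillow (A *v x + b) = f (pillow x)" "linear f" "norm (f (pillow x)) = norm (pillow x)"
  shows "pillow_sphere (A *v x + b) = f (pillow_sphere x)"
  using assms by (simp add: pillow_sphere_def linear_scale)

lemma linear_pt3:
  "linear f \<Longrightarrow> linear g \<Longrightarrow> linear h \<Longrightarrow> linear (\<lambda>u. pt3 (f u) (g u) (h u))"
  by (auto simp: linear_iff vec3_eq_iff)

lemma linear_nth3: "linear (\<lambda>u::real^3. u $ i)" "linear (\<lambda>u::real^3. - u $ i)"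
  by (auto simp: linear_iff)

lemma norm_eq3: "(u $ 1)\<^sup>2 + (u $ 2)\<^sup>2 + (u $ 3)\<^sup>2 = (v $ 1)\<^sup>2 + (v $ 2)\<^sup>2 + (v $ 3)\<^sup>2 \<Longrightarrow> norm u = norm v"
  for u v :: "real^3"
  by (simp add: norm_eq_sqrt_inner inner_vec_def sum_3 power2_eq_square)

text \<open>Orthogonal projection along the axis that the reflection reverses: the third axis for
  pmm, the first for pmg.\<close>

lemma quotient_map_disk:
  "quotient_map sphere_space disk_space (\<lambda>u. pt (u $ 1) (u $ 2))"
  "quotient_map sphere_space disk_space (\<lambda>u. pt (u $ 2) (u $ 3))"
proof -
  have *: "quotient_map sphere_space disk_space (\<lambda>u. pt (u $ i) (u $ j))"
    if le: "\<And>u :: real^3. u \<in> sphere 0 1 \<Longrightarrow> (u $ i)\<^sup>2 + (u $ j)\<^sup>2 \<le> 1"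
      and surj: "\<And>q :: plane. (q $ 1)\<^sup>2 + (q $ 2)\<^sup>2 \<le> 1 \<Longrightarrow> \<exists>u :: real^3. u \<in> sphere 0 1 \<and> u $ i = q $ 1 \<and> u $ j = q $ 2"
    for i j :: 3
    unfolding disk_space_def
  proof (rule quotient_map_sphere)
    have disk: "q \<in> cball 0 1 \<longleftrightarrow> (q $ 1)\<^sup>2 + (q $ 2)\<^sup>2 \<le> 1" for q :: plane
      by (simp add: norm_le_square inner_plane power2_eq_square)
    show "(\<lambda>u::real^3. pt (u $ i) (u $ j)) ` sphere 0 1 = cball 0 1"
    proof (intro subset_antisym subsetI)
      fix q :: plane assume "q \<in> cball 0 1"
      then obtain u where "u \<in> sphere 0 1" "u $ i = q $ 1" "u $ j = q $ 2" unfolding disk using surj by blast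
      then show "q \<in> (\<lambda>u::real^3. pt (u $ i) (u $ j)) ` sphere 0 1"
        by (intro rev_image_eqI[where x=u]) simp_all
    next
      fix q assume "q \<in> (\<lambda>u::real^3. pt (u $ i) (u $ j)) ` sphere 0 1"
      then obtain u :: "real^3" where u: "u \<in> sphere 0 1" "q = pt (u $ i) (u $ j)" by blast
      then show "q \<in> cball 0 1" unfolding disk using le[OF u(1)] by simp
    qed
  qed (intro continuous_intros)
  show "quotient_map sphere_space disk_space (\<lambda>u. pt (u $ 1) (u $ 2))"
  proof (rule *)
    fix u :: "real^3" assume "u \<in> sphere 0 1"
    then show "(u $ 1)\<^sup>2 + (u $ 2)\<^sup>2 \<le> 1" using zero_le_power2[of "u $ 3"] unfolding mem_sphere3 by linarith
  next
    fix q :: plane assume "(q $ 1)\<^sup>2 + (q $ 2)\<^sup>2 \<le> 1"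
    then have "pt3 (q $ 1) (q $ 2) (sqrt (1 - (q $ 1)\<^sup>2 - (q $ 2)\<^sup>2)) \<in> sphere 0 1"
      unfolding mem_sphere3 by simp
    then show "\<exists>u :: real^3. u \<in> sphere 0 1 \<and> u $ 1 = q $ 1 \<and> u $ 2 = q $ 2"
      by (intro exI conjI, assumption) simp_all
  qed
  show "quotient_map sphere_space disk_space (\<lambda>u. pt (u $ 2) (u $ 3))"
  proof (rule *)
    fix u :: "real^3" assume "u \<in> sphere 0 1"
    then show "(u $ 2)\<^sup>2 + (u $ 3)\<^sup>2 \<le> 1" using zero_le_power2[of "u $ 1"] unfolding mem_sphere3 by linarith
  next
    fix q :: plane assume "(q $ 1)\<^sup>2 + (q $ 2)\<^sup>2 \<le> 1"
    then have "pt3 (sqrt (1 - (q $ 1)\<^sup>2 - (q $ 2)\<^sup>2)) (q $ 1) (q $ 2) \<in> sphere 0 1"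
      unfolding mem_sphere3 by simp
    then show "\<exists>u :: real^3. u \<in> sphere 0 1 \<and> u $ 2 = q $ 1 \<and> u $ 3 = q $ 2"
      by (intro exI conjI, assumption) simp_all
  qed
qed

lemma underlying_pmm: "underlying_space pmm homeomorphic_space disk_space"
proof (rule pmm.underlying_space_homeomorphic[where M="\<lambda>u. pt3 (u $ 1) (u $ 2) (- u $ 3)"
      and h="\<lambda>u. pt (u $ 1) (u $ 2)"])
  show "pillow_sphere (refl_matrix *v x + 0) = pt3 (pillow_sphere x $ 1) (pillow_sphere x $ 2) (- pillow_sphere x $ 3)" for x
    by (rule pillow_sphere_linear) (auto intro!: linear_pt3 linear_nth3 norm_eq3 simp: pillow_def)
  show "quotient_map sphere_space disk_space (\<lambda>u. pt (u $ 1) (u $ 2))"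
    by (rule quotient_map_disk(1))
  fix u v :: "real^3" assume "u \<in> sphere 0 1" "v \<in> sphere 0 1"
  then have "u $ 1 = v $ 1 \<Longrightarrow> u $ 2 = v $ 2 \<Longrightarrow> (u $ 3)\<^sup>2 = (v $ 3)\<^sup>2" unfolding mem_sphere3 by simp
  then show "(pt (u $ 1) (u $ 2) = pt (v $ 1) (v $ 2)) = (v = u \<or> v = pt3 (u $ 1) (u $ 2) (- u $ 3))"
    by (auto simp: plane_eq_iff vec3_eq_iff power2_eq_iff)
qed

text \<open>The shift x + pi and the reflection of y each change the sign of sin x sin y, so only
  the first coordinate is negated.\<close>

lemma underlying_pmg: "underlying_space pmg homeomorphic_space disk_space"
proof (rule pmg.underlying_space_homeomorphic[where M="\<lambda>u. pt3 (- u $ 1) (u $ 2) (u $ 3)"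
      and h="\<lambda>u. pt (u $ 2) (u $ 3)"])
  show "pillow_sphere (refl_matrix *v x + pt pi 0) = pt3 (- pillow_sphere x $ 1) (pillow_sphere x $ 2) (pillow_sphere x $ 3)" for x
    by (rule pillow_sphere_linear) (auto intro!: linear_pt3 linear_nth3 norm_eq3 simp: pillow_def)
  show "quotient_map sphere_space disk_space (\<lambda>u. pt (u $ 2) (u $ 3))"
    by (rule quotient_map_disk(2))
  fix u v :: "real^3" assume "u \<in> sphere 0 1" "v \<in> sphere 0 1"
  then have "u $ 2 = v $ 2 \<Longrightarrow> u $ 3 = v $ 3 \<Longrightarrow> (u $ 1)\<^sup>2 = (v $ 1)\<^sup>2" unfolding mem_sphere3 by simp
  then show "(pt (u $ 2) (u $ 3) = pt (v $ 2) (v $ 3)) = (v = u \<or> v = pt3 (- u $ 1) (u $ 2) (u $ 3))"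
    by (auto simp: plane_eq_iff vec3_eq_iff power2_eq_iff)
qed

text \<open>Replacing y by pi - y negates its cosine and keeps its sine, and x + pi negates both;
  all three coordinates change sign, which is the antipodal map.\<close>

lemma underlying_pgg: "underlying_space pgg homeomorphic_space projective_plane"
proof (rule pgg.underlying_space_homeomorphic[where M="\<lambda>u. pt3 (- u $ 1) (- u $ 2) (- u $ 3)"
      and h="\<lambda>u. {u, - u}"])
  show "pillow_sphere (refl_matrix *v x + pt pi pi) = pt3 (- pillow_sphere x $ 1) (- pillow_sphere x $ 2) (- pillow_sphere x $ 3)" for x
    by (rule pillow_sphere_linear) (auto intro!: linear_pt3 linear_nth3 norm_eq3 simp: pillow_def)
  show "quotient_map sphere_space projective_plane (\<lambda>u. {u, - u})"
    unfolding projective_plane_def by (rule quotient_map_quotient_topology)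
  fix u v :: "real^3"
  have "pt3 (- u $ 1) (- u $ 2) (- u $ 3) = - u" by (simp add: vec3_eq_iff)
  then show "({u, - u} = {v, - v}) = (v = u \<or> v = pt3 (- u $ 1) (- u $ 2) (- u $ 3))"
    by (auto simp: doubleton_eq_iff)
qed


text \<open>With \<open>p = (x + y) / \<surd>2\<close>, \<open>q = (x - y) / \<surd>2\<close> and \<open>r = z\<close>, the point group acts on the sphere
  by \<open>(p, q, r) \<mapsto> (p, -q, -r)\<close>; the quotient map is \<open>(q + i r)\<^sup>2\<close>, with the
  first coordinate rescaled so that the image lies on the sphere again.\<close>

definition half_turn_quotient :: "real^3 \<Rightarrow> real^3" where
  "half_turn_quotient u = (let p = (u $ 1 + u $ 2) / sqrt 2; q = (u $ 1 - u $ 2) / sqrt 2; r = u $ 3 in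
     pt3 (p * sqrt (1 + (q\<^sup>2 + r\<^sup>2))) (q\<^sup>2 - r\<^sup>2) (2 * q * r))"

lemma rotated_sphere:
  fixes u :: "real^3"
  defines "p \<equiv> (u $ 1 + u $ 2) / sqrt 2" and "q \<equiv> (u $ 1 - u $ 2) / sqrt 2" and "r \<equiv> u $ 3"
  shows "u \<in> sphere 0 1 \<longleftrightarrow> p\<^sup>2 + q\<^sup>2 + r\<^sup>2 = 1" "u $ 1 = (p + q) / sqrt 2" "u $ 2 = (p - q) / sqrt 2"
proof -
  have "p\<^sup>2 + q\<^sup>2 = (u $ 1)\<^sup>2 + (u $ 2)\<^sup>2"
    by (simp add: p_def q_def power_divide power2_sum power2_diff field_simps)
  then show "u \<in> sphere 0 1 \<longleftrightarrow> p\<^sup>2 + q\<^sup>2 + r\<^sup>2 = 1" unfolding mem_sphere3 r_def by simp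
  show "u $ 1 = (p + q) / sqrt 2" "u $ 2 = (p - q) / sqrt 2"
    by (simp_all add: p_def q_def add_divide_distrib[symmetric] diff_divide_distrib[symmetric])
qed

lemma rotated_eq_iff:
  "v = u \<longleftrightarrow> (v $ 1 + v $ 2) / sqrt 2 = (u $ 1 + u $ 2) / sqrt 2 \<and>
     (v $ 1 - v $ 2) / sqrt 2 = (u $ 1 - u $ 2) / sqrt 2 \<and> v $ 3 = u $ 3"
  for u v :: "real^3"
proof
  assume "(v $ 1 + v $ 2) / sqrt 2 = (u $ 1 + u $ 2) / sqrt 2 \<and>
     (v $ 1 - v $ 2) / sqrt 2 = (u $ 1 - u $ 2) / sqrt 2 \<and> v $ 3 = u $ 3"
  then have "v $ 1 + v $ 2 = u $ 1 + u $ 2" "v $ 1 - v $ 2 = u $ 1 - u $ 2" "v $ 3 = u $ 3" by auto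
  then show "v = u" unfolding vec3_eq_iff by linarith
qed auto

lemma half_turn_quotient_image: "half_turn_quotient ` sphere 0 1 = sphere 0 1"
proof (intro subset_antisym subsetI)
  fix v assume "v \<in> half_turn_quotient ` sphere 0 1"
  then obtain u where u: "u \<in> sphere 0 1" "v = half_turn_quotient u" by blast
  define p q r where "p = (u $ 1 + u $ 2) / sqrt 2" and "q = (u $ 1 - u $ 2) / sqrt 2" and "r = u $ 3"
  have s: "p\<^sup>2 = 1 - (q\<^sup>2 + r\<^sup>2)" using u(1) unfolding rotated_sphere(1) p_def q_def r_def by simp
  have v: "v = pt3 (p * sqrt (1 + (q\<^sup>2 + r\<^sup>2))) (q\<^sup>2 - r\<^sup>2) (2 * q * r)"
    by (simp add: u(2) half_turn_quotient_def p_def q_def r_def Let_def)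
  \<comment> \<open>With m = q^2 + r^2 one has p^2 = 1 - m, while the squared last two coordinates
    sum to m^2. The first must therefore have square 1 - m^2 = (1 - m) (1 + m), which explains the
    factor.\<close>
  have "(p * sqrt (1 + (q\<^sup>2 + r\<^sup>2)))\<^sup>2 = (1 - (q\<^sup>2 + r\<^sup>2)) * (1 + (q\<^sup>2 + r\<^sup>2))"
    by (simp add: power_mult_distrib s)
  then have "(p * sqrt (1 + (q\<^sup>2 + r\<^sup>2)))\<^sup>2 + (q\<^sup>2 - r\<^sup>2)\<^sup>2 + (2 * q * r)\<^sup>2 = 1"
    by (simp only:) (simp add: power2_eq_square algebra_simps)
  then show "v \<in> sphere 0 1" unfolding mem_sphere3 v by simp
next
  fix v :: "real^3" assume "v \<in> sphere 0 1"
  then have v: "(v $ 1)\<^sup>2 + (v $ 2)\<^sup>2 + (v $ 3)\<^sup>2 = 1" unfolding mem_sphere3 .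
  \<comment> \<open>Inverting (q + i r)^2 by a complex square root; either root would do.\<close>
  define w where "w = csqrt (Complex (v $ 2) (v $ 3))"
  define q r m where "q = Re w" and "r = Im w" and "m = q\<^sup>2 + r\<^sup>2"
  have w: "w\<^sup>2 = Complex (v $ 2) (v $ 3)" by (simp add: w_def)
  then have qr: "q\<^sup>2 - r\<^sup>2 = v $ 2" "2 * q * r = v $ 3"
    unfolding q_def r_def by (simp_all add: complex_eq_iff power2_eq_square mult.commute mult.left_commute)
  have "m\<^sup>2 = (q\<^sup>2 - r\<^sup>2)\<^sup>2 + (2 * q * r)\<^sup>2" by (simp add: m_def power2_eq_square algebra_simps)
  then have m2: "m\<^sup>2 = 1 - (v $ 1)\<^sup>2" using v qr by simp
  have m0: "m \<ge> 0" by (simp add: m_def)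
  define p where "p = v $ 1 / sqrt (1 + m)"
  define u where "u = pt3 ((p + q) / sqrt 2) ((p - q) / sqrt 2) r"
  have pqr: "(u $ 1 + u $ 2) / sqrt 2 = p" "(u $ 1 - u $ 2) / sqrt 2 = q" "u $ 3 = r"
    by (simp_all add: u_def add_divide_distrib[symmetric] diff_divide_distrib[symmetric])
  have "(v $ 1)\<^sup>2 = (1 - m) * (1 + m)" using m2 by (simp add: power2_eq_square algebra_simps)
  then have "p\<^sup>2 = 1 - m" using m0 by (simp add: p_def power_divide)
  then have "u \<in> sphere 0 1" unfolding rotated_sphere(1) pqr by (simp add: m_def)
  moreover have "half_turn_quotient u = v"
    using m0 qr unfolding half_turn_quotient_def pqr Let_def m_def[symmetric]
    by (simp add: vec3_eq_iff p_def)
  ultimately show "v \<in> half_turn_quotient ` sphere 0 1" by blast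
qed

text \<open>The modulus of (q + i r)^2 determines q^2 + r^2, which then determines p; finally equal
  squares leave only the common sign of q and r undetermined.\<close>

lemma half_turn_quotient_eq_iff:
  assumes u: "u \<in> sphere 0 1" and v: "v \<in> sphere 0 1"
  shows "half_turn_quotient u = half_turn_quotient v \<longleftrightarrow> v = u \<or> v = pt3 (u $ 2) (u $ 1) (- u $ 3)"
proof -
  define p q r where "p = (u $ 1 + u $ 2) / sqrt 2" and "q = (u $ 1 - u $ 2) / sqrt 2" and "r = u $ 3"
  define p' q' r' where "p' = (v $ 1 + v $ 2) / sqrt 2" and "q' = (v $ 1 - v $ 2) / sqrt 2" and "r' = v $ 3"
  have hu: "half_turn_quotient u = pt3 (p * sqrt (1 + (q\<^sup>2 + r\<^sup>2))) (q\<^sup>2 - r\<^sup>2) (2 * q * r)"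
    and hv: "half_turn_quotient v = pt3 (p' * sqrt (1 + (q'\<^sup>2 + r'\<^sup>2))) (q'\<^sup>2 - r'\<^sup>2) (2 * q' * r')"
    by (simp_all add: half_turn_quotient_def p_def q_def r_def p'_def q'_def r'_def Let_def)
  have "half_turn_quotient u = half_turn_quotient v \<longleftrightarrow>
      p' = p \<and> (q' = q \<and> r' = r \<or> q' = - q \<and> r' = - r)"
  proof
    assume "half_turn_quotient u = half_turn_quotient v"
    then have e: "p * sqrt (1 + (q\<^sup>2 + r\<^sup>2)) = p' * sqrt (1 + (q'\<^sup>2 + r'\<^sup>2))" "q\<^sup>2 - r\<^sup>2 = q'\<^sup>2 - r'\<^sup>2" "q * r = q' * r'"
      unfolding hu hv by (auto simp: vec3_eq_iff)
    have sqm: "(q\<^sup>2 + r\<^sup>2)\<^sup>2 = (q\<^sup>2 - r\<^sup>2)\<^sup>2 + 4 * (q * r)\<^sup>2" for q r :: real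
      by (simp add: power2_eq_square algebra_simps)
    have "(q\<^sup>2 + r\<^sup>2)\<^sup>2 = (q'\<^sup>2 + r'\<^sup>2)\<^sup>2" unfolding sqm e ..
    then have m: "q\<^sup>2 + r\<^sup>2 = q'\<^sup>2 + r'\<^sup>2" by (simp add: power2_eq_iff_nonneg)
    moreover have "sqrt (1 + (q'\<^sup>2 + r'\<^sup>2)) > 0" by (simp add: add_pos_nonneg)
    ultimately have "p' = p" using e(1) by simp
    have "Complex q r ^ 2 = Complex q' r' ^ 2"
      using e(2,3) by (simp add: complex_eq_iff power2_eq_square mult.commute)
    then have "Complex q r = Complex q' r' \<or> Complex q r = - Complex q' r'"
      by (simp only: power2_eq_iff)
    then show "p' = p \<and> (q' = q \<and> r' = r \<or> q' = - q \<and> r' = - r)"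
      using \<open>p' = p\<close> by (auto simp: complex_eq_iff)
  qed (auto simp: hu hv)
  also have "\<dots> \<longleftrightarrow> v = u \<or> v = pt3 (u $ 2) (u $ 1) (- u $ 3)"
  proof -
    have "v = u \<longleftrightarrow> p' = p \<and> q' = q \<and> r' = r"
      unfolding p_def q_def r_def p'_def q'_def r'_def by (rule rotated_eq_iff)
    moreover have "v = pt3 (u $ 2) (u $ 1) (- u $ 3) \<longleftrightarrow> p' = p \<and> q' = - q \<and> r' = - r"
      unfolding p_def q_def r_def p'_def q'_def r'_def
      by (subst rotated_eq_iff) (simp only: pt3_nth add.commute minus_diff_eq minus_divide_left)
    ultimately show ?thesis by blast
  qed
  finally show ?thesis .
qed

lemma underlying_p4: "underlying_space p4 homeomorphic_space sphere_space"
proof (rule p4.underlying_space_homeomorphic[where M="\<lambda>u. pt3 (u $ 2) (u $ 1) (- u $ 3)"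
      and h=half_turn_quotient])
  show "pillow_sphere (rot_matrix *v x + 0) = pt3 (pillow_sphere x $ 2) (pillow_sphere x $ 1) (- pillow_sphere x $ 3)" for x
    by (rule pillow_sphere_linear) (auto intro!: linear_pt3 linear_nth3 norm_eq3 simp: pillow_def mult.commute)
  show "quotient_map sphere_space sphere_space half_turn_quotient"
    unfolding sphere_space_def
  proof (rule quotient_map_sphere[unfolded sphere_space_def])
    show "continuous_on (sphere 0 1) half_turn_quotient"
      unfolding half_turn_quotient_def Let_def by (intro continuous_intros) auto
  qed (rule half_turn_quotient_image)
qed (rule half_turn_quotient_eq_iff)

section \<open>Singularities\<close>

lemma conjugate_conjugate:
  fixes A B :: "real^2^2"
  assumes "orthogonal_matrix B"
  shows "transpose B ** (B ** A ** transpose B) ** B = A"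
proof -
  have "transpose B ** (B ** A ** transpose B) ** B = (transpose B ** B) ** A ** (transpose B ** B)"
    by (simp add: matrix_mul_assoc)
  then show ?thesis using assms by (simp add: orthogonal_matrix_def)
qed

lemma conjugate_central:
  fixes A B :: "real^2^2"
  assumes "orthogonal_matrix B"
  shows "B ** A ** transpose B = mat 1 \<longleftrightarrow> A = mat 1" "B ** A ** transpose B = - mat 1 \<longleftrightarrow> A = - mat 1"
proof -
  have BB: "transpose B ** B = mat 1" "B ** transpose B = mat 1"
    using assms by (auto simp: orthogonal_matrix_def)
  show "B ** A ** transpose B = mat 1 \<longleftrightarrow> A = mat 1"
    using conjugate_conjugate[OF assms, of A] BB by auto
  show "B ** A ** transpose B = - mat 1 \<longleftrightarrow> A = - mat 1"
    using conjugate_conjugate[OF assms, of A] BB by auto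
qed

lemma det_conjugate:
  fixes A B :: "real^2^2"
  assumes "orthogonal_matrix B"
  shows "det (B ** A ** transpose B) = det A"
proof -
  have "det B * det B = 1"
    using assms by (metis det_I det_mul det_transpose orthogonal_matrix_def)
  then show ?thesis by (simp add: det_mul)
qed

text \<open>Stabilizers along an orbit are conjugate. One inclusion is proved for all elements of
  the group and then applied to \<open>g\<close> and to its inverse.\<close>

lemma isotropy_act:
  assumes S: "subgroup \<Sigma> motion_group" and g: "g \<in> \<Sigma>"
  shows "isotropy \<Sigma> (act g x) = (\<lambda>A. snd g ** A ** transpose (snd g)) ` isotropy \<Sigma> x"
proof -
  interpret group motion_group by (rule group_motion_group)
  interpret S: subgroup \<Sigma> motion_group by (rule S)
  have og: "orthogonal_matrix (snd g)" if "g \<in> \<Sigma>" for g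
    using S.mem_carrier[OF that] by (simp add: motion_group_def)
  have si: "snd (inv\<^bsub>motion_group\<^esub> g) = transpose (snd g)" if g: "g \<in> \<Sigma>" for g
  proof -
    have "snd g ** snd (inv\<^bsub>motion_group\<^esub> g) = mat 1"
      using r_inv[OF S.mem_carrier[OF g]] by (simp add: motion_group_def prod_eq_iff)
    then have "transpose (snd g) ** (snd g ** snd (inv\<^bsub>motion_group\<^esub> g)) = transpose (snd g)" by simp
    then show ?thesis
      using og[OF g] by (simp add: matrix_mul_assoc orthogonal_matrix_def)
  qed
  have ai: "act (inv\<^bsub>motion_group\<^esub> g) (act g x) = x" if g: "g \<in> \<Sigma>" for g x
    using S.mem_carrier[OF g] by (simp add: act_mult[symmetric]) (simp add: act_def motion_group_def)
  have sub: "(\<lambda>A. snd g ** A ** transpose (snd g)) ` isotropy \<Sigma> x \<subseteq> isotropy \<Sigma> (act g x)"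
    if g: "g \<in> \<Sigma>" for g x
  proof -
    have gi: "inv\<^bsub>motion_group\<^esub> g \<in> \<Sigma>" using g by simp
    show ?thesis
    proof
      fix C assume "C \<in> (\<lambda>A. snd g ** A ** transpose (snd g)) ` isotropy \<Sigma> x"
      then obtain h where h: "h \<in> \<Sigma>" "act h x = x" "C = snd g ** snd h ** transpose (snd g)"
        by (auto simp: isotropy_def)
      let ?k = "g \<otimes>\<^bsub>motion_group\<^esub> h \<otimes>\<^bsub>motion_group\<^esub> inv\<^bsub>motion_group\<^esub> g"
      have "?k \<in> \<Sigma>" using g h(1) gi by simp
      moreover have "act ?k (act g x) = act g x" by (simp add: act_mult ai[OF g] h(2))
      moreover have "snd ?k = C" using si[OF g] by (simp add: motion_group_def h(3))
      ultimately show "C \<in> isotropy \<Sigma> (act g x)" unfolding isotropy_def by blast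
    qed
  qed
  show ?thesis
  proof (rule subset_antisym[OF _ sub[OF g]])
    let ?i = "inv\<^bsub>motion_group\<^esub> g"
    show "isotropy \<Sigma> (act g x) \<subseteq> (\<lambda>A. snd g ** A ** transpose (snd g)) ` isotropy \<Sigma> x"
    proof
      fix C assume "C \<in> isotropy \<Sigma> (act g x)"
      then have "transpose (snd g) ** C ** snd g \<in> isotropy \<Sigma> x"
        using sub[of ?i "act g x"] g unfolding si[OF g] ai[OF g] by (auto simp: transpose_transpose)
      moreover have "C = snd g ** (transpose (snd g) ** C ** snd g) ** transpose (snd g)"
        using conjugate_conjugate[of "transpose (snd g)" C] og[OF g] by (simp add: orthogonal_matrix_transpose)
      ultimately show "C \<in> (\<lambda>A. snd g ** A ** transpose (snd g)) ` isotropy \<Sigma> x" by blast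
    qed
  qed
qed

lemma orbit_self:
  assumes "subgroup \<Sigma> motion_group"
  shows "x \<in> motion_orbit \<Sigma> x"
proof -
  have "act \<one>\<^bsub>motion_group\<^esub> x = x" by (simp add: motion_group_def act_def)
  then show ?thesis unfolding motion_orbit_def using subgroup.one_closed[OF assms] by (metis imageI)
qed

lemma isotropy_type_orbit:
  assumes S: "subgroup \<Sigma> motion_group"
  shows "isotropy_type \<Sigma> (motion_orbit \<Sigma> x) =
    {(\<lambda>A. B ** A ** transpose B) ` isotropy \<Sigma> x | B. orthogonal_matrix B}"
proof (intro subset_antisym subsetI)
  fix H assume "H \<in> isotropy_type \<Sigma> (motion_orbit \<Sigma> x)"
  then obtain B g where B: "orthogonal_matrix B" "g \<in> \<Sigma>" and
    H: "H = (\<lambda>A. B ** A ** transpose B) ` isotropy \<Sigma> (act g x)"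
    by (auto simp: isotropy_type_def motion_orbit_def)
  have "orthogonal_matrix (snd g)"
    using B(2) subgroup.subset[OF S] by (auto simp: motion_group_def)
  then have "orthogonal_matrix (B ** snd g)" using B(1) by (simp add: orthogonal_matrix_mul)
  moreover have "H = (\<lambda>A. (B ** snd g) ** A ** transpose (B ** snd g)) ` isotropy \<Sigma> x"
    unfolding H isotropy_act[OF S B(2)] image_image
    by (simp add: matrix_transpose_mul matrix_mul_assoc)
  ultimately show "H \<in> {(\<lambda>A. B ** A ** transpose B) ` isotropy \<Sigma> x | B. orthogonal_matrix B}" by blast
next
  fix H assume "H \<in> {(\<lambda>A. B ** A ** transpose B) ` isotropy \<Sigma> x | B. orthogonal_matrix B}"
  then show "H \<in> isotropy_type \<Sigma> (motion_orbit \<Sigma> x)"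
    using orbit_self[OF S, of x] unfolding isotropy_type_def by blast
qed

lemma isotropy_in_type:
  assumes S: "subgroup \<Sigma> motion_group"
  shows "isotropy \<Sigma> x \<in> isotropy_type \<Sigma> (motion_orbit \<Sigma> x)"
  unfolding isotropy_type_orbit[OF S] mem_Collect_eq
  by (rule exI[of _ "mat 1"]) (simp add: orthogonal_matrix_id)

lemma singular_orbit_iff:
  assumes S: "subgroup \<Sigma> motion_group"
  shows "singular_point \<Sigma> (motion_orbit \<Sigma> x) \<longleftrightarrow> isotropy \<Sigma> x \<noteq> {mat 1}"
proof
  assume ne: "isotropy \<Sigma> x \<noteq> {mat 1}"
  have "isotropy \<Sigma> (act g x) \<noteq> {mat 1}" if g: "g \<in> \<Sigma>" for g
  proof
    have o: "orthogonal_matrix (snd g)"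
      using g subgroup.subset[OF S] by (auto simp: motion_group_def)
    assume "isotropy \<Sigma> (act g x) = {mat 1}"
    then have im: "(\<lambda>A. snd g ** A ** transpose (snd g)) ` isotropy \<Sigma> x = {mat 1}"
      unfolding isotropy_act[OF S g] .
    then have "isotropy \<Sigma> x \<subseteq> {mat 1}" using conjugate_central(1)[OF o] by blast
    moreover have "isotropy \<Sigma> x \<noteq> {}" using im by blast
    ultimately show False using ne by blast
  qed
  then show "singular_point \<Sigma> (motion_orbit \<Sigma> x)"
    by (auto simp: singular_point_def orbifold_points_def motion_orbit_def)
qed (use orbit_self[OF S] in \<open>auto simp: singular_point_def\<close>)

text \<open>Properties of isotropy groups that can be tested on isotropy types: they pass from a
  conjugate back to the group, and they fail for the trivial group, so a point having the property
  is singular and its type is recorded in \<open>singularity_types\<close>.\<close>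

definition conjugation_reflecting :: "((real^2^2) set \<Rightarrow> bool) \<Rightarrow> bool" where
  "conjugation_reflecting \<phi> \<longleftrightarrow> \<not> \<phi> {mat 1} \<and>
     (\<forall>H B. orthogonal_matrix B \<longrightarrow> \<phi> ((\<lambda>A. B ** A ** transpose B) ` H) \<longrightarrow> \<phi> H)"

lemma singularity_types_invariant:
  assumes S: "subgroup \<Sigma> motion_group" and S': "subgroup \<Sigma>' motion_group"
    and eq: "singularity_types \<Sigma> = singularity_types \<Sigma>'" and \<phi>: "conjugation_reflecting \<phi>"
    and x: "\<phi> (isotropy \<Sigma> x)"
  shows "\<exists>y. \<phi> (isotropy \<Sigma>' y)"
proof -
  have "isotropy \<Sigma> x \<noteq> {mat 1}" using x \<phi> by (auto simp: conjugation_reflecting_def)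
  then have "singular_point \<Sigma> (motion_orbit \<Sigma> x)" using singular_orbit_iff[OF S] by blast
  then have "isotropy_type \<Sigma> (motion_orbit \<Sigma> x) \<in> singularity_types \<Sigma>"
    unfolding singularity_types_def by blast
  then have "isotropy_type \<Sigma> (motion_orbit \<Sigma> x) \<in> singularity_types \<Sigma>'" by (simp only: eq)
  then obtain P where P: "singular_point \<Sigma>' P" "isotropy_type \<Sigma> (motion_orbit \<Sigma> x) = isotropy_type \<Sigma>' P"
    by (auto simp: singularity_types_def)
  obtain y where y: "P = motion_orbit \<Sigma>' y" using P(1) by (auto simp: singular_point_def orbifold_points_def)
  have "isotropy \<Sigma> x \<in> isotropy_type \<Sigma>' (motion_orbit \<Sigma>' y)"
    using isotropy_in_type[OF S, of x] unfolding P(2) y .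
  then obtain B where "orthogonal_matrix B" "isotropy \<Sigma> x = (\<lambda>A. B ** A ** transpose B) ` isotropy \<Sigma>' y"
    unfolding isotropy_type_orbit[OF S'] by blast
  then have "\<phi> (isotropy \<Sigma>' y)" using x \<phi> unfolding conjugation_reflecting_def by metis
  then show ?thesis ..
qed

text \<open>The three properties detect cone points of order two, mirrors, and corners or cone
  points of order four. Their occurrence, in this order, is no-yes-yes for pmm, yes-yes-no for pmg,
  yes-no-no for pgg, yes-yes-yes for cmm and yes-no-yes for p4: five different patterns.\<close>

definition half_turn_only :: "(real^2^2) set \<Rightarrow> bool" where
  "half_turn_only H \<longleftrightarrow> - mat 1 \<in> H \<and> (\<forall>A\<in>H. A = mat 1 \<or> A = - mat 1)"

definition has_reflection :: "(real^2^2) set \<Rightarrow> bool" where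
  "has_reflection H \<longleftrightarrow> (\<exists>A\<in>H. det A = - 1)"

definition half_turn_and_more :: "(real^2^2) set \<Rightarrow> bool" where
  "half_turn_and_more H \<longleftrightarrow> - mat 1 \<in> H \<and> (\<exists>A\<in>H. A \<noteq> mat 1 \<and> A \<noteq> - mat 1)"

lemma mat1_neq: "- mat 1 \<noteq> (mat 1 :: real^2^2)" "mat 1 \<noteq> (- mat 1 :: real^2^2)"
  by (auto simp: matrix2_eq_iff matrix2_simps)

lemma half_turn_in_conjugate:
  assumes "orthogonal_matrix B" "- mat 1 \<in> (\<lambda>A. B ** A ** transpose B) ` H"
  shows "- mat 1 \<in> (H :: (real^2^2) set)"
proof -
  from assms(2) obtain A where A: "- mat 1 = B ** A ** transpose B" "A \<in> H" by (rule imageE)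
  then have "A = - mat 1" using conjugate_central(2)[OF assms(1), of A] by simp
  then show ?thesis using A(2) by simp
qed

lemma conjugation_reflecting_half_turn_only: "conjugation_reflecting half_turn_only"
  unfolding conjugation_reflecting_def half_turn_only_def
proof (intro conjI allI impI ballI; (elim conjE)?)
  show "\<not> (- mat 1 \<in> {mat 1 :: real^2^2} \<and> (\<forall>A\<in>{mat 1}. A = mat 1 \<or> A = - mat 1))"
    using mat1_neq by blast
  fix H and B :: "real^2^2"
  assume B: "orthogonal_matrix B" and m: "- mat 1 \<in> (\<lambda>A. B ** A ** transpose B) ` H"
    and all: "\<forall>A\<in>(\<lambda>A. B ** A ** transpose B) ` H. A = mat 1 \<or> A = - mat 1"
  show "- mat 1 \<in> H" using half_turn_in_conjugate[OF B m] .
  fix A assume "A \<in> H"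
  then have "B ** A ** transpose B = mat 1 \<or> B ** A ** transpose B = - mat 1" using all by blast
  then show "A = mat 1 \<or> A = - mat 1" unfolding conjugate_central[OF B] .
qed

lemma conjugation_reflecting_has_reflection: "conjugation_reflecting has_reflection"
  unfolding conjugation_reflecting_def has_reflection_def
proof (intro conjI allI impI)
  show "\<not> (\<exists>A\<in>{mat 1 :: real^2^2}. det A = - 1)" by simp
  fix H and B :: "real^2^2"
  assume B: "orthogonal_matrix B" and "\<exists>A\<in>(\<lambda>A. B ** A ** transpose B) ` H. det A = - 1"
  then obtain A where "A \<in> H" "det (B ** A ** transpose B) = - 1" by blast
  then show "\<exists>A\<in>H. det A = - 1" unfolding det_conjugate[OF B] by blast
qed

lemma conjugation_reflecting_half_turn_and_more: "conjugation_reflecting half_turn_and_more"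
  unfolding conjugation_reflecting_def half_turn_and_more_def
proof (intro conjI allI impI; (elim conjE)?)
  show "\<not> (- mat 1 \<in> {mat 1 :: real^2^2} \<and> (\<exists>A\<in>{mat 1}. A \<noteq> mat 1 \<and> A \<noteq> - mat 1))" by blast
  fix H and B :: "real^2^2"
  assume B: "orthogonal_matrix B" and m: "- mat 1 \<in> (\<lambda>A. B ** A ** transpose B) ` H"
    and ex: "\<exists>A\<in>(\<lambda>A. B ** A ** transpose B) ` H. A \<noteq> mat 1 \<and> A \<noteq> - mat 1"
  show "- mat 1 \<in> H" using half_turn_in_conjugate[OF B m] .
  obtain A where "A \<in> H" "B ** A ** transpose B \<noteq> mat 1" "B ** A ** transpose B \<noteq> - mat 1"
    using ex by blast
  then show "\<exists>A\<in>H. A \<noteq> mat 1 \<and> A \<noteq> - mat 1" unfolding conjugate_central[OF B] by blast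
qed

lemmas conjugation_reflecting = conjugation_reflecting_half_turn_only
  conjugation_reflecting_has_reflection conjugation_reflecting_half_turn_and_more

text \<open>A motion fixing x is determined by its linear part B, since its translation must be x -
  B x.\<close>

lemma (in crystal) mem_isotropy_iff:
  "B \<in> isotropy (crys A b) x \<longleftrightarrow> B = mat 1 \<or> B = - mat 1 \<and> x + x \<in> period_lattice \<or>
     B = A \<and> x - A *v x - b \<in> period_lattice \<or> B = - A \<and> x + A *v x - b \<in> period_lattice"
proof -
  have "B \<in> isotropy (crys A b) x \<longleftrightarrow> (x - B *v x, B) \<in> crys A b"
  proof
    assume "B \<in> isotropy (crys A b) x"
    then obtain t where "(t, B) \<in> crys A b" "B *v x + t = x"
      by (auto simp: isotropy_def act_pair)
    moreover from this(2) have "t = x - B *v x" by (simp add: eq_diff_eq add.commute)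
    ultimately show "(x - B *v x, B) \<in> crys A b" by simp
  next
    assume "(x - B *v x, B) \<in> crys A b"
    moreover have "act (x - B *v x, B) x = x" by (simp add: act_pair)
    ultimately show "B \<in> isotropy (crys A b) x" unfolding isotropy_def by (metis (mono_tags, lifting) imageI mem_Collect_eq snd_conv)
  qed
  then show ?thesis by (auto simp: crys_def)
qed

lemma sin_zero_period: "(\<exists>k::int. x = pi * of_int k) \<longleftrightarrow> sin x = 0"
  unfolding sin_zero_iff_int2 by (simp add: mult.commute)

lemma cos_zero_period: "(\<exists>k::int. 2 * x - pi = 2 * pi * of_int k) \<longleftrightarrow> cos x = 0"
proof -
  have "cos x = 0 \<longleftrightarrow> sin (x - pi / 2) = 0" by (simp add: sin_diff)
  also have "\<dots> \<longleftrightarrow> (\<exists>k::int. x - pi / 2 = pi * of_int k)" by (rule sin_zero_period[symmetric])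
  also have "\<dots> \<longleftrightarrow> (\<exists>k::int. 2 * x - pi = 2 * pi * of_int k)" by (simp add: field_simps)
  finally show ?thesis by simp
qed

text \<open>Parity. It shows that the glides of pmg and pgg have no fixed points and that the
  half-turn centre \<open>pt pi 0\<close> has no larger isotropy in cmm and p4.\<close>

lemma not_period_pi: "\<not> (\<exists>k::int. - pi = 2 * pi * of_int k)" "\<not> (\<exists>k::int. pi = 2 * pi * of_int k)"
proof -
  have "pi * of_int m \<noteq> 2 * pi * of_int k" if "m = 1 \<or> m = - 1" for k m :: int
  proof
    assume "pi * of_int m = 2 * pi * of_int k"
    then have "real_of_int m = real_of_int (2 * k)" by simp
    then have "m = 2 * k" by (simp only: of_int_eq_iff)
    then show False using that by presburger
  qed
  from this[of "- 1"] this[of 1]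
  show "\<not> (\<exists>k::int. - pi = 2 * pi * of_int k)" "\<not> (\<exists>k::int. pi = 2 * pi * of_int k)" by auto
qed

text \<open>Lattice conditions on x are rewritten as zeros of sine (and of cosine for pmg), which
  links them with the orbit invariants of \<open>pillow\<close>.\<close>

lemma isotropy_pmm: "B \<in> isotropy pmm x \<longleftrightarrow> B = mat 1 \<or> B = - mat 1 \<and> sin (x $ 1) = 0 \<and> sin (x $ 2) = 0 \<or>
    B = refl_matrix \<and> sin (x $ 2) = 0 \<or> B = - refl_matrix \<and> sin (x $ 1) = 0"
  unfolding pmm.mem_isotropy_iff by (simp add: period_lattice_nth sin_zero_period)

lemma isotropy_pmg: "B \<in> isotropy pmg x \<longleftrightarrow> B = mat 1 \<or> B = - mat 1 \<and> sin (x $ 1) = 0 \<and> sin (x $ 2) = 0 \<or>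
    B = - refl_matrix \<and> cos (x $ 1) = 0"
  unfolding pmg.mem_isotropy_iff
  by (simp add: period_lattice_nth sin_zero_period cos_zero_period not_period_pi)

lemma isotropy_pgg: "B \<in> isotropy pgg x \<longleftrightarrow> B = mat 1 \<or> B = - mat 1 \<and> sin (x $ 1) = 0 \<and> sin (x $ 2) = 0"
  unfolding pgg.mem_isotropy_iff
  by (simp add: period_lattice_nth sin_zero_period cos_zero_period not_period_pi)

lemma det_matrices: "det refl_matrix = - 1" "det (- refl_matrix) = - 1" "det swap_matrix = - 1"
  "det rot_matrix = 1" "det (- rot_matrix) = 1" "det (mat 1 :: real^2^2) = 1" "det (- mat 1 :: real^2^2) = 1"
  by (simp_all add: det_2 matrix2_simps)

lemma matrices_neq:
  "refl_matrix \<noteq> mat 1" "refl_matrix \<noteq> - mat 1" "- refl_matrix \<noteq> mat 1" "- refl_matrix \<noteq> - mat 1"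
  "swap_matrix \<noteq> mat 1" "swap_matrix \<noteq> - mat 1" "- swap_matrix \<noteq> mat 1" "- swap_matrix \<noteq> - mat 1"
  "rot_matrix \<noteq> mat 1" "rot_matrix \<noteq> - mat 1" "- rot_matrix \<noteq> mat 1" "- rot_matrix \<noteq> - mat 1"
  by (auto simp: matrix2_eq_iff matrix2_simps)

lemma sin_or_cos: "sin x = 0 \<Longrightarrow> cos x \<noteq> (0::real)"
  using sin_cos_squared_add[of x] by auto

lemma types_pmm: "\<not> half_turn_only (isotropy pmm x)" "has_reflection (isotropy pmm 0)"
    "half_turn_and_more (isotropy pmm 0)"
  unfolding half_turn_only_def has_reflection_def half_turn_and_more_def
  using matrices_neq mat1_neq det_matrices by (auto simp: isotropy_pmm)

text \<open>The mirrors lie where cos x = 0 and the half-turn centres where sin x = 0, so no point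
  has both kinds of isotropy.\<close>

lemma types_pmg: "half_turn_only (isotropy pmg 0)" "has_reflection (isotropy pmg (pt (pi / 2) 0))"
    "\<not> half_turn_and_more (isotropy pmg x)"
  unfolding half_turn_only_def has_reflection_def half_turn_and_more_def
  using matrices_neq mat1_neq det_matrices sin_or_cos[of "x $ 1"] by (auto simp: isotropy_pmg)

lemma types_pgg: "half_turn_only (isotropy pgg 0)" "\<not> has_reflection (isotropy pgg x)"
    "\<not> half_turn_and_more (isotropy pgg x)"
  unfolding half_turn_only_def has_reflection_def half_turn_and_more_def
  using det_matrices by (auto simp: isotropy_pgg)

text \<open>The origin is a corner where mirrors cross, while \<open>pt pi 0\<close> is a half-turn
  centre off every mirror: the swap moves it by (pi, -pi) up to sign, which is not a period.\<close>

lemma types_cmm: "half_turn_only (isotropy cmm (pt pi 0))" "has_reflection (isotropy cmm 0)"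
    "half_turn_and_more (isotropy cmm 0)"
proof -
  have "- mat 1 \<in> isotropy cmm (pt pi 0)"
    unfolding cmm.mem_isotropy_iff by (auto simp: period_lattice_nth period_two_pi)
  moreover have "swap_matrix \<notin> isotropy cmm (pt pi 0)" "- swap_matrix \<notin> isotropy cmm (pt pi 0)"
    unfolding cmm.mem_isotropy_iff using matrices_neq not_period_pi
    by (auto simp: period_lattice_nth matrix2_eq_iff)
  ultimately show "half_turn_only (isotropy cmm (pt pi 0))"
    unfolding half_turn_only_def using cmm.mem_isotropy_iff by blast
  have "swap_matrix \<in> isotropy cmm 0" "- mat 1 \<in> isotropy cmm 0"
    unfolding cmm.mem_isotropy_iff by simp_all
  then show "has_reflection (isotropy cmm 0)" "half_turn_and_more (isotropy cmm 0)"
    unfolding has_reflection_def half_turn_and_more_def using det_matrices matrices_neq by metis+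
qed

lemma isotropy_p4_subset: "isotropy p4 x \<subseteq> {mat 1, - mat 1, rot_matrix, - rot_matrix}"
  using p4.mem_isotropy_iff by blast

lemma types_p4: "half_turn_only (isotropy p4 (pt pi 0))" "\<not> has_reflection (isotropy p4 x)"
    "half_turn_and_more (isotropy p4 0)"
proof -
  have "- mat 1 \<in> isotropy p4 (pt pi 0)"
    unfolding p4.mem_isotropy_iff by (auto simp: period_lattice_nth period_two_pi)
  moreover have "rot_matrix \<notin> isotropy p4 (pt pi 0)" "- rot_matrix \<notin> isotropy p4 (pt pi 0)"
    unfolding p4.mem_isotropy_iff using matrices_neq not_period_pi
    by (auto simp: period_lattice_nth matrix2_eq_iff)
  ultimately show "half_turn_only (isotropy p4 (pt pi 0))"
    unfolding half_turn_only_def using p4.mem_isotropy_iff by blast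
  show "\<not> has_reflection (isotropy p4 x)"
    unfolding has_reflection_def using isotropy_p4_subset[of x] det_matrices by fastforce
  have "rot_matrix \<in> isotropy p4 0" "- mat 1 \<in> isotropy p4 0"
    unfolding p4.mem_isotropy_iff by simp_all
  then show "half_turn_and_more (isotropy p4 0)"
    unfolding half_turn_and_more_def using matrices_neq by metis
qed

lemma subgroup_groups: "G \<in> {pmm, pmg, pgg, cmm, p4} \<Longrightarrow> subgroup G motion_group"
  using pmm.subgroup_crys pmg.subgroup_crys pgg.subgroup_crys cmm.subgroup_crys p4.subgroup_crys by blast

lemma singularity_types_groups:
  "pairwise (\<lambda>G G'. singularity_types G \<noteq> singularity_types G') {pmm, pmg, pgg, cmm, p4}"
proof -
  define F where "F = {pmm, pmg, pgg, cmm, p4}"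
  define has where "has \<phi> G \<longleftrightarrow> (\<exists>x. \<phi> (isotropy G x))" for \<phi> and G :: "motion set"
  have inv: "has \<phi> G \<longleftrightarrow> has \<phi> G'"
    if "G \<in> F" "G' \<in> F" "singularity_types G = singularity_types G'" "conjugation_reflecting \<phi>" for \<phi> G G'
    unfolding has_def
    using singularity_types_invariant[of G G' \<phi>] singularity_types_invariant[of G' G \<phi>] that
      subgroup_groups unfolding F_def by metis
  have 1: "\<not> has half_turn_only pmm" "has half_turn_only pmg" "has half_turn_only pgg"
    "has half_turn_only cmm" "has half_turn_only p4"
    unfolding has_def using types_pmm types_pmg types_pgg types_cmm types_p4 by blast+
  have 2: "has has_reflection pmm" "has has_reflection pmg" "\<not> has has_reflection pgg"
    "has has_reflection cmm" "\<not> has has_reflection p4"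
    unfolding has_def using types_pmm types_pmg types_pgg types_cmm types_p4 by blast+
  have 3: "has half_turn_and_more pmm" "\<not> has half_turn_and_more pmg" "\<not> has half_turn_and_more pgg"
    "has half_turn_and_more cmm" "has half_turn_and_more p4"
    unfolding has_def using types_pmm types_pmg types_pgg types_cmm types_p4 by blast+
  have "G = G'" if G: "G \<in> F" "G' \<in> F" "singularity_types G = singularity_types G'" for G G'
    using inv[OF G conjugation_reflecting(1)] inv[OF G conjugation_reflecting(2)]
      inv[OF G conjugation_reflecting(3)] G(1,2) 1 2 3 unfolding F_def by auto
  then show ?thesis unfolding pairwise_def F_def by blast
qed

lemma locally_orientable_p4: "locally_orientable p4"
  unfolding locally_orientable_def rotation_matrix_def
proof (intro allI ballI conjI)
  fix x A assume "A \<in> isotropy p4 x"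
  then have A: "A \<in> {mat 1, - mat 1, rot_matrix, - rot_matrix}" using isotropy_p4_subset by blast
  then show "det A = 1" using det_matrices by auto
  show "orthogonal_matrix A" using A by (auto simp: orthogonal_matrix_def matrix2_eq_iff matrix2_simps)
qed

lemma singular_p4: "singular_point p4 (motion_orbit p4 0)"
proof -
  have "- mat 1 \<in> isotropy p4 0" using types_p4(3) by (simp add: half_turn_and_more_def)
  then show ?thesis unfolding singular_orbit_iff[OF p4.subgroup_crys] using mat1_neq by auto
qed

lemma cone_points_p4: "singular_point p4 P \<Longrightarrow> cone_point p4 P"
  using locally_orientable_p4 finite_subset[OF isotropy_p4_subset]
  by (auto simp: cone_point_def locally_orientable_def)

lemma not_locally_orientable_pmm: "\<not> locally_orientable pmm"
proof
  assume "locally_orientable pmm"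
  moreover obtain A where "A \<in> isotropy pmm 0" "det A = - 1"
    using types_pmm(2) unfolding has_reflection_def by blast
  ultimately have "rotation_matrix A" unfolding locally_orientable_def by blast
  then show False using \<open>det A = - 1\<close> by (simp add: rotation_matrix_def)
qed


section \<open>The orbifold pmm is a square\<close>

text \<open>In pmm the coordinates can change sign independently, so the relative sign kept by the
  third coordinate of \<open>pillow\<close> is lost and the two cosines are complete
  invariants.\<close>

lemma pmm_orbit_iff:
  "y \<in> motion_orbit pmm x \<longleftrightarrow> cos (y $ 1) = cos (x $ 1) \<and> cos (y $ 2) = cos (x $ 2)"
proof
  assume "y \<in> motion_orbit pmm x"
  then have "pillow y = pillow x \<or> pillow y = pillow (refl_matrix *v x + 0)"
    unfolding pmm.mem_orbit_iff pillow_sphere_eq_iff .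
  then show "cos (y $ 1) = cos (x $ 1) \<and> cos (y $ 2) = cos (x $ 2)"
    by (auto simp: pillow_def vec3_eq_iff)
next
  assume c: "cos (y $ 1) = cos (x $ 1) \<and> cos (y $ 2) = cos (x $ 2)"
  have ex: "\<exists>e k. (e = 1 \<or> e = - 1) \<and> b = e * a + 2 * pi * of_int k" if "cos b = cos a" for a b :: real
    using that[symmetric] by (rule cos_eq_cases) (force intro: exI[of _ 1] exI[of _ "- 1"])+
  obtain e k where e: "e = 1 \<or> e = - 1" "y $ 1 = e * x $ 1 + 2 * pi * of_int k" using ex c by blast
  obtain d l where d: "d = 1 \<or> d = - 1" "y $ 2 = d * x $ 2 + 2 * pi * of_int l" using ex c by blast
  let ?g = "(pt (2 * pi * of_int k) (2 * pi * of_int l), diag2 e d)"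
  have "?g \<in> pmm" using e(1) d(1) by (auto simp: pmm_iff lattice_pt)
  moreover have "y = act ?g x" using e(2) d(2) by (simp add: act_pair plane_eq_iff)
  ultimately show "y \<in> motion_orbit pmm x" unfolding motion_orbit_def by (rule rev_image_eqI)
qed

lemma pmm_orbit_eq_iff: "motion_orbit pmm x = motion_orbit pmm y \<longleftrightarrow>
    cos (y $ 1) = cos (x $ 1) \<and> cos (y $ 2) = cos (x $ 2)"
  unfolding pmm.orbit_eq_iff pmm_orbit_iff ..

text \<open>The function arccos(cos a) is the distance of a from the multiples of 2 pi; this lemma
  and the next express that, and the Lipschitz bound follows as for any distance to a set.\<close>

lemma arccos_cos_le: "arccos (cos a) \<le> \<bar>a - 2 * pi * of_int k\<bar>"
proof -
  have "arccos (cos y) \<le> \<bar>y\<bar>" for y :: real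
  proof (cases "\<bar>y\<bar> \<le> pi")
    case True
    have "cos y = cos \<bar>y\<bar>" by (simp add: abs_if)
    then show ?thesis using True arccos_cos[of "\<bar>y\<bar>"] by simp
  next
    case False
    then show ?thesis using arccos_ubound[of "cos y"] by simp
  qed
  from this[of "a - 2 * pi * of_int k"] show ?thesis
    using sin_cos_eq_iff[of "a - 2 * pi * of_int k" a] by (auto dest!: spec[of _ "- k"])
qed

lemma arccos_cos_eq: obtains k :: int where "arccos (cos a) = \<bar>a - 2 * pi * of_int k\<bar>"
proof -
  have "cos a = cos (arccos (cos a))" by (simp add: cos_arccos)
  then show ?thesis
  proof (rule cos_eq_cases)
    fix k :: int assume "arccos (cos a) = a + 2 * pi * of_int k"
    then show ?thesis using arccos_lbound[of "cos a"] by (intro that[of "- k"]) simp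
  next
    fix k :: int assume "arccos (cos a) = - a + 2 * pi * of_int k"
    then show ?thesis using arccos_lbound[of "cos a"] by (intro that[of "k"]) simp
  qed
qed

lemma arccos_cos_lipschitz: "\<bar>arccos (cos a) - arccos (cos b)\<bar> \<le> \<bar>a - b\<bar>"
proof -
  have "arccos (cos a) \<le> \<bar>a - b\<bar> + arccos (cos b)" for a b :: real
  proof -
    obtain k :: int where k: "arccos (cos b) = \<bar>b - 2 * pi * of_int k\<bar>" by (rule arccos_cos_eq)
    show ?thesis using arccos_cos_le[of a k] unfolding k by linarith
  qed
  from this[of a b] this[of b a] show ?thesis by linarith
qed

definition fold_plane :: "plane \<Rightarrow> plane" where
  "fold_plane p = pt (arccos (cos (p $ 1))) (arccos (cos (p $ 2)))"

lemma fold_plane_orbit: "fold_plane p \<in> motion_orbit pmm p"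
  by (simp add: pmm_orbit_iff fold_plane_def cos_arccos)

lemma fold_plane_square: "fold_plane p \<in> square pi"
  by (simp add: mem_square fold_plane_def arccos_lbound arccos_ubound)

lemma fold_plane_id: "p \<in> square pi \<Longrightarrow> fold_plane p = p"
  by (simp add: mem_square fold_plane_def arccos_cos)

lemma fold_plane_dist: "dist (fold_plane p) (fold_plane q) \<le> dist p q"
  unfolding dist_norm
proof (rule norm_le_componentwise_cart)
  fix i :: 2
  show "norm ((fold_plane p - fold_plane q) $ i) \<le> norm ((p - q) $ i)"
    using exhaust_2[of i] arccos_cos_lipschitz by (auto simp: fold_plane_def)
qed

text \<open>Folding does not increase distances, which bounds the distance in the square by the
  quotient distance. Conversely the folded points belong to the two orbits, so their distance bounds
  the infimum from above.\<close>

lemma isometric_to_square_pmm: "isometric_to_square pmm pi"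
proof -
  \<comment> \<open>The choice of a lift is immaterial, because \<open>fold_plane\<close> is
    constant on orbits.\<close>
  define \<phi> where "\<phi> P = fold_plane (SOME p. p \<in> P)" for P :: "plane set"
  have \<phi>: "\<phi> (motion_orbit pmm p) = fold_plane p" for p
  proof -
    have "(SOME q. q \<in> motion_orbit pmm p) \<in> motion_orbit pmm p"
      using fold_plane_orbit by (rule someI)
    then show ?thesis by (simp add: \<phi>_def fold_plane_def pmm_orbit_iff)
  qed
  have "bij_betw \<phi> (orbifold_points pmm) (square pi)"
  proof (rule bij_betwI')
    fix P Q assume "P \<in> orbifold_points pmm" "Q \<in> orbifold_points pmm"
    then obtain p q where [simp]: "P = motion_orbit pmm p" "Q = motion_orbit pmm q"
      by (auto simp: orbifold_points_def)
    have o: "motion_orbit pmm (fold_plane p) = motion_orbit pmm p" for p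
      by (simp add: pmm_orbit_eq_iff fold_plane_def cos_arccos)
    show "(\<phi> P = \<phi> Q) = (P = Q)"
    proof
      assume "\<phi> P = \<phi> Q"
      then have "fold_plane p = fold_plane q" by (simp add: \<phi>)
      then show "P = Q" using o[of p] o[of q] by simp
    qed simp
  next
    fix P assume "P \<in> orbifold_points pmm"
    then show "\<phi> P \<in> square pi" by (auto simp: orbifold_points_def \<phi> fold_plane_square)
  next
    fix p assume "p \<in> square pi"
    then have "p = \<phi> (motion_orbit pmm p)" by (simp add: \<phi> fold_plane_id)
    then show "\<exists>P\<in>orbifold_points pmm. p = \<phi> P" unfolding orbifold_points_def by blast
  qed
  moreover have "dist (\<phi> P) (\<phi> Q) = setdist P Q"
    if PQ: "P \<in> orbifold_points pmm" "Q \<in> orbifold_points pmm" for P Q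
  proof -
    obtain p q where [simp]: "P = motion_orbit pmm p" "Q = motion_orbit pmm q"
      using PQ by (auto simp: orbifold_points_def)
    have f: "fold_plane x = fold_plane y" if "x \<in> motion_orbit pmm y" for x y
      using that by (simp add: fold_plane_def pmm_orbit_iff)
    show ?thesis
    proof (rule antisym)
      show "setdist P Q \<le> dist (\<phi> P) (\<phi> Q)"
        by (simp add: \<phi> setdist_le_dist fold_plane_orbit)
      show "dist (\<phi> P) (\<phi> Q) \<le> setdist P Q"
      proof (rule le_setdistI)
        show "P \<noteq> {}" "Q \<noteq> {}" using fold_plane_orbit by auto
        fix x y assume "x \<in> P" "y \<in> Q"
        then have "\<phi> P = fold_plane x" "\<phi> Q = fold_plane y" using f by (auto simp: \<phi>)
        then show "dist (\<phi> P) (\<phi> Q) \<le> dist x y" using fold_plane_dist by simp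
      qed
    qed
  qed
  ultimately show ?thesis unfolding isometric_to_square_def by blast
qed

section \<open>Reflector edges\<close>

text \<open>The way in which edges are recognised: a nonempty connected set that is open and closed
  in its stratum is a component of it.\<close>

lemma clopen_connected_component:
  assumes C: "connectedin X E" "E \<noteq> {}" and "openin X E" "closedin X E"
  shows "E \<in> connected_components_of X"
proof -
  obtain x where x: "x \<in> E" using C(2) by blast
  have top: "x \<in> topspace X" using x C(1) connectedin_subset_topspace by blast
  let ?K = "connected_component_of_set X x"
  have K: "connectedin X ?K" by (rule connectedin_connected_component_of)
  have "x \<in> ?K" using top by (simp add: connected_component_of_refl)
  then have "\<not> disjnt ?K E" using x by (auto simp: disjnt_def)
  then have "?K \<subseteq> E" using connectedin_clopen_cases[OF K assms(4,3)] by blast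
  moreover have "E \<subseteq> ?K" by (rule connected_component_of_maximal[OF C(1) x])
  ultimately have "E = ?K" by blast
  then show ?thesis using top by (auto simp: connected_components_of_def)
qed

definition stratum :: "motion set \<Rightarrow> plane \<Rightarrow> plane set topology" where
  "stratum \<Sigma> x = subtopology (underlying_space \<Sigma>)
     {P \<in> orbifold_points \<Sigma>. isotropy_type \<Sigma> P = isotropy_type \<Sigma> (motion_orbit \<Sigma> x)}"

lemma topspace_stratum: "topspace (stratum \<Sigma> x) =
    {motion_orbit \<Sigma> y | y. isotropy_type \<Sigma> (motion_orbit \<Sigma> y) = isotropy_type \<Sigma> (motion_orbit \<Sigma> x)}"
  by (auto simp: stratum_def underlying_space_def topspace_quotient_topology orbifold_points_def)

lemma isotropy_type_cong:
  assumes "subgroup \<Sigma> motion_group" "isotropy \<Sigma> y = isotropy \<Sigma> x"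
  shows "isotropy_type \<Sigma> (motion_orbit \<Sigma> y) = isotropy_type \<Sigma> (motion_orbit \<Sigma> x)"
  using assms by (simp add: isotropy_type_orbit)

lemma isotropy_type_reflects:
  assumes S: "subgroup \<Sigma> motion_group" and \<phi>: "conjugation_reflecting \<phi>"
    and eq: "isotropy_type \<Sigma> (motion_orbit \<Sigma> y) = isotropy_type \<Sigma> (motion_orbit \<Sigma> x)"
    and x: "\<phi> (isotropy \<Sigma> x)"
  shows "\<phi> (isotropy \<Sigma> y)"
proof -
  have "isotropy \<Sigma> x \<in> isotropy_type \<Sigma> (motion_orbit \<Sigma> y)"
    using isotropy_in_type[OF S, of x] unfolding eq .
  then obtain B where "orthogonal_matrix B" "isotropy \<Sigma> x = (\<lambda>A. B ** A ** transpose B) ` isotropy \<Sigma> y"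
    unfolding isotropy_type_orbit[OF S] by blast
  then show ?thesis using x \<phi> unfolding conjugation_reflecting_def by metis
qed

lemma connectedin_stratum_line:
  assumes "connected I" and "\<And>t. t \<in> I \<Longrightarrow>
      isotropy_type \<Sigma> (motion_orbit \<Sigma> (p + t *\<^sub>R u)) = isotropy_type \<Sigma> (motion_orbit \<Sigma> x)"
  shows "connectedin (stratum \<Sigma> x) ((\<lambda>t. motion_orbit \<Sigma> (p + t *\<^sub>R u)) ` I)"
proof -
  have "connectedin euclidean ((\<lambda>t. p + t *\<^sub>R u) ` I)"
    unfolding connectedin_iff_connected
    by (intro connected_continuous_image continuous_intros assms(1))
  then have "connectedin (underlying_space \<Sigma>) (motion_orbit \<Sigma> ` (\<lambda>t. p + t *\<^sub>R u) ` I)"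
    unfolding underlying_space_def
    by (rule connectedin_continuous_map_image[OF quotient_imp_continuous_map[OF quotient_map_quotient_topology]])
  then show ?thesis
    unfolding stratum_def connectedin_subtopology image_image
    using assms(2) by (auto simp: orbifold_points_def)
qed

lemma rotoinversion_refl: "rotoinversion_matrix refl_matrix" "rotoinversion_matrix (- refl_matrix)"
  using pmm.orth by (auto simp: rotoinversion_matrix_def det_matrices orthogonal_matrix_def)

text \<open>The open bottom side of the square. The reflections of all four sides are conjugate in
  O(2), so the four open sides share one isotropy type, and this side has to be separated from the
  other three.\<close>

definition pmm_edge :: "plane set set" where
  "pmm_edge = (\<lambda>t. motion_orbit pmm (0 + t *\<^sub>R pt 1 0)) ` {0<..<pi}"

lemma isotropy_pmm_edge:
  assumes "sin (x $ 1) \<noteq> 0" "sin (x $ 2) = 0"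
  shows "isotropy pmm x = {mat 1, refl_matrix}"
  using assms by (auto simp: isotropy_pmm)

text \<open>A reflection in the isotropy places x on a mirror, and the absence of a half-turn keeps
  it away from the corners. The isotropy type transports the first fact from the reference point to
  x, the second by contraposition.\<close>

lemma pmm_edge_stratum:
  assumes x: "isotropy_type pmm (motion_orbit pmm x) = isotropy_type pmm (motion_orbit pmm (pt (pi / 2) 0))"
  shows "sin (x $ 1) = 0 \<and> sin (x $ 2) \<noteq> 0 \<or> sin (x $ 1) \<noteq> 0 \<and> sin (x $ 2) = 0"
proof -
  have 0: "isotropy pmm (pt (pi / 2) 0) = {mat 1, refl_matrix}" by (rule isotropy_pmm_edge) auto
  have "has_reflection (isotropy pmm (pt (pi / 2) 0))"
    unfolding 0 has_reflection_def using det_matrices(1) by blast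
  then have "has_reflection (isotropy pmm x)"
    by (rule isotropy_type_reflects[OF pmm.subgroup_crys conjugation_reflecting_has_reflection x])
  then obtain A where A: "A \<in> isotropy pmm x" "det A = - 1" unfolding has_reflection_def by blast
  then have "A \<noteq> mat 1" "A \<noteq> - mat 1" using det_matrices(6,7) by auto
  then have "sin (x $ 1) = 0 \<or> sin (x $ 2) = 0" using A(1) unfolding isotropy_pmm by blast
  moreover have "\<not> half_turn_and_more (isotropy pmm (pt (pi / 2) 0))"
    unfolding 0 half_turn_and_more_def using mat1_neq(1) matrices_neq(2) by auto
  then have "\<not> half_turn_and_more (isotropy pmm x)"
    using isotropy_type_reflects[OF pmm.subgroup_crys conjugation_reflecting_half_turn_and_more x[symmetric]]
    by blast
  then have "\<not> (- mat 1 \<in> isotropy pmm x \<and> refl_matrix \<in> isotropy pmm x)"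
    unfolding half_turn_and_more_def using matrices_neq(1,2) by blast
  then have "\<not> (sin (x $ 1) = 0 \<and> sin (x $ 2) = 0)"
    unfolding isotropy_pmm by blast
  ultimately show ?thesis by blast
qed

lemma sin_zero_cos: "sin x = 0 \<longleftrightarrow> \<bar>cos x\<bar> = (1::real)"
proof -
  have "sin x = 0 \<longleftrightarrow> (sin x)\<^sup>2 = 0" by simp
  also have "\<dots> \<longleftrightarrow> (cos x)\<^sup>2 = 1" unfolding sin_squared_eq by auto
  finally show ?thesis by (simp add: abs_square_eq_1)
qed

lemma mem_pmm_edge: "motion_orbit pmm x \<in> pmm_edge \<longleftrightarrow> sin (x $ 1) \<noteq> 0 \<and> cos (x $ 2) = 1"
proof
  assume "motion_orbit pmm x \<in> pmm_edge"
  then obtain t where t: "0 < t" "t < pi" "motion_orbit pmm x = motion_orbit pmm (pt t 0)"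
    by (auto simp: pmm_edge_def plane_eq_iff pmm_orbit_eq_iff)
  then have c: "cos (x $ 1) = cos t" "cos (x $ 2) = 1" by (auto simp: pmm_orbit_eq_iff)
  have "sin t \<noteq> 0" using sin_gt_zero[OF t(1,2)] by simp
  then show "sin (x $ 1) \<noteq> 0 \<and> cos (x $ 2) = 1" using c by (simp add: sin_zero_cos)
next
  assume x: "sin (x $ 1) \<noteq> 0 \<and> cos (x $ 2) = 1"
  define t where "t = arccos (cos (x $ 1))"
  have ct: "cos t = cos (x $ 1)" by (simp add: t_def cos_arccos)
  then have "sin t \<noteq> 0" using x by (simp add: sin_zero_cos)
  then have "t \<noteq> 0" "t \<noteq> pi" by auto
  moreover have "0 \<le> t" "t \<le> pi" by (simp_all add: t_def arccos_lbound arccos_ubound)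
  ultimately have "t \<in> {0<..<pi}" by auto
  moreover have "motion_orbit pmm x = motion_orbit pmm (0 + t *\<^sub>R pt 1 0)"
    using x ct by (simp add: pmm_orbit_eq_iff)
  ultimately show "motion_orbit pmm x \<in> pmm_edge" unfolding pmm_edge_def by blast
qed

lemma openin_stratum_pmm:
  assumes "open {x::plane. Q (cos (x $ 1)) (cos (x $ 2))}"
  shows "openin (stratum pmm z) {P \<in> topspace (stratum pmm z). \<exists>x. P = motion_orbit pmm x \<and> Q (cos (x $ 1)) (cos (x $ 2))}"
proof -
  let ?U = "motion_orbit pmm ` {x. Q (cos (x $ 1)) (cos (x $ 2))}"
  have "{x \<in> topspace euclidean. motion_orbit pmm x \<in> ?U} = {x. Q (cos (x $ 1)) (cos (x $ 2))}"
    by (auto simp: pmm_orbit_eq_iff)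
  then have "openin (underlying_space pmm) ?U"
    unfolding underlying_space_def openin_quotient_topology using assms by auto
  then have "openin (stratum pmm z) (topspace (stratum pmm z) \<inter> ?U)"
    unfolding stratum_def openin_subtopology by auto
  moreover have "topspace (stratum pmm z) \<inter> ?U =
      {P \<in> topspace (stratum pmm z). \<exists>x. P = motion_orbit pmm x \<and> Q (cos (x $ 1)) (cos (x $ 2))}" by auto
  ultimately show ?thesis by simp
qed

text \<open>With a = cos x and b = cos y the stratum becomes the four open sides of the square
  [-1, 1]^2. On them |a| < b describes the side b = 1, and |a| > b the other three. Both
  inequalities are strict, so the edge and its complement are open.\<close>

lemma edge_dichotomy:
  fixes a b :: real
  assumes "\<bar>a\<bar> = 1 \<and> \<bar>b\<bar> \<noteq> 1 \<or> \<bar>a\<bar> \<noteq> 1 \<and> \<bar>b\<bar> = 1" "\<bar>a\<bar> \<le> 1" "\<bar>b\<bar> \<le> 1"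
  shows "(\<bar>a\<bar> \<noteq> 1 \<and> b = 1 \<longleftrightarrow> \<bar>a\<bar> < b) \<and> (\<not> (\<bar>a\<bar> \<noteq> 1 \<and> b = 1) \<longleftrightarrow> \<bar>a\<bar> > b)"
proof (cases "\<bar>a\<bar> = 1")
  case True
  then have "\<bar>b\<bar> < 1" using assms by (intro order.not_eq_order_implies_strict) auto
  then have "b < 1" by linarith
  then show ?thesis using True by simp
next
  case False
  then have "\<bar>a\<bar> < 1" using assms by (intro order.not_eq_order_implies_strict) auto
  moreover have "b = 1 \<or> b = - 1" using assms False by (auto simp: abs_if split: if_splits)
  moreover have "- 1 < \<bar>a\<bar>" "\<not> \<bar>a\<bar> < - 1" by linarith+
  ultimately show ?thesis by (elim disjE) simp_all
qed

lemma reflector_edge_pmm: "reflector_edge pmm pmm_edge"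
proof -
  let ?z = "pt (pi / 2) 0" and ?X = "stratum pmm (pt (pi / 2) 0)"
  have z: "isotropy pmm ?z = {mat 1, refl_matrix}" by (rule isotropy_pmm_edge) auto
  have sin0: "sin (x $ 2) = 0" if "cos (x $ 2) = 1" for x :: plane using that by (simp add: sin_zero_cos)
  have type: "isotropy_type pmm (motion_orbit pmm x) = isotropy_type pmm (motion_orbit pmm ?z)"
    if "motion_orbit pmm x \<in> pmm_edge" for x
  proof (rule isotropy_type_cong[OF pmm.subgroup_crys])
    have "sin (x $ 1) \<noteq> 0" "sin (x $ 2) = 0" using that sin0 unfolding mem_pmm_edge by auto
    then show "isotropy pmm x = isotropy pmm ?z" unfolding z by (rule isotropy_pmm_edge)
  qed
  have sub: "pmm_edge \<subseteq> topspace ?X"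
  proof
    fix P assume P: "P \<in> pmm_edge"
    then obtain x where x: "P = motion_orbit pmm x" unfolding pmm_edge_def by blast
    show "P \<in> topspace ?X"
      unfolding topspace_stratum mem_Collect_eq using type[of x] P unfolding x by blast
  qed
  have conn: "connectedin ?X pmm_edge"
    unfolding pmm_edge_def
    by (rule connectedin_stratum_line, simp) (rule type, unfold pmm_edge_def, blast)
  have open1: "open {x::plane. \<bar>cos (x $ 1)\<bar> < cos (x $ 2)}" and open2: "open {x::plane. \<bar>cos (x $ 1)\<bar> > cos (x $ 2)}"
    by (intro open_Collect_less continuous_intros)+
  have E1: "pmm_edge = {P \<in> topspace ?X. \<exists>x. P = motion_orbit pmm x \<and> \<bar>cos (x $ 1)\<bar> < cos (x $ 2)}"
    and E2: "topspace ?X - pmm_edge = {P \<in> topspace ?X. \<exists>x. P = motion_orbit pmm x \<and> \<bar>cos (x $ 1)\<bar> > cos (x $ 2)}"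
  proof -
    have *: "motion_orbit pmm x \<in> pmm_edge \<longleftrightarrow> \<bar>cos (x $ 1)\<bar> < cos (x $ 2)"
      "motion_orbit pmm x \<notin> pmm_edge \<longleftrightarrow> \<bar>cos (x $ 1)\<bar> > cos (x $ 2)"
      if xX: "motion_orbit pmm x \<in> topspace ?X" for x
    proof -
      obtain y where y: "motion_orbit pmm x = motion_orbit pmm y"
        "isotropy_type pmm (motion_orbit pmm y) = isotropy_type pmm (motion_orbit pmm ?z)"
        using xX unfolding topspace_stratum mem_Collect_eq by (elim exE conjE)
      have "sin (x $ 1) = 0 \<and> sin (x $ 2) \<noteq> 0 \<or> sin (x $ 1) \<noteq> 0 \<and> sin (x $ 2) = 0"
        by (rule pmm_edge_stratum) (simp only: y)
      then have c: "\<bar>cos (x $ 1)\<bar> = 1 \<and> \<bar>cos (x $ 2)\<bar> \<noteq> 1 \<or> \<bar>cos (x $ 1)\<bar> \<noteq> 1 \<and> \<bar>cos (x $ 2)\<bar> = 1"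
        unfolding sin_zero_cos .
      from edge_dichotomy[OF c abs_cos_le_one abs_cos_le_one] show "motion_orbit pmm x \<in> pmm_edge \<longleftrightarrow> \<bar>cos (x $ 1)\<bar> < cos (x $ 2)"
        "motion_orbit pmm x \<notin> pmm_edge \<longleftrightarrow> \<bar>cos (x $ 1)\<bar> > cos (x $ 2)"
        unfolding mem_pmm_edge sin_zero_cos by blast+
    qed
    have ob: "\<exists>x. P = motion_orbit pmm x" if "P \<in> topspace ?X" for P
      using that unfolding topspace_stratum mem_Collect_eq by (elim exE conjE) (rule exI)
    show "pmm_edge = {P \<in> topspace ?X. \<exists>x. P = motion_orbit pmm x \<and> \<bar>cos (x $ 1)\<bar> < cos (x $ 2)}"
    proof (intro subset_antisym subsetI)
      fix P assume P: "P \<in> pmm_edge"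
      then have PX: "P \<in> topspace ?X" using sub by (rule subsetD[rotated])
      then obtain x where x: "P = motion_orbit pmm x" using ob[OF PX] by (elim exE)
      have "\<bar>cos (x $ 1)\<bar> < cos (x $ 2)" using *(1)[of x] P PX unfolding x by iprover
      then show "P \<in> {P \<in> topspace ?X. \<exists>x. P = motion_orbit pmm x \<and> \<bar>cos (x $ 1)\<bar> < cos (x $ 2)}"
        using PX x by (intro CollectI conjI exI)
    next
      fix P assume "P \<in> {P \<in> topspace ?X. \<exists>x. P = motion_orbit pmm x \<and> \<bar>cos (x $ 1)\<bar> < cos (x $ 2)}"
      then obtain x where x: "P \<in> topspace ?X" "P = motion_orbit pmm x" "\<bar>cos (x $ 1)\<bar> < cos (x $ 2)"
        unfolding mem_Collect_eq by (elim conjE exE)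
      show "P \<in> pmm_edge" unfolding x(2) by (rule iffD2[OF *(1)[OF x(1)[unfolded x(2)]] x(3)])
    qed
    show "topspace ?X - pmm_edge = {P \<in> topspace ?X. \<exists>x. P = motion_orbit pmm x \<and> \<bar>cos (x $ 1)\<bar> > cos (x $ 2)}"
    proof (intro subset_antisym subsetI)
      fix P assume P: "P \<in> topspace ?X - pmm_edge"
      then have PX: "P \<in> topspace ?X" "P \<notin> pmm_edge" by simp_all
      then obtain x where x: "P = motion_orbit pmm x" using ob[OF PX(1)] by (elim exE)
      have "\<bar>cos (x $ 1)\<bar> > cos (x $ 2)" using *(2)[of x] PX unfolding x by (iprover)
      then show "P \<in> {P \<in> topspace ?X. \<exists>x. P = motion_orbit pmm x \<and> \<bar>cos (x $ 1)\<bar> > cos (x $ 2)}"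
        using PX(1) x by (intro CollectI conjI exI)
    next
      fix P assume "P \<in> {P \<in> topspace ?X. \<exists>x. P = motion_orbit pmm x \<and> \<bar>cos (x $ 1)\<bar> > cos (x $ 2)}"
      then obtain x where x: "P \<in> topspace ?X" "P = motion_orbit pmm x" "\<bar>cos (x $ 1)\<bar> > cos (x $ 2)"
        unfolding mem_Collect_eq by (elim conjE exE)
      have "P \<notin> pmm_edge" using *(2)[of x] x(1,3) unfolding x(2) by (iprover)
      then show "P \<in> topspace ?X - pmm_edge" using x(1) by (rule DiffI[rotated])
    qed
  qed
  have "openin ?X pmm_edge"
    by (subst E1) (rule openin_stratum_pmm[where Q="\<lambda>a b. \<bar>a\<bar> < b", OF open1])
  moreover have "openin ?X (topspace ?X - pmm_edge)"
    by (subst E2) (rule openin_stratum_pmm[where Q="\<lambda>a b. \<bar>a\<bar> > b", OF open2])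
  then have "closedin ?X pmm_edge" using sub by (simp add: closedin_def)
  moreover have "pmm_edge \<noteq> {}" by (simp add: pmm_edge_def not_le)
  ultimately have comp: "pmm_edge \<in> connected_components_of ?X"
    using conn by (intro clopen_connected_component)
  have "isotropy pmm x = {mat 1, refl_matrix}" if PE: "P \<in> pmm_edge" "x \<in> P" for P x
  proof -
    obtain t where "P = motion_orbit pmm (0 + t *\<^sub>R pt 1 0)" using PE(1) unfolding pmm_edge_def by blast
    then have "P = motion_orbit pmm x" using PE(2) pmm.orbit_eq_iff by blast
    then have "sin (x $ 1) \<noteq> 0" "cos (x $ 2) = 1" using PE(1) mem_pmm_edge by blast+
    then show ?thesis using sin0 by (intro isotropy_pmm_edge)
  qed
  then show ?thesis
    unfolding reflector_edge_def using comp rotoinversion_refl(1) unfolding stratum_def by blast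
qed

lemma edge_length_pmm: "edge_length pmm pmm_edge pi"
proof -
  have "inj_on (\<lambda>t. motion_orbit pmm (0 + t *\<^sub>R pt 1 0)) {0<..<pi}"
    by (rule inj_onI) (auto simp: pmm_orbit_eq_iff dest!: cos_inj_pi[rotated 4])
  moreover have "norm (pt 1 0) = 1" by (simp add: norm_eq_1 inner_plane)
  ultimately show ?thesis unfolding edge_length_def bij_betw_def pmm_edge_def using pi_gt_zero by blast
qed

text \<open>One mirror line suffices: half-turns exchange x = pi/2 and x = 3 pi/2 modulo periods.
  The parameter runs over all reals because the image is a closed curve.\<close>

definition pmg_edge :: "plane set set" where
  "pmg_edge = range (\<lambda>t. motion_orbit pmg (pt (pi / 2) 0 + t *\<^sub>R pt 0 1))"

lemma isotropy_pmg_edge: "cos (x $ 1) = 0 \<Longrightarrow> isotropy pmg x = {mat 1, - refl_matrix}"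
  using sin_or_cos[of "x $ 1"] by (auto simp: isotropy_pmg)

lemma pmg_orbit_iff: "y \<in> motion_orbit pmg x \<longleftrightarrow>
    pillow y = pillow x \<or> pillow y = pillow (refl_matrix *v x + pt pi 0)"
  unfolding pmg.mem_orbit_iff pillow_sphere_eq_iff ..

lemma cos_sin_3pi_half: "cos (3 * pi / 2) = 0" "sin (3 * pi / 2) = - 1"
  using cos_periodic_pi[of "pi / 2"] sin_periodic_pi[of "pi / 2"] by simp_all

lemma mem_pmg_edge: "motion_orbit pmg x \<in> pmg_edge \<longleftrightarrow> cos (x $ 1) = 0"
proof
  assume "motion_orbit pmg x \<in> pmg_edge"
  then obtain t where "x \<in> motion_orbit pmg (pt (pi / 2) 0 + t *\<^sub>R pt 0 1)"
    unfolding pmg_edge_def using pmg.orbit_eq_iff by blast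
  then show "cos (x $ 1) = 0" unfolding pmg_orbit_iff by (auto simp: pillow_def vec3_eq_iff cos_sin_3pi_half)
next
  assume c: "cos (x $ 1) = 0"
  then have "\<bar>sin (x $ 1)\<bar> = 1" using sin_cos_squared_add[of "x $ 1"] by (simp add: abs_square_eq_1)
  then have "sin (x $ 1) = 1 \<or> sin (x $ 1) = - 1" by linarith
  then obtain e where e: "sin (x $ 1) = e" "e = 1 \<or> e = - 1" by blast
  \<comment> \<open>The half-turn reverses the direction of the mirror; hence the sign
    \<open>e\<close>, the sine of the first coordinate, in the parameter.\<close>
  have "pillow (pt (pi / 2) 0 + (e * x $ 2) *\<^sub>R pt 0 1) = pillow x"
    using e c by (auto simp: pillow_def vec3_eq_iff)
  then have "motion_orbit pmg x = motion_orbit pmg (pt (pi / 2) 0 + (e * x $ 2) *\<^sub>R pt 0 1)"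
    unfolding pmg.orbit_eq_iff pmg_orbit_iff by simp
  then show "motion_orbit pmg x \<in> pmg_edge" unfolding pmg_edge_def by blast
qed

text \<open>All points whose isotropy is a reflection group form a single closed curve, so the edge
  is its entire stratum and is trivially open and closed there.\<close>

lemma reflector_edge_pmg: "reflector_edge pmg pmg_edge"
proof -
  let ?z = "pt (pi / 2) 0" and ?X = "stratum pmg (pt (pi / 2) 0)"
  have z: "isotropy pmg ?z = {mat 1, - refl_matrix}" by (rule isotropy_pmg_edge) simp
  have type: "isotropy_type pmg (motion_orbit pmg x) = isotropy_type pmg (motion_orbit pmg ?z)"
    if "motion_orbit pmg x \<in> pmg_edge" for x
  proof (rule isotropy_type_cong[OF pmg.subgroup_crys])
    show "isotropy pmg x = isotropy pmg ?z"
      unfolding z by (rule isotropy_pmg_edge) (use that in \<open>simp only: mem_pmg_edge\<close>)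
  qed
  have sub: "pmg_edge \<subseteq> topspace ?X"
  proof
    fix P assume P: "P \<in> pmg_edge"
    then obtain x where x: "P = motion_orbit pmg x" unfolding pmg_edge_def by blast
    show "P \<in> topspace ?X"
      unfolding topspace_stratum mem_Collect_eq using type[of x] P unfolding x by blast
  qed
  have "cos (x $ 1) = 0"
    if x: "isotropy_type pmg (motion_orbit pmg x) = isotropy_type pmg (motion_orbit pmg ?z)" for x
  proof -
    have "has_reflection (isotropy pmg ?z)"
      unfolding z has_reflection_def using det_matrices(2) by blast
    then have "has_reflection (isotropy pmg x)"
      by (rule isotropy_type_reflects[OF pmg.subgroup_crys conjugation_reflecting_has_reflection x])
    then obtain A where A: "A \<in> isotropy pmg x" "det A = - 1" unfolding has_reflection_def by blast
    then have "A \<noteq> mat 1" "A \<noteq> - mat 1" using det_matrices(6,7) by auto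
    then show ?thesis using A(1) unfolding isotropy_pmg by blast
  qed
  then have "topspace ?X \<subseteq> pmg_edge" unfolding topspace_stratum using mem_pmg_edge by blast
  then have top: "pmg_edge = topspace ?X" using sub by blast
  have conn: "connectedin ?X pmg_edge"
    unfolding pmg_edge_def
    by (rule connectedin_stratum_line, simp) (rule type, unfold pmg_edge_def, blast)
  have comp: "pmg_edge \<in> connected_components_of ?X"
    by (rule clopen_connected_component[OF conn]) (simp_all only: top openin_topspace closedin_topspace, use top in \<open>auto simp: pmg_edge_def\<close>)
  have "isotropy pmg x = {mat 1, - refl_matrix}" if PE: "P \<in> pmg_edge" "x \<in> P" for P x
  proof -
    obtain t where "P = motion_orbit pmg (pt (pi / 2) 0 + t *\<^sub>R pt 0 1)" using PE(1) unfolding pmg_edge_def by blast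
    then have "P = motion_orbit pmg x" using PE(2) pmg.orbit_eq_iff by blast
    then have "cos (x $ 1) = 0" using PE(1) mem_pmg_edge by blast
    then show ?thesis by (rule isotropy_pmg_edge)
  qed
  then show ?thesis
    unfolding reflector_edge_def using comp rotoinversion_refl(2) unfolding stratum_def by blast
qed

text \<open>On the mirror x = pi/2 the \<open>pillow\<close> coordinates are (0, cos t, sin t), and
  the remaining generator fixes these points of the surface. Identification therefore occurs only
  after a full period, whereas the edge of pmm has length pi.\<close>

lemma edge_length_pmg: "edge_length pmg pmg_edge (2 * pi)"
proof -
  let ?f = "\<lambda>t. motion_orbit pmg (pt (pi / 2) 0 + t *\<^sub>R pt 0 1)"
  have eq: "?f s = ?f t \<longleftrightarrow> (\<exists>k::int. t = s + 2 * pi * of_int k)" for s t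
    unfolding pmg.orbit_eq_iff pmg_orbit_iff sin_cos_eq_iff[symmetric]
    by (auto simp: pillow_def vec3_eq_iff cos_sin_3pi_half)
  have "inj_on ?f {0..<2 * pi}"
  proof (rule inj_onI)
    fix s t assume st: "s \<in> {0..<2 * pi}" "t \<in> {0..<2 * pi}" and "?f s = ?f t"
    then obtain k :: int where k: "t = s + 2 * pi * of_int k" unfolding eq by blast
    have "2 * pi * of_int k < 2 * pi * 1" "2 * pi * (- 1) < 2 * pi * of_int k"
      using st k unfolding atLeastLessThan_iff by linarith+
    then have "of_int k < (1::real)" "- 1 < real_of_int k"
      by (auto simp only: mult_less_cancel_left_pos[of "2 * pi"] pi_gt_zero mult_pos_pos zero_less_numeral)
    then have "k = 0" by linarith
    then show "s = t" using k by simp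
  qed
  moreover have "?f ` {0..<2 * pi} = pmg_edge"
  proof (intro subset_antisym subsetI)
    fix P assume "P \<in> pmg_edge"
    then obtain t where t: "P = ?f t" unfolding pmg_edge_def by blast
    define k where "k = \<lfloor>t / (2 * pi)\<rfloor>"
    have "of_int k \<le> t / (2 * pi)" "t / (2 * pi) < of_int k + 1" unfolding k_def by linarith+
    then have "t - 2 * pi * of_int k \<in> {0..<2 * pi}" by (auto simp: field_simps)
    moreover have "P = ?f (t - 2 * pi * of_int k)"
      unfolding t by (rule sym) (simp only: eq, rule exI[of _ k], simp)
    ultimately show "P \<in> ?f ` {0..<2 * pi}" by blast
  qed (auto simp: pmg_edge_def)
  moreover have "norm (pt 0 1) = 1" by (simp add: norm_eq_1 inner_plane)
  ultimately show ?thesis unfolding edge_length_def bij_betw_def using pi_gt_zero by (intro conjI exI[of _ "pt (pi/2) 0"] exI[of _ "pt 0 1"] disjI2) auto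
qed

theorem mainTheorem3:
  shows "\<exists>F :: motion set set.
    card F = 5 \<and>
    (\<forall>S\<in>F. closed_flat_2_orbifold S) \<and>
    pairwise isospectral1 F \<and>
    pairwise (\<lambda>S S'. \<not> isospectral0 S S') F \<and>
    pairwise (\<lambda>S S'. singularity_types S \<noteq> singularity_types S') F \<and>
    \<comment> \<open>(1)\<close>
    (\<exists>S\<in>F. \<exists>a>0. isometric_to_square S a \<and> spectrum1 S = square_abs_spectrum1 a) \<and>
    \<comment> \<open>(2)\<close>
    (\<exists>S\<in>F. underlying_space S homeomorphic_space sphere_space) \<and>
    (\<exists>S\<in>F. underlying_space S homeomorphic_space projective_plane) \<and>
    (\<exists>S\<in>F. \<exists>S'\<in>F. S \<noteq> S' \<and>
       underlying_space S homeomorphic_space disk_space \<and>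
       underlying_space S' homeomorphic_space disk_space) \<and>
    \<comment> \<open>(3)\<close>
    (\<exists>S\<in>F. \<exists>S'\<in>F. S \<noteq> S' \<and>
       (\<exists>E E' l l'. reflector_edge S E \<and> edge_length S E l \<and>
          reflector_edge S' E' \<and> edge_length S' E' l' \<and> l \<noteq> l')) \<and>
    (\<exists>S\<in>F. (\<exists>P. singular_point S P) \<and> (\<forall>P. singular_point S P \<longrightarrow> cone_point S P)) \<and>
    (\<exists>S\<in>F. locally_orientable S) \<and>
    (\<exists>S\<in>F. \<not> locally_orientable S)"
proof -
  define F where "F = {pmm, pmg, pgg, cmm, p4}"
  have mem: "pmm \<in> F" "pmg \<in> F" "pgg \<in> F" "cmm \<in> F" "p4 \<in> F" by (simp_all add: F_def)
  \<comment> \<open>Groups with different 0-spectra are different sets, so the computed dimensions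
    also show that the family has five members.\<close>
  have neq: "pmm \<noteq> pmg" "pmm \<noteq> pgg" "pmm \<noteq> cmm" "pmm \<noteq> p4" "pmg \<noteq> pgg" "pmg \<noteq> cmm" "pmg \<noteq> p4"
    "pgg \<noteq> cmm" "pgg \<noteq> p4" "cmm \<noteq> p4"
    using spectrum0_values_1 spectrum0_values_2 spectrum0_values_4 by auto
  have "card F = 5" unfolding F_def using neq by simp
  moreover have "\<forall>S\<in>F. closed_flat_2_orbifold S"
    unfolding F_def using pmm.closed_flat_2_orbifold_crys pmg.closed_flat_2_orbifold_crys
      pgg.closed_flat_2_orbifold_crys cmm.closed_flat_2_orbifold_crys p4.closed_flat_2_orbifold_crys
    by blast
  moreover have "pairwise isospectral1 F" unfolding F_def by (rule isospectral1_groups)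
  moreover have "pairwise (\<lambda>S S'. \<not> isospectral0 S S') F" unfolding F_def by (rule not_isospectral0_groups)
  moreover have "pairwise (\<lambda>S S'. singularity_types S \<noteq> singularity_types S') F"
    unfolding F_def by (rule singularity_types_groups)
  moreover have "\<exists>S\<in>F. \<exists>a>0. isometric_to_square S a \<and> spectrum1 S = square_abs_spectrum1 a"
    using mem(1) isometric_to_square_pmm spectrum1_square pi_gt_zero by blast
  moreover have "\<exists>S\<in>F. underlying_space S homeomorphic_space sphere_space"
    using mem(5) underlying_p4 by blast
  moreover have "\<exists>S\<in>F. underlying_space S homeomorphic_space projective_plane"
    using mem(3) underlying_pgg by blast
  moreover have "\<exists>S\<in>F. \<exists>S'\<in>F. S \<noteq> S' \<and> underlying_space S homeomorphic_space disk_space \<and>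
       underlying_space S' homeomorphic_space disk_space"
    using mem(1,2) neq(1) underlying_pmm underlying_pmg by blast
  moreover have "\<exists>S\<in>F. \<exists>S'\<in>F. S \<noteq> S' \<and> (\<exists>E E' l l'. reflector_edge S E \<and> edge_length S E l \<and>
          reflector_edge S' E' \<and> edge_length S' E' l' \<and> l \<noteq> l')"
  proof -
    have "pi \<noteq> 2 * pi" by simp
    then show ?thesis
      using mem(1,2) neq(1) reflector_edge_pmm edge_length_pmm reflector_edge_pmg edge_length_pmg by blast
  qed
  moreover have "\<exists>S\<in>F. (\<exists>P. singular_point S P) \<and> (\<forall>P. singular_point S P \<longrightarrow> cone_point S P)"
    using mem(5) singular_p4 cone_points_p4 by blast
  moreover have "\<exists>S\<in>F. locally_orientable S" using mem(5) locally_orientable_p4 by blast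
  moreover have "\<exists>S\<in>F. \<not> locally_orientable S" using mem(1) not_locally_orientable_pmm by blast
  ultimately show ?thesis by (intro exI[of _ F] conjI)
qed

end
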